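(* Assume that $-A$ generates a bounded analytic semigroup on a Hilbert space $\mathcal{H}$. Then for every $\beta\in(-1,\infty)$ the operator $\mathcal{M}_{-}$, initially defined on $L^2_{c}(0,\infty;dt,\mathsf{D}(A))$ by $$\mathcal{M}_{-}f(t)=\int_{t}^\infty Ae^{-(s-t)A}f(s)\,ds,\qquad t>0,$$ extends to a bounded operator on $L^2(0,\infty;t^\beta dt,\mathcal{H})$.
   Context: $\mathcal{H}$ is a Hilbert space with norm $\|\cdot\|$. "$-A$ generates a bounded analytic semigroup on $\mathcal{H}$" means that $A$ is a densely defined closed linear operator on $\mathcal{H}$ and $-A$ generates a bounded analytic semigroup $\{e^{-zA}:|\arg z|<\delta\}$ for some $0<\delta<\pi/2$. $\mathsf{D}(A)$ is the domain of $A$ (a Hilbert space for the graph norm). For $\beta\in\mathbf{R}$, $L^2(0,\infty;t^\beta dt,\mathcal{H})$ is the space of (classes of) strongly measurable $f:(0,\infty)\to\mathcal{H}$ with $\int_0^\infty\|f(t)\|^2t^\beta\,dt<\infty$. $L^2_{c}(0,\infty;dt,\mathsf{D}(A))$ is the space of $f\in L^2(0,\infty;dt,\mathsf{D}(A))$ with compact support in $(0,\infty)$. *)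

theory Defs
  imports "HOL-Analysis.Analysis"
begin

section \<open>Complex Hilbert spaces\<close>

class scaleC =
  fixes scaleC :: "complex \<Rightarrow> 'a \<Rightarrow> 'a" (infixr "*\<^sub>C" 75)

text \<open>The real inner product inherited from \<^class>\<open>real_inner\<close> is the real part of
  the complex one, so the inherited norm satisfies \<open>\<parallel>x\<parallel>\<^sup>2 = cinner x x\<close>.\<close>

class complex_inner = real_inner + scaleC +
  fixes cinner :: "'a \<Rightarrow> 'a \<Rightarrow> complex"
  assumes scaleC_add_right: "c *\<^sub>C (x + y) = c *\<^sub>C x + c *\<^sub>C y"
    and scaleC_add_left: "(c + d) *\<^sub>C x = c *\<^sub>C x + d *\<^sub>C x"
    and scaleC_scaleC: "c *\<^sub>C d *\<^sub>C x = (c * d) *\<^sub>C x"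
    and scaleR_scaleC: "r *\<^sub>R x = complex_of_real r *\<^sub>C x"
    and cinner_commute: "cinner x y = cnj (cinner y x)"
    and cinner_add_left: "cinner (x + y) z = cinner x z + cinner y z"
    and cinner_scaleC_left: "cinner (c *\<^sub>C x) y = c * cinner x y"
    and inner_eq_Re_cinner: "inner x y = Re (cinner x y)"

class chilbert_space = complex_inner + complete_space
begin
subclass banach ..
end

definition bounded_clinear :: "('a::complex_inner \<Rightarrow> 'b::complex_inner) \<Rightarrow> bool" where
  "bounded_clinear F \<longleftrightarrow> bounded_linear F \<and> (\<forall>c x. F (c *\<^sub>C x) = c *\<^sub>C F x)"


section \<open>Unbounded operators and bounded analytic semigroups\<close>

text \<open>An unbounded operator is a domain \<open>D\<close> with a map \<open>A\<close>, of which only the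
  values on \<open>D\<close> are meaningful.\<close>

definition densely_defined_closed_operator :: "'a::complex_inner set \<Rightarrow> ('a \<Rightarrow> 'a) \<Rightarrow> bool" where
  "densely_defined_closed_operator D A \<longleftrightarrow>
     0 \<in> D \<and>
     (\<forall>x\<in>D. \<forall>y\<in>D. x + y \<in> D \<and> A (x + y) = A x + A y) \<and>
     (\<forall>c. \<forall>x\<in>D. c *\<^sub>C x \<in> D \<and> A (c *\<^sub>C x) = c *\<^sub>C A x) \<and>
     closure D = UNIV \<and>
     closed {(x, A x) | x. x \<in> D}"

definition sector :: "real \<Rightarrow> complex set" where
  "sector \<delta> = {z. z \<noteq> 0 \<and> \<bar>Arg z\<bar> < \<delta>}"

text \<open>Analyticity is with respect to the operator norm. Boundedness and strong
  continuity at 0 are required on every strictly smaller sector.\<close>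

definition bounded_analytic_semigroup ::
    "real \<Rightarrow> (complex \<Rightarrow> 'a::complex_inner \<Rightarrow> 'a) \<Rightarrow> bool" where
  "bounded_analytic_semigroup \<delta> S \<longleftrightarrow>
     (\<forall>z \<in> sector \<delta>. bounded_clinear (S z)) \<and>
     (\<forall>x. S 0 x = x) \<and>
     (\<forall>z \<in> sector \<delta>. \<forall>w \<in> sector \<delta>. \<forall>x. S (z + w) x = S z (S w x)) \<and>
     (\<forall>z \<in> sector \<delta>. \<exists>S'. bounded_clinear S' \<and>
        ((\<lambda>w. onorm (\<lambda>x. (1 / (w - z)) *\<^sub>C (S w x - S z x) - S' x)) \<longlongrightarrow> 0) (at z)) \<and>
     (\<forall>\<delta>'. 0 < \<delta>' \<and> \<delta>' < \<delta> \<longrightarrow>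
        (\<forall>x. ((\<lambda>z. S z x) \<longlongrightarrow> x) (at 0 within sector \<delta>')) \<and>
        (\<exists>K. \<forall>z \<in> sector \<delta>'. onorm (S z) \<le> K))"

definition is_generator ::
    "(complex \<Rightarrow> 'a::complex_inner \<Rightarrow> 'a) \<Rightarrow> 'a set \<Rightarrow> ('a \<Rightarrow> 'a) \<Rightarrow> bool" where
  "is_generator S D G \<longleftrightarrow>
     D = {x. \<exists>y. ((\<lambda>t. (1 / t) *\<^sub>R (S (complex_of_real t) x - x)) \<longlongrightarrow> y) (at_right 0)} \<and>
     (\<forall>x\<in>D. ((\<lambda>t. (1 / t) *\<^sub>R (S (complex_of_real t) x - x)) \<longlongrightarrow> G x) (at_right 0))"


section \<open>Strong measurability and the Bochner integral\<close>

text \<open>The Bochner integral of HOL-Analysis is restricted to second-countable types, that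
  is, to separable spaces. The following is the same notion without that restriction:
  Borel measurability is replaced by strong measurability.\<close>

definition strongly_measurable :: "'s measure \<Rightarrow> ('s \<Rightarrow> 'b::real_normed_vector) \<Rightarrow> bool" where
  "strongly_measurable M f \<longleftrightarrow>
     (\<exists>s. (\<forall>i::nat. simple_function M (s i)) \<and> (AE x in M. (\<lambda>i. s i x) \<longlonglongrightarrow> f x))"

definition bochner_has_integral ::
    "'s measure \<Rightarrow> ('s \<Rightarrow> 'b::real_normed_vector) \<Rightarrow> 'b \<Rightarrow> bool" where
  "bochner_has_integral M f v \<longleftrightarrow>
     strongly_measurable M f \<and>
     (\<exists>s. (\<forall>i::nat. Bochner_Integration.simple_bochner_integrable M (s i)) \<and>
          (\<lambda>i. \<integral>\<^sup>+x. ennreal (norm (f x - s i x)) \<partial>M) \<longlonglongrightarrow> 0 \<and>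
          (\<lambda>i. Bochner_Integration.simple_bochner_integral M (s i)) \<longlonglongrightarrow> v)"

definition bochner_integrable :: "'s measure \<Rightarrow> ('s \<Rightarrow> 'b::real_normed_vector) \<Rightarrow> bool" where
  "bochner_integrable M f \<longleftrightarrow> (\<exists>v. bochner_has_integral M f v)"

definition bochner_integral :: "'s measure \<Rightarrow> ('s \<Rightarrow> 'b::real_normed_vector) \<Rightarrow> 'b" where
  "bochner_integral M f = (THE v. bochner_has_integral M f v)"


section \<open>Hilbert-space valued square-integrable functions\<close>

text \<open>The elements are functions; the classes modulo equality almost everywhere are taken
  into account by the notion of operator below.\<close>

definition L2_space :: "'s measure \<Rightarrow> ('s \<Rightarrow> 'b::real_normed_vector) set" where
  "L2_space M = {f. strongly_measurable M f \<and> (\<integral>\<^sup>+x. ennreal ((norm (f x))\<^sup>2) \<partial>M) < \<infinity>}"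

definition L2_norm :: "'s measure \<Rightarrow> ('s \<Rightarrow> 'b::real_normed_vector) \<Rightarrow> real" where
  "L2_norm M f = sqrt (enn2real (\<integral>\<^sup>+x. ennreal ((norm (f x))\<^sup>2) \<partial>M))"

definition bounded_operator_L2 ::
    "'s measure \<Rightarrow> (('s \<Rightarrow> 'b::complex_inner) \<Rightarrow> 's \<Rightarrow> 'b) \<Rightarrow> bool" where
  "bounded_operator_L2 M T \<longleftrightarrow>
     (\<forall>f \<in> L2_space M. T f \<in> L2_space M) \<and>
     (\<forall>f \<in> L2_space M. \<forall>g \<in> L2_space M.
        (AE x in M. f x = g x) \<longrightarrow> (AE x in M. T f x = T g x)) \<and>
     (\<forall>f \<in> L2_space M. \<forall>g \<in> L2_space M. AE x in M. T (\<lambda>y. f y + g y) x = T f x + T g x) \<and>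
     (\<forall>c. \<forall>f \<in> L2_space M. AE x in M. T (\<lambda>y. c *\<^sub>C f y) x = c *\<^sub>C T f x) \<and>
     (\<exists>C. \<forall>f \<in> L2_space M. L2_norm M (T f) \<le> C * L2_norm M f)"

definition extends_to_bounded_operator_L2 ::
    "'s measure \<Rightarrow> ('s \<Rightarrow> 'b::complex_inner) set \<Rightarrow> (('s \<Rightarrow> 'b) \<Rightarrow> 's \<Rightarrow> 'b) \<Rightarrow> bool" where
  "extends_to_bounded_operator_L2 M V F \<longleftrightarrow>
     V \<subseteq> L2_space M \<and>
     (\<exists>T. bounded_operator_L2 M T \<and> (\<forall>f \<in> V. AE x in M. T f x = F f x))"

text \<open>The measure \<open>t\<^sup>\<beta> dt\<close> on \<open>(0,\<infinity>)\<close>; its space is \<open>{0<..}\<close>, so values of functions at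
  \<open>t \<le> 0\<close> play no role.\<close>

definition half_line :: "real measure" where
  "half_line = restrict_space lborel {0<..}"

definition weighted_half_line :: "real \<Rightarrow> real measure" where
  "weighted_half_line \<beta> = density half_line (\<lambda>t. ennreal (t powr \<beta>))"

text \<open>The space \<open>L\<^sup>2\<^sub>c(0,\<infinity>; dt, D)\<close>, where \<open>D\<close> carries the graph norm of \<open>A\<close>: the
  approximating simple functions take values in \<open>D\<close> and converge in the graph norm.\<close>

definition L2c_domain :: "'a::complex_inner set \<Rightarrow> ('a \<Rightarrow> 'a) \<Rightarrow> (real \<Rightarrow> 'a) set" where
  "L2c_domain D A = {f.
     (\<forall>t>0. f t \<in> D) \<and>
     (\<exists>s. (\<forall>i::nat. simple_function half_line (s i) \<and> (\<forall>t>0. s i t \<in> D)) \<and>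
          (AE t in half_line. (\<lambda>i. s i t) \<longlonglongrightarrow> f t \<and> (\<lambda>i. A (s i t)) \<longlonglongrightarrow> A (f t))) \<and>
     (\<integral>\<^sup>+t. ennreal ((norm (f t))\<^sup>2 + (norm (A (f t)))\<^sup>2) \<partial>half_line) < \<infinity> \<and>
     (\<exists>K. compact K \<and> K \<subseteq> {0<..} \<and> (AE t in half_line. t \<notin> K \<longrightarrow> f t = 0))}"


section \<open>The operator\<close>

text \<open>Here \<open>S z\<close> stands for \<open>e\<^sup>-\<^sup>z\<^sup>A\<close>.\<close>

definition M_minus_integrand ::
    "('a::complex_inner \<Rightarrow> 'a) \<Rightarrow> (complex \<Rightarrow> 'a \<Rightarrow> 'a) \<Rightarrow> (real \<Rightarrow> 'a) \<Rightarrow> real \<Rightarrow> real \<Rightarrow> 'a" where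
  "M_minus_integrand A S f t s = A (S (complex_of_real (s - t)) (f s))"

definition M_minus ::
    "('a::complex_inner \<Rightarrow> 'a) \<Rightarrow> (complex \<Rightarrow> 'a \<Rightarrow> 'a) \<Rightarrow> (real \<Rightarrow> 'a) \<Rightarrow> real \<Rightarrow> 'a" where
  "M_minus A S f t = bochner_integral (restrict_space lborel {t<..}) (M_minus_integrand A S f t)"

end

theory Submission
  imports Defs "HOL-Complex_Analysis.Cauchy_Integral_Formula"
begin

text \<open>
  On step functions with mesh \<open>h\<close> the operator is, at the grid points, the discrete convolution
  with \<open>(I - R) R\<^sup>k\<close>, \<open>R = e\<^sup>-\<^sup>h\<^sup>A\<close>. The multiplier \<open>(I - R) \<Sum> z\<^sup>k R\<^sup>k\<close> is bounded for \<open>|z| = 1\<close>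
  uniformly in \<open>h\<close>, because analyticity gives \<open>\<parallel>A e\<^sup>-\<^sup>t\<^sup>A\<parallel> \<le> C / t\<close>, and Plancherel's identity for the finite
  Fourier transform turns this into an \<open>L\<^sup>2\<close> bound that does not depend on \<open>h\<close>; no vector-valued
  Fourier transform is needed. Approximation in the graph norm gives the case \<open>\<beta> = 0\<close>. For
  \<open>\<beta> > -1\<close>, the commutator of the operator with multiplication by \<open>t\<^sup>\<beta>\<^sup>/\<^sup>2\<close> has a kernel dominated by
  \<open>t\<^sup>-\<^sup>\<gamma> s\<^sup>\<gamma>\<^sup>-\<^sup>1\<close> on \<open>s > t\<close> with \<open>\<gamma> < 1/2\<close>, which Hardy's inequality controls.
\<close>

section \<open>Complex inner product spaces\<close>

text \<open>The obstacle is the kernel: \<open>norm (A (T r x))\<close> is only bounded by a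
  multiple of \<open>1 / r\<close>, which is integrable neither at 0 nor at infinity, so no absolute
  estimate can give the case \<beta> = 0. The cancellation is found in the discrete multiplier, and
  Plancherel's identity is where the Hilbert structure is essential; elsewhere inner products only
  serve as scalar test functionals.

  In the commutator the factor \<open>t powr a - s powr a\<close> vanishes on the diagonal and
  removes that singularity. What is left is homogeneous of degree -1, hence within reach of Hardy's
  inequality. The exponent is \<gamma> = 0 for \<beta> \<ge> 0 and \<gamma> = -\<beta>/2 otherwise,
  so that \<gamma> < 1/2 is the condition \<beta> > -1.

  On the initial domain \<open>A\<close> can be moved through the semigroup onto \<open>f\<close>,
  and the integral converges absolutely. The resulting bound in the graph norm is too strong for the
  theorem, but it gives uniform convergence of the images along approximations. So the
  \<open>L2\<close> bound for step functions survives the limit although the graph norm does not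
  occur in it.\<close>

lemma cinner_add_right: "cinner x (y + z) = cinner x y + cinner x (z :: 'a::complex_inner)"
  by (metis cinner_add_left cinner_commute complex_cnj_add)

lemma cinner_scaleC_right: "cinner x (c *\<^sub>C y) = cnj c * cinner x (y :: 'a::complex_inner)"
  by (metis cinner_commute cinner_scaleC_left complex_cnj_mult)

lemma scaleC_one [simp]: "1 *\<^sub>C x = (x :: 'a::complex_inner)"
  by (metis of_real_1 scaleR_one scaleR_scaleC)

lemma scaleC_zero_left [simp]: "0 *\<^sub>C x = (0 :: 'a::complex_inner)"
  by (metis of_real_0 scaleR_zero_left scaleR_scaleC)

lemma scaleC_zero_right [simp]: "c *\<^sub>C 0 = (0 :: 'a::complex_inner)"
  by (metis add_cancel_right_left scaleC_add_right)

lemma scaleC_minus_right: "c *\<^sub>C (- x) = - (c *\<^sub>C (x :: 'a::complex_inner))"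
  by (metis add.right_inverse add_eq_0_iff scaleC_add_right scaleC_zero_right)

lemma scaleC_diff_right: "c *\<^sub>C (x - y) = c *\<^sub>C x - c *\<^sub>C (y :: 'a::complex_inner)"
  by (metis add_uminus_conv_diff scaleC_add_right scaleC_minus_right)

lemma scaleC_minus_one: "(-1) *\<^sub>C x = - (x :: 'a::complex_inner)"
  by (metis of_real_1 of_real_minus scaleR_minus1_left scaleR_scaleC)

lemma scaleC_diff_left: "(c - d) *\<^sub>C x = c *\<^sub>C x - d *\<^sub>C (x :: 'a::complex_inner)"
proof -
  have "c *\<^sub>C x = (c - d) *\<^sub>C x + d *\<^sub>C x"
    by (simp flip: scaleC_add_left)
  then show ?thesis by simp
qed

lemma cinner_zero_left [simp]: "cinner 0 (x :: 'a::complex_inner) = 0"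
  by (metis cinner_scaleC_left mult_zero_left scaleC_zero_left)

lemma cinner_zero_right [simp]: "cinner (x :: 'a::complex_inner) 0 = 0"
  by (metis cinner_commute cinner_zero_left complex_cnj_zero)

lemma cinner_sum_left: "cinner (\<Sum>i\<in>I. f i) (y :: 'a::complex_inner) = (\<Sum>i\<in>I. cinner (f i) y)"
  by (induction I rule: infinite_finite_induct) (auto simp: cinner_add_left)

lemma cinner_sum_right: "cinner (y :: 'a::complex_inner) (\<Sum>i\<in>I. f i) = (\<Sum>i\<in>I. cinner y (f i))"
  by (induction I rule: infinite_finite_induct) (auto simp: cinner_add_right)

lemma scaleC_sum_right: "c *\<^sub>C (\<Sum>i\<in>I. f i) = (\<Sum>i\<in>I. c *\<^sub>C (f i :: 'a::complex_inner))"
  by (induction I rule: infinite_finite_induct) (auto simp: scaleC_add_right)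

lemma scaleC_sum_left: "(\<Sum>i\<in>I. f i) *\<^sub>C (x :: 'a::complex_inner) = (\<Sum>i\<in>I. f i *\<^sub>C x)"
  by (induction I rule: infinite_finite_induct) (auto simp: scaleC_add_left)

lemma cinner_self: "cinner x x = complex_of_real ((norm (x :: 'a::complex_inner))\<^sup>2)"
proof (rule complex_eqI)
  show "Re (cinner x x) = Re (complex_of_real ((norm x)\<^sup>2))"
    by (simp add: power2_norm_eq_inner flip: inner_eq_Re_cinner)
  have "cinner x x = cnj (cinner x x)" by (rule cinner_commute)
  then have "Im (cinner x x) = - Im (cinner x x)"
    by (metis cnj.simps(2))
  then show "Im (cinner x x) = Im (complex_of_real ((norm x)\<^sup>2))" by simp
qed

lemma norm_scaleC [simp]: "norm (c *\<^sub>C x) = cmod c * norm (x :: 'a::complex_inner)"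
proof -
  have "complex_of_real ((norm (c *\<^sub>C x))\<^sup>2) = (c * cnj c) * complex_of_real ((norm x)\<^sup>2)"
    unfolding cinner_self[symmetric] by (simp add: cinner_scaleC_left cinner_scaleC_right)
  also have "\<dots> = complex_of_real ((cmod c * norm x)\<^sup>2)"
    by (simp add: power_mult_distrib flip: complex_norm_square)
  finally have "complex_of_real ((norm (c *\<^sub>C x))\<^sup>2) = complex_of_real ((cmod c * norm x)\<^sup>2)" .
  then have "(norm (c *\<^sub>C x))\<^sup>2 = (cmod c * norm x)\<^sup>2"
    by (simp only: of_real_eq_iff)
  then show ?thesis by (simp add: power2_eq_iff_nonneg)
qed

lemma bounded_linear_scaleC_compose:
  fixes f :: "'b::real_normed_vector \<Rightarrow> 'a::complex_inner"
  assumes f: "bounded_linear f"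
  shows "bounded_linear (\<lambda>x. c *\<^sub>C f x)"
proof -
  interpret f: bounded_linear f by fact
  have "bounded_linear (\<lambda>x::'a. c *\<^sub>C x)"
    by (rule bounded_linear_intro[where K = "cmod c"])
       (auto simp: scaleC_add_right scaleR_scaleC scaleC_scaleC mult.commute)
  from bounded_linear_compose[OF this f] show ?thesis .
qed

lemma cinner_diff_left: "cinner (x - y) z = cinner x z - cinner y (z :: 'a::complex_inner)"
  by (metis add_diff_cancel cinner_add_left diff_add_cancel)

text \<open>A unimodular factor on \<open>x\<close> turns \<open>cinner x y\<close> into its
  modulus, which is then a real inner product; the real Cauchy-Schwarz inequality applies.\<close>

lemma norm_cinner_le: "cmod (cinner x y) \<le> norm x * norm (y :: 'a::complex_inner)"
proof (cases "cinner x y = 0")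
  case False
  define c where "c = cnj (cinner x y) / cmod (cinner x y)"
  have c: "cmod c = 1" using False by (simp add: c_def norm_divide)
  have "cinner (c *\<^sub>C x) y = cmod (cinner x y)"
    using False complex_norm_square[of "cinner x y"]
    by (simp add: cinner_scaleC_left c_def power2_eq_square mult.commute nonzero_divide_eq_eq)
  then have "cmod (cinner x y) = inner (c *\<^sub>C x) y"
    by (simp add: inner_eq_Re_cinner)
  also have "\<dots> \<le> norm (c *\<^sub>C x) * norm y" by (rule norm_cauchy_schwarz)
  finally show ?thesis by (simp add: c)
qed simp

lemma bounded_linear_cinner: "bounded_linear (\<lambda>x. cinner x (y :: 'a::complex_inner))"
proof
  show "\<exists>K. \<forall>x. cmod (cinner x y) \<le> norm x * K"
    using norm_cinner_le by blast
qed (auto simp: cinner_add_left scaleR_scaleC cinner_scaleC_left scaleR_conv_of_real)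

text \<open>Tested with \<open>y = x\<close>. It carries estimates for holomorphic scalar functions
  \<open>cinner (S z x) y\<close> back to vectors.\<close>

lemma norm_le_if_cinner_le:
  fixes x :: "'a::complex_inner"
  assumes "\<And>y. cmod (cinner x y) \<le> B * norm y" "0 \<le> B"
  shows "norm x \<le> B"
proof (cases "x = 0")
  case False
  have "norm x * norm x \<le> B * norm x"
    using assms(1)[of x] by (simp add: cinner_self norm_power power2_eq_square norm_mult)
  then show ?thesis using False by simp
qed (use assms in simp)

section \<open>Analytic semigroups on the positive half-line\<close>

text \<open>The real-variable content of analyticity, with \<open>T t\<close> for
  \<open>e^{-tA}\<close>. All later estimates use these facts and no complex times.
  \<open>norm_T_diff\<close> is the integrated form of \<open>norm_A_T\<close>, with the same
  constant; the discrete argument works with the former, the commutator with the latter.\<close>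

locale semigroup_estimates =
  fixes D :: "'a::chilbert_space set" and A :: "'a \<Rightarrow> 'a"
    and T :: "real \<Rightarrow> 'a \<Rightarrow> 'a" and K C :: real
  assumes D_zero: "0 \<in> D"
    and D_add: "x \<in> D \<Longrightarrow> y \<in> D \<Longrightarrow> x + y \<in> D"
    and A_add: "x \<in> D \<Longrightarrow> y \<in> D \<Longrightarrow> A (x + y) = A x + A y"
    and D_scaleC: "x \<in> D \<Longrightarrow> c *\<^sub>C x \<in> D"
    and A_scaleC: "x \<in> D \<Longrightarrow> A (c *\<^sub>C x) = c *\<^sub>C A x"
    and D_dense: "closure D = UNIV"
    and T_add: "0 \<le> t \<Longrightarrow> T t (x + y) = T t x + T t y"
    and T_scaleC: "0 \<le> t \<Longrightarrow> T t (c *\<^sub>C x) = c *\<^sub>C T t x"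
    and T_zero: "T 0 x = x"
    and T_plus: "0 \<le> s \<Longrightarrow> 0 \<le> t \<Longrightarrow> T (s + t) x = T s (T t x)"
    and K_ge_1: "1 \<le> K"
    and C_ge_0: "0 \<le> C"
    and norm_T: "0 \<le> t \<Longrightarrow> norm (T t x) \<le> K * norm x"
    and norm_T_diff: "0 < t \<Longrightarrow> t \<le> s \<Longrightarrow> norm (T t x - T s x) \<le> C * (s - t) / t * norm x"
    and continuous_T: "continuous_on {0..} (\<lambda>t. T t x)"
    and T_in_D: "0 < t \<Longrightarrow> T t x \<in> D"
    and norm_A_T: "0 < t \<Longrightarrow> norm (A (T t x)) \<le> C / t * norm x"
    and A_T: "0 \<le> t \<Longrightarrow> x \<in> D \<Longrightarrow> A (T t x) = T t (A x)"
    and deriv_T: "0 < t \<Longrightarrow> x \<in> D \<Longrightarrow>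
      ((\<lambda>t. T t x) has_vector_derivative - T t (A x)) (at t)"

section \<open>Sectors in the complex plane\<close>

lemma open_sector:
  assumes "\<delta> \<le> pi / 2"
  shows "open (sector \<delta>)"
proof -
  have "sector \<delta> = {z \<in> - \<real>\<^sub>\<le>\<^sub>0. Arg z \<in> {- \<delta><..<\<delta>}}"
  proof (intro Set.equalityI subsetI)
    fix z assume z: "z \<in> sector \<delta>"
    then have "\<bar>Arg z\<bar> < pi / 2" "z \<noteq> 0" using assms by (auto simp: sector_def)
    then have "0 < Re z"
      using cos_gt_zero_pi[of "Arg z"] Re_rcis[of "cmod z" "Arg z"] by (simp add: rcis_cmod_Arg)
    then have "z \<notin> \<real>\<^sub>\<le>\<^sub>0" by (simp add: complex_nonpos_Reals_iff)
    then show "z \<in> {z \<in> - \<real>\<^sub>\<le>\<^sub>0. Arg z \<in> {- \<delta><..<\<delta>}}"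
      using z by (auto simp: sector_def)
  qed (auto simp: sector_def)
  moreover have "open {z \<in> - \<real>\<^sub>\<le>\<^sub>0. Arg z \<in> {- \<delta><..<\<delta>}}"
    by (rule continuous_open_preimage[of _ Arg, unfolded vimage_def Int_def mem_Collect_eq, simplified])
       (auto intro!: continuous_at_imp_continuous_on continuous_at_Arg)
  ultimately show ?thesis by simp
qed


lemma sector_scaleR: "0 < s \<Longrightarrow> complex_of_real s * z \<in> sector \<delta> \<longleftrightarrow> z \<in> sector \<delta>"
  by (auto simp: sector_def mult.commute)

lemma of_real_in_sector: "0 < \<delta> \<Longrightarrow> 0 < s \<Longrightarrow> complex_of_real s \<in> sector \<delta>"
  by (auto simp: sector_def)

text \<open>Sectors are invariant under dilation, so one ball around 1 gives balls around every
  \<open>s\<close> with radius proportional to \<open>s\<close>. This proportionality produces the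
  factor \<open>1 / s\<close> in Cauchy's estimate.\<close>

lemma sector_cball:
  assumes "0 < \<delta>" "\<delta> \<le> pi / 2"
  obtains r where "0 < r" "r < 1" "\<And>s. 0 < s \<Longrightarrow> cball (complex_of_real s) (r * s) \<subseteq> sector \<delta>"
proof -
  have "1 \<in> sector \<delta>" using assms of_real_in_sector[of \<delta> 1] by simp
  then obtain r0 where r0: "0 < r0" "cball 1 r0 \<subseteq> sector \<delta>"
    using open_sector[OF assms(2)] by (meson open_contains_cball)
  define r where "r = min r0 (1/2)"
  have r: "0 < r" "r < 1" "cball 1 r \<subseteq> sector \<delta>" using r0 by (auto simp: r_def)
  have "z \<in> sector \<delta>" if "0 < s" "z \<in> cball (complex_of_real s) (r * s)" for s z
  proof -
    define w where "w = z / complex_of_real s"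
    have z: "z = complex_of_real s * w" using that by (simp add: w_def)
    have "complex_of_real s - z = complex_of_real s * (1 - w)" by (simp add: z algebra_simps)
    then have "s * cmod (1 - w) \<le> s * r"
      using that by (simp add: dist_norm norm_mult mult.commute)
    then have "w \<in> cball 1 r" using that by (simp add: dist_norm)
    then show ?thesis using r(3) that unfolding z sector_scaleR[OF that(1)] by blast
  qed
  with r show ?thesis by (intro that[of r]) auto
qed

section \<open>Consequences of holomorphy for the semigroup on the half-line\<close>

context
  fixes \<delta> :: real and S :: "complex \<Rightarrow> 'a::complex_inner \<Rightarrow> 'a"
  assumes S: "bounded_analytic_semigroup \<delta> S" and \<delta>: "0 < \<delta>" "\<delta> < pi / 2"
begin

lemma semigroup_bounded_linear: "z \<in> sector \<delta> \<Longrightarrow> bounded_linear (S z)"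
  using S by (auto simp: bounded_analytic_semigroup_def bounded_clinear_def)

lemma semigroup_derivative:
  assumes z: "z \<in> sector \<delta>"
  obtains S' where "bounded_linear S'"
    "\<And>x. ((\<lambda>w. (1 / (w - z)) *\<^sub>C (S w x - S z x)) \<longlongrightarrow> S' x) (at z)"
proof -
  obtain S' where S': "bounded_clinear S'" 
    "((\<lambda>w. onorm (\<lambda>x. (1 / (w - z)) *\<^sub>C (S w x - S z x) - S' x)) \<longlongrightarrow> 0) (at z)"
    using S z unfolding bounded_analytic_semigroup_def by blast
  have bl: "bounded_linear S'" using S' by (simp add: bounded_clinear_def)
  have "((\<lambda>w. (1 / (w - z)) *\<^sub>C (S w x - S z x)) \<longlongrightarrow> S' x) (at z)" for x
  proof -
    have "((\<lambda>w. (1 / (w - z)) *\<^sub>C (S w x - S z x) - S' x) \<longlongrightarrow> 0) (at z)"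
    proof (rule Lim_null_comparison)
      show "((\<lambda>w. onorm (\<lambda>x. (1 / (w - z)) *\<^sub>C (S w x - S z x) - S' x) * norm x) \<longlongrightarrow> 0) (at z)"
        using tendsto_mult_right[OF S'(2), of "norm x"] by simp
      have "\<forall>\<^sub>F w in at z. w \<in> sector \<delta>"
        using z open_sector[of \<delta>] \<delta> eventually_at_in_open' by fastforce
      then show "\<forall>\<^sub>F w in at z. norm ((1 / (w - z)) *\<^sub>C (S w x - S z x) - S' x)
          \<le> onorm (\<lambda>x. (1 / (w - z)) *\<^sub>C (S w x - S z x) - S' x) * norm x"
        by eventually_elim
           (intro onorm[of _ x] bounded_linear_sub bl bounded_linear_scaleC_compose
              semigroup_bounded_linear z, auto)
    qed
    then show ?thesis by (rule LIM_zero_cancel)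
  qed
  with bl show ?thesis using that by blast
qed

lemma semigroup_vector_derivative:
  assumes t: "0 < t"
    and S': "((\<lambda>w. (1 / (w - complex_of_real t)) *\<^sub>C (S w x - S (complex_of_real t) x)) \<longlongrightarrow> v)
      (at (complex_of_real t))"
  shows "((\<lambda>u. S (complex_of_real u) x) has_vector_derivative v) (at t)"
proof -
  have "filterlim complex_of_real (at (complex_of_real t)) (at t)"
    unfolding filterlim_at by (auto intro!: tendsto_intros eventually_at_topological[THEN iffD2])
  from filterlim_compose[OF S' this]
  have "((\<lambda>u. (1 / (u - t)) *\<^sub>R (S (complex_of_real u) x - S (complex_of_real t) x)) \<longlongrightarrow> v) (at t)"
    by (simp add: scaleR_scaleC)
  from tendsto_norm[OF LIM_zero[OF this]]
  have "((\<lambda>u. norm ((1 / (u - t)) *\<^sub>R (S (complex_of_real u) x - S (complex_of_real t) x) - v))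
      \<longlongrightarrow> 0) (at t)" by simp
  moreover have "\<forall>\<^sub>F u in at t.
      norm ((1 / (u - t)) *\<^sub>R (S (complex_of_real u) x - S (complex_of_real t) x) - v) =
      norm (S (complex_of_real u) x - S (complex_of_real t) x - (u - t) *\<^sub>R v) / norm (u - t)"
  proof (rule eventually_at_topological[THEN iffD2], rule exI[of _ UNIV], intro conjI ballI impI)
    fix u :: real assume u: "u \<noteq> t"
    define w where "w = S (complex_of_real u) x - S (complex_of_real t) x"
    have "(1 / (u - t)) *\<^sub>R w - v = (1 / (u - t)) *\<^sub>R (w - (u - t) *\<^sub>R v)"
      using u by (simp add: scaleR_diff_right)
    then show "norm ((1 / (u - t)) *\<^sub>R (S (complex_of_real u) x - S (complex_of_real t) x) - v) =
      norm (S (complex_of_real u) x - S (complex_of_real t) x - (u - t) *\<^sub>R v) / norm (u - t)"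
      by (simp add: w_def divide_inverse mult.commute)
  qed auto
  ultimately have "((\<lambda>u. norm (S (complex_of_real u) x - S (complex_of_real t) x - (u - t) *\<^sub>R v) / norm (u - t))
      \<longlongrightarrow> 0) (at t)"
    by (rule Lim_transform_eventually)
  then show ?thesis
    unfolding has_vector_derivative_def has_derivative_iff_norm
    by (simp add: bounded_linear_scaleR_left)
qed

lemma semigroup_has_vector_derivative:
  assumes t: "0 < t"
  obtains v where "((\<lambda>u. S (complex_of_real u) x) has_vector_derivative v) (at t)"
proof -
  have "\<exists>S'. \<forall>x. ((\<lambda>w. (1 / (w - complex_of_real t)) *\<^sub>C (S w x - S (complex_of_real t) x))
      \<longlongrightarrow> S' x) (at (complex_of_real t))"
    by (rule semigroup_derivative[OF of_real_in_sector[OF \<delta>(1) t]]) auto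
  then obtain S' where S': "((\<lambda>w. (1 / (w - complex_of_real t)) *\<^sub>C (S w x - S (complex_of_real t) x))
      \<longlongrightarrow> S' x) (at (complex_of_real t))"
    by auto
  show ?thesis by (rule that[OF semigroup_vector_derivative[OF t S']])
qed

text \<open>The scalar functions \<open>cinner (S z x) y\<close> are holomorphic and bounded on a
  smaller sector. Cauchy's inequality on circles of radius proportional to \<open>s\<close> bounds
  their derivative at \<open>s\<close> by a multiple of \<open>1 / s\<close>, and the mean value
  inequality on \<open>{t..s}\<close> gives the Lipschitz bound.\<close>

lemma semigroup_bounds:
  obtains K C where "1 \<le> K" "0 \<le> C"
    "\<And>t x. 0 \<le> t \<Longrightarrow> norm (S (complex_of_real t) x) \<le> K * norm x"
    "\<And>t s x. 0 < t \<Longrightarrow> t \<le> s \<Longrightarrow>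
      norm (S (complex_of_real t) x - S (complex_of_real s) x) \<le> C * (s - t) / t * norm x"
proof -
  \<comment> \<open>Uniform bounds are available on strictly smaller sectors only; half the angle is
    one choice.\<close>
  have \<delta>2: "0 < \<delta> / 2" "\<delta> / 2 \<le> pi / 2" "\<delta> / 2 < \<delta>" using \<delta> by auto
  have sub: "sector (\<delta> / 2) \<subseteq> sector \<delta>" using \<delta> by (auto simp: sector_def)
  obtain K0 where K0: "\<And>z. z \<in> sector (\<delta> / 2) \<Longrightarrow> onorm (S z) \<le> K0"
    using S \<delta>2 unfolding bounded_analytic_semigroup_def by blast
  \<comment> \<open>At least 1, so that the bound also covers \<open>t = 0\<close>, which lies in no
    sector and where the semigroup is the identity.\<close>
  define K where "K = max 1 K0"
  have K: "norm (S z x) \<le> K * norm x" if "z \<in> sector (\<delta> / 2)" for z x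
  proof -
    have "norm (S z x) \<le> onorm (S z) * norm x"
      using that sub semigroup_bounded_linear by (intro onorm) blast
    also have "\<dots> \<le> K * norm x"
      using K0[OF that] by (intro mult_right_mono) (auto simp: K_def)
    finally show ?thesis .
  qed
  have K1: "1 \<le> K" by (simp add: K_def)
  obtain r where r: "0 < r" "r < 1"
    "\<And>s. 0 < s \<Longrightarrow> cball (complex_of_real s) (r * s) \<subseteq> sector (\<delta> / 2)"
    using sector_cball[OF \<delta>2(1,2)] by blast
  \<comment> \<open>Cauchy's inequality with radius \<open>r * s\<close> gives the bound
    \<open>K / (r * s)\<close> for the derivative at \<open>s\<close>.\<close>
  define C where "C = K / r"
  have "0 \<le> C" using K1 r by (simp add: C_def)
  have dphi: "\<exists>d. ((\<lambda>z. cinner (S z x) y) has_field_derivative d) (at z)" if "z \<in> sector \<delta>" for x y z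
  proof -
    obtain S' where "((\<lambda>w. (1 / (w - z)) *\<^sub>C (S w x - S z x)) \<longlongrightarrow> S' x) (at z)"
      using semigroup_derivative[OF \<open>z \<in> sector \<delta>\<close>] by blast
    from bounded_linear.tendsto[OF bounded_linear_cinner this, of y]
    have "((\<lambda>w. (cinner (S w x) y - cinner (S z x) y) / (w - z)) \<longlongrightarrow> cinner (S' x) y) (at z)"
      by (simp add: cinner_scaleC_left cinner_diff_left)
    then show ?thesis unfolding has_field_derivative_iff by blast
  qed
  have ddphi: "cmod (deriv (\<lambda>z. cinner (S z x) y) (complex_of_real s)) \<le> C / s * (norm x * norm y)"
    if s: "0 < s" for x y s
  proof -
    let ?f = "\<lambda>z. cinner (S z x) y"
    have hol: "?f holomorphic_on cball (complex_of_real s) (r * s)"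
      unfolding holomorphic_on_def field_differentiable_def
      using dphi r(3)[OF s] sub by (meson has_field_derivative_at_within subsetD)
    have "cmod ((deriv ^^ 1) ?f (complex_of_real s)) \<le> fact 1 * (K * norm x * norm y) / (r * s) ^ 1"
    proof (rule Cauchy_inequality)
      fix z assume "cmod (complex_of_real s - z) = r * s"
      then have "z \<in> sector (\<delta> / 2)" using r(3)[OF s] by (auto simp: dist_norm)
      then have "norm (S z x) * norm y \<le> K * norm x * norm y"
        by (intro mult_right_mono K) auto
      with norm_cinner_le show "cmod (cinner (S z x) y) \<le> K * norm x * norm y"
        by (rule order_trans)
    qed (use hol s r in \<open>auto intro: holomorphic_on_imp_continuous_on holomorphic_on_subset\<close>)
    then show ?thesis by (simp add: C_def field_simps)
  qed
  have "norm (S (complex_of_real t) x - S (complex_of_real s) x) \<le> C * (s - t) / t * norm x"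
    if "0 < t" "t \<le> s" for t s x
  proof (rule norm_le_if_cinner_le)
    fix y
    let ?f = "\<lambda>z. cinner (S z x) y"
    have "cmod (?f (complex_of_real t) - ?f (complex_of_real s)) \<le>
        C / t * (norm x * norm y) * cmod (complex_of_real t - complex_of_real s)"
    proof (rule field_differentiable_bound[where S = "complex_of_real ` {t..s}"])
      show "convex (complex_of_real ` {t..s})"
        by (intro convex_linear_image) (auto simp: linear_of_real)
    next
      fix z assume "z \<in> complex_of_real ` {t..s}"
      then obtain u where u: "z = complex_of_real u" "t \<le> u" "u \<le> s" by auto
      then have "z \<in> sector \<delta>" using \<open>0 < t\<close> \<delta> of_real_in_sector[of \<delta> u] by simp
      from dphi[OF this] show "(?f has_field_derivative deriv ?f z) (at z within complex_of_real ` {t..s})"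
        by (metis DERIV_imp_deriv has_field_derivative_at_within)
      have "C / u \<le> C / t" using \<open>0 \<le> C\<close> u that by (simp add: frac_le)
      then have "C / u * (norm x * norm y) \<le> C / t * (norm x * norm y)"
        by (intro mult_right_mono) auto
      with ddphi[of u x y] u that show "cmod (deriv ?f z) \<le> C / t * (norm x * norm y)"
        by simp
    qed (use that in auto)
    moreover have "cmod (complex_of_real t - complex_of_real s) = s - t"
      using that by (simp flip: of_real_diff)
    ultimately show "cmod (cinner (S (complex_of_real t) x - S (complex_of_real s) x) y) \<le>
        C * (s - t) / t * norm x * norm y"
      by (simp add: cinner_diff_left field_simps)
  qed (use that \<open>0 \<le> C\<close> in auto)
  moreover have "norm (S (complex_of_real t) x) \<le> K * norm x" if "0 \<le> t" for t x
  proof (cases "t = 0")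
    case True
    have "S 0 x = x" using S by (simp add: bounded_analytic_semigroup_def)
    then show ?thesis using K1 mult_right_mono[of 1 K "norm x"] True by simp
  next
    case False
    then show ?thesis using that \<delta>2(1) by (intro K of_real_in_sector) auto
  qed
  ultimately show ?thesis using that K1 \<open>0 \<le> C\<close> by blast
qed

text \<open>At 0 this is the strong continuity within a smaller sector, which contains the positive
  axis; at positive times the orbit is even differentiable.\<close>

lemma semigroup_continuous: "continuous_on {0..} (\<lambda>t. S (complex_of_real t) x)"
  unfolding continuous_on_def
proof
  fix t :: real assume "t \<in> {0..}"
  then consider "t = 0" | "0 < t" by fastforce
  then show "((\<lambda>t. S (complex_of_real t) x) \<longlongrightarrow> S (complex_of_real t) x) (at t within {0..})"
  proof cases
    case 1
    have "((\<lambda>z. S z x) \<longlongrightarrow> x) (at 0 within sector (\<delta> / 2))"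
      using S \<delta> half_gt_zero[of \<delta>] unfolding bounded_analytic_semigroup_def by auto
    moreover have "filterlim complex_of_real (at 0 within sector (\<delta> / 2)) (at 0 within {0..})"
      unfolding filterlim_at
    proof
      show "\<forall>\<^sub>F x in at 0 within {0..}. complex_of_real x \<in> sector (\<delta> / 2) \<and> complex_of_real x \<noteq> 0"
        using \<delta> of_real_in_sector[of "\<delta> / 2"] by (auto simp: eventually_at_filter)
      show "(complex_of_real \<longlongrightarrow> 0) (at 0 within {0..})"
        by (rule tendsto_eq_intros | simp)+
    qed
    moreover have "S 0 x = x" using S by (simp add: bounded_analytic_semigroup_def)
    ultimately show ?thesis using 1 filterlim_compose by fastforce
  next
    case 2
    obtain v where "((\<lambda>u. S (complex_of_real u) x) has_vector_derivative v) (at t)"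
      by (rule semigroup_has_vector_derivative[OF 2])
    from has_vector_derivative_continuous[OF this]
    show ?thesis
      using continuous_at_imp_continuous_at_within continuous_within by blast
  qed
qed

lemma semigroup_plus:
  assumes "0 \<le> s" "0 \<le> t"
  shows "S (complex_of_real (s + t)) x = S (complex_of_real s) (S (complex_of_real t) x)"
proof -
  have "S 0 y = y" for y using S by (simp add: bounded_analytic_semigroup_def)
  moreover have "S (complex_of_real (s + t)) x = S (complex_of_real s) (S (complex_of_real t) x)"
    if "0 < s" "0 < t"
    using S \<delta> that of_real_in_sector unfolding bounded_analytic_semigroup_def by simp
  ultimately show ?thesis using assms by (cases "s = 0"; cases "t = 0") auto
qed

end

lemma has_vector_derivative_right_quotient:
  fixes f :: "real \<Rightarrow> 'a::real_normed_vector"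
  assumes "(f has_vector_derivative v) (at t)"
  shows "((\<lambda>h. (1 / h) *\<^sub>R (f (t + h) - f t)) \<longlongrightarrow> v) (at_right 0)"
proof (rule LIM_zero_cancel, rule Lim_null_comparison)
  have "((\<lambda>h. norm (f (t + h) - f t - h *\<^sub>R v) / norm h) \<longlongrightarrow> 0) (at 0)"
    using assms unfolding has_vector_derivative_def has_derivative_at by simp
  then show "((\<lambda>h. norm (f (t + h) - f t - h *\<^sub>R v) / norm h) \<longlongrightarrow> 0) (at_right 0)"
    by (rule filterlim_mono) (auto simp: at_le)
  show "\<forall>\<^sub>F h in at_right 0. norm ((1 / h) *\<^sub>R (f (t + h) - f t) - v) \<le> norm (f (t + h) - f t - h *\<^sub>R v) / norm h"
  proof (rule eventually_at_right_less[THEN eventually_mono])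
    fix h :: real assume "0 < h"
    then have "(1 / h) *\<^sub>R (f (t + h) - f t) - v = (1 / h) *\<^sub>R (f (t + h) - f t - h *\<^sub>R v)"
      by (simp add: scaleR_diff_right)
    then show "norm ((1 / h) *\<^sub>R (f (t + h) - f t) - v) \<le> norm (f (t + h) - f t - h *\<^sub>R v) / norm h"
      using \<open>0 < h\<close> by (simp add: divide_inverse mult.commute)
  qed
qed

text \<open>Orbits of an analytic semigroup are differentiable at every positive time for every
  initial vector. Through the definition of the generator this becomes \<open>T t x \<in> D\<close>,
  and the Lipschitz bound becomes the bound on \<open>A (T t x)\<close>.\<close>

lemma bounded_analytic_semigroup_estimates:
  fixes D :: "'a::chilbert_space set"
  assumes A: "densely_defined_closed_operator D A"
    and \<delta>: "0 < \<delta>" "\<delta> < pi / 2"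
    and S: "bounded_analytic_semigroup \<delta> S"
    and G: "is_generator S D (\<lambda>x. - A x)"
  obtains K C where "semigroup_estimates D A (\<lambda>t. S (complex_of_real t)) K C"
proof -
  let ?T = "\<lambda>t. S (complex_of_real t)"
  obtain K C where K: "1 \<le> K" "0 \<le> C"
    "\<And>t x. 0 \<le> t \<Longrightarrow> norm (?T t x) \<le> K * norm x"
    "\<And>t s x. 0 < t \<Longrightarrow> t \<le> s \<Longrightarrow> norm (?T t x - ?T s x) \<le> C * (s - t) / t * norm x"
    using semigroup_bounds[OF S \<delta>] by blast
  have T0: "?T 0 x = x" for x using S by (simp add: bounded_analytic_semigroup_def)
  have lin: "bounded_linear (?T t) \<and> (\<forall>c x. ?T t (c *\<^sub>C x) = c *\<^sub>C ?T t x)" if "0 \<le> t" for t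
  proof (cases "t = 0")
    case False
    then show ?thesis
      using S of_real_in_sector[of \<delta> t] \<delta> that
      unfolding bounded_analytic_semigroup_def bounded_clinear_def by simp
  next
    case True
    have "S 0 = (\<lambda>x. x)" using T0 by auto
    then show ?thesis using True by (simp add: bounded_linear_ident)
  qed
  have plus: "?T (s + t) x = ?T s (?T t x)" if "0 \<le> s" "0 \<le> t" for s t x
    by (rule semigroup_plus[OF S \<delta> that])
  \<comment> \<open>The generator is given by the existence of a limit; uniqueness of limits turns
    any computed limit into both membership in \<open>D\<close> and the value of
    \<open>A\<close>.\<close>
  have gen: "x \<in> D \<and> A x = - y"
    if "((\<lambda>t. (1 / t) *\<^sub>R (?T t x - x)) \<longlongrightarrow> y) (at_right 0)" for x y
  proof -
    have "x \<in> D" using G that unfolding is_generator_def by blast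
    moreover from this have "((\<lambda>t. (1 / t) *\<^sub>R (?T t x - x)) \<longlongrightarrow> - A x) (at_right 0)"
      using G unfolding is_generator_def by blast
    from tendsto_unique[OF _ this that] have "- A x = y" by simp
    ultimately show ?thesis by auto
  qed
  \<comment> \<open>By the semigroup law, the right difference quotient of the orbit at
    \<open>t\<close> is the generator's quotient at the point \<open>?T t x\<close>.\<close>
  have vd: "(\<exists>v. (?T t x \<in> D \<and> A (?T t x) = - v) \<and> ((\<lambda>u. ?T u x) has_vector_derivative v) (at t))"
    if t: "0 < t" for t x
  proof -
    obtain v where d: "((\<lambda>u. ?T u x) has_vector_derivative v) (at t)"
      by (rule semigroup_has_vector_derivative[OF S \<delta> t])
    have "((\<lambda>h. (1 / h) *\<^sub>R (?T h (?T t x) - ?T t x)) \<longlongrightarrow> v) (at_right 0)"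
    proof (rule Lim_transform_eventually[OF has_vector_derivative_right_quotient[OF d]])
      show "\<forall>\<^sub>F h in at_right 0. (1 / h) *\<^sub>R (?T (t + h) x - ?T t x) =
          (1 / h) *\<^sub>R (?T h (?T t x) - ?T t x)"
        by (rule eventually_at_right_less[THEN eventually_mono])
           (use t plus in \<open>simp add: add.commute del: of_real_add\<close>)
    qed
    from gen[OF this] d show ?thesis by auto
  qed
  \<comment> \<open>The bounded operator \<open>?T t\<close> commutes with \<open>?T h\<close>,
    hence can be pulled through the quotient that defines the generator.\<close>
  have AT: "?T t x \<in> D \<and> A (?T t x) = ?T t (A x)" if t: "0 \<le> t" and x: "x \<in> D" for t x
  proof -
    interpret bounded_linear "?T t" using lin t by simp
    have "((\<lambda>h. (1 / h) *\<^sub>R (?T h x - x)) \<longlongrightarrow> - A x) (at_right 0)"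
      using G x unfolding is_generator_def by blast
    then have "((\<lambda>h. ?T t ((1 / h) *\<^sub>R (?T h x - x))) \<longlongrightarrow> ?T t (- A x)) (at_right 0)"
      by (rule tendsto)
    moreover have "\<forall>\<^sub>F h in at_right 0. ?T t ((1 / h) *\<^sub>R (?T h x - x)) =
        (1 / h) *\<^sub>R (?T h (?T t x) - ?T t x)"
    proof (rule eventually_at_right_less[THEN eventually_mono])
      fix h :: real assume h: "0 < h"
      have "?T t (?T h x) = ?T h (?T t x)"
        using plus[of t h x] plus[of h t x] t h by (simp add: add.commute)
      then show "?T t ((1 / h) *\<^sub>R (?T h x - x)) = (1 / h) *\<^sub>R (?T h (?T t x) - ?T t x)"
        by (simp add: scaleR diff)
    qed
    ultimately have "((\<lambda>h. (1 / h) *\<^sub>R (?T h (?T t x) - ?T t x)) \<longlongrightarrow> ?T t (- A x)) (at_right 0)"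
      by (rule Lim_transform_eventually)
    from gen[OF this] show ?thesis by (simp add: neg)
  qed
  have "semigroup_estimates D A ?T K C"
  proof
    show "0 \<in> D" "closure D = UNIV" "\<And>x y. x \<in> D \<Longrightarrow> y \<in> D \<Longrightarrow> x + y \<in> D"
      "\<And>x y. x \<in> D \<Longrightarrow> y \<in> D \<Longrightarrow> A (x + y) = A x + A y"
      "\<And>x c. x \<in> D \<Longrightarrow> c *\<^sub>C x \<in> D" "\<And>x c. x \<in> D \<Longrightarrow> A (c *\<^sub>C x) = c *\<^sub>C A x"
      using A unfolding densely_defined_closed_operator_def by auto
    show "?T t (x + y) = ?T t x + ?T t y" if "0 \<le> t" for t x y
      using lin[OF that] bounded_linear.linear linear_add by blast
    show "?T t (c *\<^sub>C x) = c *\<^sub>C ?T t x" if "0 \<le> t" for t c x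
      using lin[OF that] by blast
    show "continuous_on {0..} (\<lambda>t. ?T t x)" for x
      by (rule semigroup_continuous[OF S \<delta>])
    show "((\<lambda>t. ?T t x) has_vector_derivative - ?T t (A x)) (at t)" if "0 < t" "x \<in> D" for t x
      using vd[OF that(1)] AT[of t x] that by (metis add.inverse_inverse less_imp_le)
    show "norm (A (?T t x)) \<le> C / t * norm x" if t: "0 < t" for t x
    proof -
      obtain v where v: "A (?T t x) = - v" "((\<lambda>u. ?T u x) has_vector_derivative v) (at t)"
        using vd[OF t] by blast
      \<comment> \<open>The Lipschitz bound, divided by \<open>h\<close>, is independent of
        \<open>h\<close> and survives the limit; so the constant is again \<open>C\<close>.\<close>
      have "norm v \<le> C / t * norm x"
      proof (rule tendsto_upperbound[OF tendsto_norm[OF has_vector_derivative_right_quotient[OF v(2)]]])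
        show "\<forall>\<^sub>F h in at_right 0. norm ((1 / h) *\<^sub>R (?T (t + h) x - ?T t x)) \<le> C / t * norm x"
        proof (rule eventually_at_right_less[THEN eventually_mono])
          fix h :: real assume h: "0 < h"
          have "norm (?T (t + h) x - ?T t x) \<le> h * (C / t * norm x)"
            using K(4)[of t "t + h" x] t h by (simp add: norm_minus_commute mult.left_commute)
          then show "norm ((1 / h) *\<^sub>R (?T (t + h) x - ?T t x)) \<le> C / t * norm x"
            using h by (simp add: divide_inverse[symmetric] pos_divide_le_eq mult.commute)
        qed
      qed simp
      then show ?thesis using v by simp
    qed
    show "?T t x \<in> D" if "0 < t" for t x using vd[OF that] by blast
  qed (use K T0 plus AT in auto)
  then show ?thesis using that by blast
qed

section \<open>The discrete convolution\<close>

text \<open>A geometric sum whose ratio is an \<open>N\<close>-th root of unity; injectivity of the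
  roots on \<open>{..<N}\<close> shows that the ratio is 1 only for \<open>m = m'\<close>.\<close>

lemma sum_roots_of_unity:
  fixes N m m' :: nat
  defines "z \<equiv> \<lambda>j. cis (2 * pi * real j / real N)"
  assumes "m < N" "m' < N"
  shows "(\<Sum>j<N. z j ^ m * cnj (z j) ^ m') = (if m = m' then of_nat N else 0)"
proof -
  \<comment> \<open>The angle depends on the product \<open>j * n\<close> only, so index and
    exponent may be exchanged.\<close>
  have zpow: "z j ^ n = z n ^ j" for j n
    unfolding z_def Complex.DeMoivre by (rule arg_cong[where f = cis]) simp
  have "z j ^ m * cnj (z j) ^ m' = (z m * cnj (z m')) ^ j" for j
    by (simp add: zpow power_mult_distrib flip: complex_cnj_power)
  then have eq: "(\<Sum>j<N. z j ^ m * cnj (z j) ^ m') = (\<Sum>j<N. (z m * cnj (z m')) ^ j)" by simp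
  have cn: "z n * cnj (z n) = 1" for n 
    by (simp add: z_def flip: complex_norm_square)
  show ?thesis
  proof (cases "m = m'")
    case True
    then show ?thesis unfolding eq by (simp add: cn)
  next
    case False
    have "inj_on z {..<N}"
      using Complex.bij_betw_roots_unity[of N] assms unfolding z_def bij_betw_def by auto
    with False assms have "z m \<noteq> z m'" by (auto simp: inj_on_def)
    then have "z m * cnj (z m') \<noteq> 1"
      using cn[of m'] by (metis mult.assoc mult.commute mult_1)
    moreover have "(z m * cnj (z m')) ^ N = 1"
      using assms unfolding z_def power_mult_distrib
      by (simp add: Complex.DeMoivre flip: complex_cnj_power)
    ultimately show ?thesis using False by (simp add: eq sum_gp_strict)
  qed
qed

text \<open>Orthogonality is a hypothesis so that the identity can be applied both to the roots of
  unity and to their conjugates, that is, to the transform and to its inverse.\<close>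

lemma Plancherel_finite:
  fixes g :: "nat \<Rightarrow> 'a::complex_inner"
  assumes orth: "\<And>m m'. m < N \<Longrightarrow> m' < N \<Longrightarrow>
    (\<Sum>j<N. z j ^ m * cnj (z j) ^ m') = (if m = m' then of_nat N else 0)"
  shows "(\<Sum>j<N. (norm (\<Sum>m<N. z j ^ m *\<^sub>C g m))\<^sup>2) = real N * (\<Sum>m<N. (norm (g m))\<^sup>2)"
proof -
  have "complex_of_real (\<Sum>j<N. (norm (\<Sum>m<N. z j ^ m *\<^sub>C g m))\<^sup>2)
      = (\<Sum>j<N. cinner (\<Sum>m<N. z j ^ m *\<^sub>C g m) (\<Sum>m<N. z j ^ m *\<^sub>C g m))"
    by (simp add: cinner_self)
  also have "\<dots> = (\<Sum>j<N. \<Sum>m<N. \<Sum>m'<N. (z j ^ m * cnj (z j) ^ m') * cinner (g m) (g m'))"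
    unfolding cinner_sum_left
    by (simp add: cinner_sum_right cinner_scaleC_left cinner_scaleC_right mult_ac)
  also have "\<dots> = (\<Sum>m<N. \<Sum>m'<N. (\<Sum>j<N. z j ^ m * cnj (z j) ^ m') * cinner (g m) (g m'))"
    by (subst sum.swap, rule sum.cong[OF refl], subst sum.swap) (simp add: sum_distrib_right)
  also have "\<dots> = (\<Sum>m<N. \<Sum>m'<N. (if m' = m then of_nat N * cinner (g m) (g m') else 0))"
    by (intro sum.cong refl) (auto simp: orth)
  also have "\<dots> = (\<Sum>m<N. of_nat N * cinner (g m) (g m))"
    by (intro sum.cong refl) (simp add: sum.delta)
  also have "\<dots> = complex_of_real (real N * (\<Sum>m<N. (norm (g m))\<^sup>2))"
    by (simp add: cinner_self sum_distrib_left)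
  finally show ?thesis unfolding of_real_eq_iff .
qed

text \<open>The finite Fourier transform turns the correlation of \<open>a\<close> and
  \<open>f\<close> into the multiplier evaluated at the conjugate roots. Applying Plancherel once to
  \<open>f\<close> and once to the inverse transform leaves the supremum \<open>M\<close> of the
  multiplier over the unit circle.\<close>

lemma finite_multiplier_bound:
  fixes a :: "nat \<Rightarrow> 'a::complex_inner \<Rightarrow> 'a" and f :: "nat \<Rightarrow> 'a"
  assumes add: "\<And>k x y. a k (x + y) = a k x + a k y"
    and scale: "\<And>k c x. a k (c *\<^sub>C x) = c *\<^sub>C a k x"
    and mult: "\<And>z x. cmod z = 1 \<Longrightarrow> norm (\<Sum>k<L. z ^ k *\<^sub>C a k x) \<le> M * norm x"
    and f: "\<And>m. L \<le> m \<Longrightarrow> f m = 0"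
  shows "(\<Sum>n<L. (norm (\<Sum>k<L. a k (f (n + k))))\<^sup>2) \<le> M\<^sup>2 * (\<Sum>n<L. (norm (f n))\<^sup>2)"
proof (cases "L = 0")
  case False
  \<comment> \<open>The period is doubled so that \<open>n + k < N\<close> for all
    \<open>n, k < L\<close>: no index wraps around, and the cyclic correlation agrees with the given
    one.\<close>
  define N where "N = 2 * L"
  define z where "z = (\<lambda>j. cis (2 * pi * real j / real N))"
  define w where "w = (\<lambda>j. cnj (z j))"
  have orth: "(\<Sum>j<N. z j ^ m * cnj (z j) ^ m') = (if m = m' then of_nat N else 0)"
    if "m < N" "m' < N" for m m'
    using sum_roots_of_unity[OF that] by (simp add: z_def)
  have orth_w: "(\<Sum>j<N. w j ^ m * cnj (w j) ^ m') = (if m = m' then of_nat N else 0)"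
    if "m < N" "m' < N" for m m'
    using orth[OF that(2,1)] by (simp add: w_def mult.commute)
  \<comment> \<open>Exchanging index and exponent brings the inverse transform into the form
    required by \<open>Plancherel_finite\<close>.\<close>
  have w_pow: "w j ^ n = w n ^ j" for j n
    unfolding w_def z_def complex_cnj_power[symmetric] Complex.DeMoivre
    by (rule arg_cong[where f = "\<lambda>x. cnj (cis x)"]) simp
  have a0: "a k 0 = 0" for k using scale[of k 0 0] by simp
  have a_sum: "a k (\<Sum>m<N. c m *\<^sub>C f m) = (\<Sum>m<N. c m *\<^sub>C a k (f m))" for k c
    by (induction N) (auto simp: a0 add scale)
  define F where "F = (\<lambda>j. \<Sum>m<N. z j ^ m *\<^sub>C f m)"
  define G where "G = (\<lambda>j. \<Sum>k<L. w j ^ k *\<^sub>C a k (F j))"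
  define g where "g = (\<lambda>n. \<Sum>j<N. w j ^ n *\<^sub>C G j)"
  \<comment> \<open>Summing over \<open>j\<close> first, orthogonality selects
    \<open>m = n + k\<close>; the inverse transform is not normalised, hence the factor
    \<open>N\<close>.\<close>
  have g_eq: "g n = of_nat N *\<^sub>C (\<Sum>k<L. a k (f (n + k)))" if n: "n < L" for n
  proof -
    have "g n = (\<Sum>j<N. \<Sum>k<L. \<Sum>m<N. (z j ^ m * cnj (z j) ^ (n + k)) *\<^sub>C a k (f m))"
      unfolding g_def G_def F_def a_sum scaleC_sum_right scaleC_scaleC
      by (intro sum.cong refl arg_cong2[where f=scaleC]) (simp add: w_def power_add)
    also have "\<dots> = (\<Sum>k<L. \<Sum>m<N. (\<Sum>j<N. z j ^ m * cnj (z j) ^ (n + k)) *\<^sub>C a k (f m))"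
      by (subst sum.swap, rule sum.cong[OF refl], subst sum.swap) (simp add: scaleC_sum_left)
    also have "\<dots> = (\<Sum>k<L. \<Sum>m<N. if m = n + k then of_nat N *\<^sub>C a k (f m) else 0)"
      by (intro sum.cong refl, subst orth) (use n in \<open>auto simp: N_def\<close>)
    also have "\<dots> = (\<Sum>k<L. of_nat N *\<^sub>C a k (f (n + k)))"
      using n by (intro sum.cong refl) (auto simp: sum.delta N_def)
    finally show ?thesis by (simp add: scaleC_sum_right)
  qed
  have "(real N)\<^sup>2 * (\<Sum>n<L. (norm (\<Sum>k<L. a k (f (n + k))))\<^sup>2) = (\<Sum>n<L. (norm (g n))\<^sup>2)"
    by (simp add: g_eq power_mult_distrib sum_distrib_left)
  also have "\<dots> \<le> (\<Sum>n<N. (norm (g n))\<^sup>2)"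
    by (intro sum_mono2) (auto simp: N_def)
  also have "\<dots> = (\<Sum>n<N. (norm (\<Sum>j<N. w n ^ j *\<^sub>C G j))\<^sup>2)"
    by (simp add: g_def w_pow)
  also have "\<dots> = real N * (\<Sum>j<N. (norm (G j))\<^sup>2)"
    by (rule Plancherel_finite[OF orth_w])
  also have "\<dots> \<le> real N * (\<Sum>j<N. (M * norm (F j))\<^sup>2)"
    unfolding G_def by (intro mult_left_mono sum_mono power_mono mult) (auto simp: w_def z_def)
  also have "\<dots> = real N * (M\<^sup>2 * (\<Sum>j<N. (norm (F j))\<^sup>2))"
    by (simp add: power_mult_distrib sum_distrib_left)
  also have "(\<Sum>j<N. (norm (F j))\<^sup>2) = real N * (\<Sum>m<N. (norm (f m))\<^sup>2)"
    unfolding F_def by (rule Plancherel_finite[OF orth])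
  also have "(\<Sum>m<N. (norm (f m))\<^sup>2) = (\<Sum>m<L. (norm (f m))\<^sup>2)"
    by (rule sum.mono_neutral_right) (auto simp: N_def f)
  finally have "(real N)\<^sup>2 * (\<Sum>n<L. (norm (\<Sum>k<L. a k (f (n + k))))\<^sup>2)
      \<le> (real N)\<^sup>2 * (M\<^sup>2 * (\<Sum>n<L. (norm (f n))\<^sup>2))"
    by (simp add: power2_eq_square mult.assoc mult.left_commute)
  then show ?thesis using False by (simp add: N_def)
qed simp

text \<open>Telescoping: \<open>1 / n^2 \<le> 2 / (n * (n + 1))\<close>, because
  \<open>n + 1 \<le> 2 * n\<close>.\<close>

lemma sum_inverse_squares_le:
  assumes "1 \<le> N" "N \<le> L"
  shows "(\<Sum>k\<in>{N..<L}. 1 / (real k)\<^sup>2) \<le> 2 / real N - 2 / real L"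
  using assms(2)
proof (induction L rule: dec_induct)
  case (step n)
  then have n: "1 \<le> real n" using assms by simp
  have "1 / (real n)\<^sup>2 \<le> 2 / real n - 2 / real (Suc n)"
    using n mult_left_mono[OF n, of "real n"]
    by (simp add: divide_simps power2_eq_square) (simp add: algebra_simps)?
  with step show ?case by simp
qed simp

section \<open>The multiplier of the semigroup increments\<close>

context semigroup_estimates
begin

lemma T_minus: "0 \<le> t \<Longrightarrow> T t (- x) = - T t x"
  using T_scaleC[of t "-1" x] by (simp add: scaleC_minus_one)

lemma T_diff: "0 \<le> t \<Longrightarrow> T t (x - y) = T t x - T t y"
  using T_add[of t x "- y"] by (simp add: T_minus)

lemma T_0_right [simp]: "0 \<le> t \<Longrightarrow> T t 0 = 0"
  using T_scaleC[of t 0 0] by simp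

text \<open>At \<open>t = k * h\<close> this is \<open>(I - R) R^k\<close>. Times off the grid are
  allowed because the second difference is estimated through its half-time
  \<open>t / 2\<close>.\<close>

definition T_increment :: "real \<Rightarrow> real \<Rightarrow> 'a \<Rightarrow> 'a" where
  "T_increment h t x = T t x - T (t + h) x"

lemma norm_T_increment:
  "0 < t \<Longrightarrow> 0 \<le> h \<Longrightarrow> norm (T_increment h t x) \<le> C * h / t * norm x"
  using norm_T_diff[of t "t + h" x] by (simp add: T_increment_def)

text \<open>The second difference at \<open>t\<close> is the square of the first difference at
  \<open>t / 2\<close>, since the semigroup commutes with itself. Each factor contributes
  \<open>2 * C * h / t\<close>.\<close>

lemma norm_T_increment_diff:
  assumes "0 < t" "0 \<le> h"
  shows "norm (T_increment h t x - T_increment h (t + h) x) \<le> (2 * C * h / t)\<^sup>2 * norm x"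
proof -
  have "T_increment h t x - T_increment h (t + h) x =
      T_increment h (t / 2) (T_increment h (t / 2) x)"
    using assms T_plus[of "t / 2" "t / 2" x] T_plus[of "t / 2" "t / 2 + h" x]
      T_plus[of "t / 2 + h" "t / 2" x] T_plus[of "t / 2 + h" "t / 2 + h" x]
    by (simp add: T_increment_def T_diff algebra_simps)
  also have "norm \<dots> \<le> C * h / (t / 2) * (C * h / (t / 2) * norm x)"
    using assms C_ge_0
    by (intro order_trans[OF norm_T_increment] mult_left_mono norm_T_increment) auto
  finally show ?thesis by (simp add: power2_eq_square mult.assoc mult.left_commute)
qed

text \<open>Summation by parts moves the difference from the semigroup to the powers of
  \<open>z\<close>, where each one has modulus \<open>|1 - z|\<close>. The result is good as long as
  \<open>m * |1 - z|\<close> stays bounded.\<close>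

lemma increment_multiplier_head:
  assumes "cmod z = 1" "0 \<le> h"
  shows "norm (\<Sum>k<m. z ^ k *\<^sub>C T_increment h (real k * h) x)
    \<le> (1 + K + real m * cmod (1 - z) * K) * norm x"
proof -
  have "(\<Sum>k<m. z ^ k *\<^sub>C T_increment h (real k * h) x) =
      x - z ^ m *\<^sub>C T (real m * h) x + (\<Sum>k<m. (z ^ Suc k - z ^ k) *\<^sub>C T (real (Suc k) * h) x)"
    by (induction m)
      (simp_all add: T_zero T_increment_def scaleC_diff_right scaleC_diff_left algebra_simps)
  also have "norm \<dots> \<le> norm x + norm (z ^ m *\<^sub>C T (real m * h) x) +
      (\<Sum>k<m. norm ((z ^ Suc k - z ^ k) *\<^sub>C T (real (Suc k) * h) x))"
    by (intro order_trans[OF norm_triangle_ineq] add_mono norm_sum norm_triangle_ineq4)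
  also have "\<dots> \<le> norm x + K * norm x + (\<Sum>k<m. cmod (1 - z) * (K * norm x))"
  proof (intro add_mono sum_mono order_refl)
    show "norm (z ^ m *\<^sub>C T (real m * h) x) \<le> K * norm x"
      using assms norm_T[of "real m * h" x] by (simp add: norm_power)
    fix k
    have "z ^ Suc k - z ^ k = z ^ k * (z - 1)" by (simp add: algebra_simps)
    then have "cmod (z ^ Suc k - z ^ k) = cmod (1 - z)"
      using assms by (simp add: norm_mult norm_power norm_minus_commute)
    then show "norm ((z ^ Suc k - z ^ k) *\<^sub>C T (real (Suc k) * h) x) \<le> cmod (1 - z) * (K * norm x)"
      using assms norm_T[of "real (Suc k) * h" x] by (simp add: mult_left_mono)
  qed
  finally show ?thesis by (simp add: algebra_simps)
qed

text \<open>After multiplication by \<open>1 - z\<close>, summation by parts goes the other way and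
  puts the difference on the increments. The two boundary terms are bounded by \<open>C / N\<close>
  each, and the second differences by \<open>4 * C^2 / k^2\<close>, whose sum is at most
  \<open>8 * C^2 / N\<close>.\<close>

lemma increment_multiplier_tail:
  assumes "cmod z = 1" "0 < h" "1 \<le> N" "N \<le> L"
  shows "cmod (1 - z) * norm (\<Sum>k\<in>{N..<L}. z ^ k *\<^sub>C T_increment h (real k * h) x)
    \<le> (2 * C + 8 * C\<^sup>2) / real N * norm x"
proof -
  let ?B = "\<lambda>k. T_increment h (real k * h) x"
  have "(1 - z) *\<^sub>C (\<Sum>k\<in>{N..<L}. z ^ k *\<^sub>C ?B k) =
      z ^ N *\<^sub>C ?B N - z ^ L *\<^sub>C ?B L - (\<Sum>k\<in>{N..<L}. z ^ Suc k *\<^sub>C (?B k - ?B (Suc k)))"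
    using assms(4)
    by (induction L rule: dec_induct)
      (simp_all add: scaleC_add_right scaleC_diff_right scaleC_diff_left scaleC_scaleC algebra_simps)
  then have "cmod (1 - z) * norm (\<Sum>k\<in>{N..<L}. z ^ k *\<^sub>C ?B k) =
      norm (z ^ N *\<^sub>C ?B N - z ^ L *\<^sub>C ?B L - (\<Sum>k\<in>{N..<L}. z ^ Suc k *\<^sub>C (?B k - ?B (Suc k))))"
    by (simp flip: norm_scaleC)
  also have "\<dots> \<le> norm (z ^ N *\<^sub>C ?B N) + norm (z ^ L *\<^sub>C ?B L) +
      (\<Sum>k\<in>{N..<L}. norm (z ^ Suc k *\<^sub>C (?B k - ?B (Suc k))))"
    by (intro order_trans[OF norm_triangle_ineq4] add_mono norm_sum norm_triangle_ineq4)
  also have "\<dots> \<le> C / real N * norm x + C / real N * norm x +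
      (\<Sum>k\<in>{N..<L}. 4 * C\<^sup>2 * norm x * (1 / (real k)\<^sup>2))"
  proof (intro add_mono sum_mono)
    have B: "norm (?B k) \<le> C / real k * norm x" if "1 \<le> k" for k
      using norm_T_increment[of "real k * h" h x] assms that by (simp add: field_simps)
    show "norm (z ^ N *\<^sub>C ?B N) \<le> C / real N * norm x"
      using assms B[of N] by (simp add: norm_power)
    have "C / real L * norm x \<le> C / real N * norm x"
      using assms C_ge_0 by (intro mult_right_mono divide_left_mono) auto
    then show "norm (z ^ L *\<^sub>C ?B L) \<le> C / real N * norm x"
      using assms B[of L] by (simp add: norm_power)
    fix k assume "k \<in> {N..<L}"
    then have k: "0 < real k" using assms by auto
    have "norm (?B k - ?B (Suc k)) \<le> (2 * C * h / (real k * h))\<^sup>2 * norm x"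
      using norm_T_increment_diff[of "real k * h" h x] k assms by (simp add: algebra_simps)
    also have "2 * C * h / (real k * h) = 2 * C / real k" using assms by simp
    finally show "norm (z ^ Suc k *\<^sub>C (?B k - ?B (Suc k))) \<le> 4 * C\<^sup>2 * norm x * (1 / (real k)\<^sup>2)"
      using assms by (simp add: norm_power power_divide power_mult_distrib norm_mult)
  qed
  also have "(\<Sum>k\<in>{N..<L}. 4 * C\<^sup>2 * norm x * (1 / (real k)\<^sup>2)) \<le> 4 * C\<^sup>2 * norm x * (2 / real N)"
    unfolding sum_distrib_left[symmetric]
    using sum_inverse_squares_le[OF assms(3,4)]
    by (intro mult_left_mono) (auto intro: order_trans)
  finally show ?thesis by (simp add: algebra_simps add_divide_distrib)
qed

text \<open>The first bracket bounds the head \<open>1 + K + N * |1 - z| * K\<close> with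
  \<open>N * |1 - z| \<le> 3\<close>; the second bounds the tail with
  \<open>N * |1 - z| \<ge> 1\<close>.\<close>

definition multiplier_const :: real where
  "multiplier_const = (1 + 4 * K) + (2 * C + 8 * C\<^sup>2)"

text \<open>The multiplier is \<open>(I - R) (I - z R)\<^sup>-\<^sup>1\<close> with \<open>R = T h\<close>. The sum is split where
  \<open>k\<close> is comparable to \<open>1 / |1 - z|\<close>, and summed by parts on either side.\<close>

lemma increment_multiplier:
  assumes z: "cmod z = 1" and h: "0 < h"
  shows "norm (\<Sum>k<L. z ^ k *\<^sub>C T_increment h (real k * h) x) \<le> multiplier_const * norm x"
proof (cases "real L * cmod (1 - z) \<le> 3")
  case True
  have "norm (\<Sum>k<L. z ^ k *\<^sub>C T_increment h (real k * h) x)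
      \<le> (1 + K + real L * cmod (1 - z) * K) * norm x"
    using increment_multiplier_head[where m = L and x = x and z = z and h = h] z h by simp
  also have "\<dots> \<le> multiplier_const * norm x"
  proof (rule mult_right_mono)
    have "real L * cmod (1 - z) * K \<le> 3 * K"
      using True K_ge_1 by (intro mult_right_mono) auto
    then show "1 + K + real L * cmod (1 - z) * K \<le> multiplier_const"
      using C_ge_0 zero_le_power2[of C] unfolding multiplier_const_def by linarith
  qed simp
  finally show ?thesis .
next
  case False
  let ?c = "cmod (1 - z)"
  have c: "0 < ?c" using False by (cases "?c = 0") auto
  \<comment> \<open>The least \<open>N\<close> with \<open>N * ?c \<ge> 1\<close>. As
    \<open>?c \<le> 2\<close>, also \<open>N * ?c \<le> 3\<close>, which explains the threshold 3 of
    the case distinction: it forces \<open>N \<le> L\<close> here.\<close>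
  define N where "N = nat \<lceil>1 / ?c\<rceil>"
  have c2: "?c \<le> 2" using norm_triangle_ineq4[of 1 z] z by simp
  have N: "1 / ?c \<le> real N" "real N < 1 / ?c + 1" "1 \<le> N"
    using c unfolding N_def by (auto simp: Suc_le_eq) linarith+
  have Nc: "1 \<le> real N * ?c" using N(1) c by (simp add: field_simps)
  have "real N * ?c \<le> (1 / ?c + 1) * ?c" using N(2) c by (intro mult_right_mono) auto
  also have "\<dots> \<le> 3" using c c2 by (simp add: field_simps)
  finally have Nc3: "real N * ?c \<le> 3" .
  have "real N * ?c < real L * ?c" using Nc3 False by linarith
  then have "N \<le> L" using c by (simp add: mult_less_cancel_right)
  then have "(\<Sum>k<L. z ^ k *\<^sub>C T_increment h (real k * h) x) =
      (\<Sum>k<N. z ^ k *\<^sub>C T_increment h (real k * h) x) +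
      (\<Sum>k\<in>{N..<L}. z ^ k *\<^sub>C T_increment h (real k * h) x)"
    by (simp add: sum.atLeastLessThan_concat flip: atLeast0LessThan)
  moreover have "norm (\<Sum>k<N. z ^ k *\<^sub>C T_increment h (real k * h) x) \<le> (1 + 4 * K) * norm x"
  proof -
    have "norm (\<Sum>k<N. z ^ k *\<^sub>C T_increment h (real k * h) x)
        \<le> (1 + K + real N * ?c * K) * norm x"
      using increment_multiplier_head[where m = N and x = x and z = z and h = h] z h by simp
    also have "\<dots> \<le> (1 + 4 * K) * norm x"
      using mult_right_mono[OF Nc3, of K] K_ge_1 by (intro mult_right_mono) auto
    finally show ?thesis .
  qed
  moreover have "norm (\<Sum>k\<in>{N..<L}. z ^ k *\<^sub>C T_increment h (real k * h) x)
      \<le> (2 * C + 8 * C\<^sup>2) * norm x" (is "norm ?P \<le> _")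
  proof -
    \<comment> \<open>Inserting a factor that is at least 1 makes the tail estimate applicable, and
      its \<open>1 / N\<close> cancels.\<close>
    have "norm ?P \<le> real N * ?c * norm ?P"
      using mult_right_mono[OF Nc, of "norm ?P"] by simp
    also have "\<dots> \<le> real N * ((2 * C + 8 * C\<^sup>2) / real N * norm x)"
      using increment_multiplier_tail[OF z h N(3) \<open>N \<le> L\<close>, of x]
      unfolding mult.assoc by (intro mult_left_mono) auto
    also have "\<dots> = (2 * C + 8 * C\<^sup>2) * norm x" using N by simp
    finally show ?thesis .
  qed
  ultimately show ?thesis
    by (simp add: multiplier_const_def algebra_simps) (smt (verit) norm_triangle_ineq)
qed

lemma discrete_maximal_regularity:
  assumes h: "0 < h" and f: "\<And>m. L \<le> m \<Longrightarrow> f m = 0"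
  shows "(\<Sum>n<L. (norm (\<Sum>k<L. T_increment h (real k * h) (f (n + k))))\<^sup>2)
    \<le> multiplier_const\<^sup>2 * (\<Sum>n<L. (norm (f n))\<^sup>2)"
proof (rule finite_multiplier_bound)
  show "T_increment h (real k * h) (x + y) =
      T_increment h (real k * h) x + T_increment h (real k * h) y" for k x y
    using h by (simp add: T_increment_def T_add)
  show "T_increment h (real k * h) (c *\<^sub>C x) = c *\<^sub>C T_increment h (real k * h) x" for k c x
    using h by (simp add: T_increment_def T_scaleC scaleC_diff_right)
qed (use increment_multiplier h f in auto)

end

section \<open>Strongly measurable functions\<close>

text \<open>A strongly measurable function need not be Borel measurable, as it is only an almost
  everywhere limit of simple functions. Since \<open>nn_integral\<close> does not change under completion,
  its norm can be handled as a measurable function for the completed measure.\<close>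

lemma borel_measurable_completion_AE:
  assumes "g \<in> borel_measurable M" "AE x in M. f x = g x"
  shows "f \<in> borel_measurable (completion M)"
proof (rule measurableI)
  fix A :: "'b set" assume "A \<in> sets borel"
  then have "g -` A \<inter> space M \<in> sets (completion M)"
    using assms(1) by (auto intro: measurable_sets)
  then show "f -` A \<inter> space (completion M) \<in> sets (completion M)"
    by (rule completion.in_sets_AE[rotated])
       (use assms(2) AE_space[of M] in \<open>auto simp: AE_completion_iff elim!: AE_mp\<close>)
qed simp

text \<open>Setting everything to 0 on a null set that contains the exceptional points makes the
  convergence hold everywhere, so that norms of the limit are Borel measurable as pointwise
  limits.\<close>

lemma strongly_measurable_version:
  fixes f :: "'s \<Rightarrow> 'b::real_normed_vector"
  assumes "\<And>i. simple_function M (s i)" "AE x in M. (\<lambda>i. s i x) \<longlonglongrightarrow> f x"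
  shows "\<exists>s' f'. (\<forall>i. simple_function M (s' i)) \<and> (\<forall>x. (\<lambda>i. s' i x) \<longlonglongrightarrow> f' x) \<and>
    (AE x in M. f x = f' x \<and> (\<forall>i. s' i x = s i x))"
proof -
  obtain N where N: "N \<in> sets M" "emeasure M N = 0"
    "{x\<in>space M. \<not> (\<lambda>i. s i x) \<longlonglongrightarrow> f x} \<subseteq> N"
    using assms(2) by (auto elim!: AE_E)
  define s' where "s' = (\<lambda>i x. if x \<in> space M - N then s i x else 0)"
  define f' where "f' = (\<lambda>x. if x \<in> space M - N then f x else 0)"
  have "simple_function M (s' i)" for i
  proof -
    have "simple_function M (\<lambda>x. if x \<in> space M - N then s i x else 0)"
      using N assms(1) by (intro simple_function_If_set) auto
    then show ?thesis by (simp add: s'_def)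
  qed
  moreover have "(\<lambda>i. s' i x) \<longlonglongrightarrow> f' x" for x
    using N(3) by (cases "x \<in> space M - N") (auto simp: s'_def f'_def)
  moreover have "AE x in M. x \<notin> N" using N by (intro AE_not_in) auto
  then have "AE x in M. f x = f' x \<and> (\<forall>i. s' i x = s i x)"
    using AE_space by eventually_elim (auto simp: s'_def f'_def)
  ultimately show ?thesis by blast
qed

lemma strongly_measurable_norm:
  assumes "strongly_measurable M f"
  shows "(\<lambda>x. norm (f x)) \<in> borel_measurable (completion M)"
proof -
  obtain s where s: "\<And>i. simple_function M (s i)" "AE x in M. (\<lambda>i. s i x) \<longlonglongrightarrow> f x"
    using assms by (auto simp: strongly_measurable_def)
  obtain s' f' where s': "\<And>i. simple_function M (s' i)" "\<And>x. (\<lambda>i. s' i x) \<longlonglongrightarrow> f' x"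
    "AE x in M. f x = f' x \<and> (\<forall>i. s' i x = s i x)"
    using strongly_measurable_version[OF s] by auto
  have "(\<lambda>x. norm (f' x)) \<in> borel_measurable M"
  proof (rule borel_measurable_LIMSEQ_real[where u = "\<lambda>i x. norm (s' i x)"])
    show "(\<lambda>x. norm (s' i x)) \<in> borel_measurable M" for i
      using s'(1) by (intro borel_measurable_simple_function simple_function_compose1[where g = norm])
  qed (use s'(2) tendsto_norm in blast)
  then show ?thesis
    by (rule borel_measurable_completion_AE) (use s'(3) in auto)
qed

lemma strongly_measurable_ennreal_norm:
  assumes "strongly_measurable M f"
  shows "(\<lambda>x. ennreal (norm (f x))) \<in> borel_measurable (completion M)"
    "(\<lambda>x. ennreal ((norm (f x))\<^sup>2)) \<in> borel_measurable (completion M)"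
  using strongly_measurable_norm[OF assms] by simp_all

lemma nn_integral_completion_cmult:
  fixes f :: "'s \<Rightarrow> ennreal"
  shows "f \<in> borel_measurable (completion M) \<Longrightarrow> (\<integral>\<^sup>+x. c * f x \<partial>M) = c * (\<integral>\<^sup>+x. f x \<partial>M)"
  using nn_integral_cmult[of f "completion M" c] by (simp add: nn_integral_completion)

lemma nn_integral_completion_add:
  fixes f g :: "'s \<Rightarrow> ennreal"
  shows "f \<in> borel_measurable (completion M) \<Longrightarrow> g \<in> borel_measurable (completion M) \<Longrightarrow>
    (\<integral>\<^sup>+x. f x + g x \<partial>M) = (\<integral>\<^sup>+x. f x \<partial>M) + (\<integral>\<^sup>+x. g x \<partial>M)"
  using nn_integral_add[of f "completion M" g] by (simp add: nn_integral_completion)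

lemma nn_integral_completion_linear:
  fixes f g :: "'s \<Rightarrow> ennreal"
  assumes "f \<in> borel_measurable (completion M)" "g \<in> borel_measurable (completion M)"
  shows "(\<integral>\<^sup>+x. c * f x + d * g x \<partial>M) = c * (\<integral>\<^sup>+x. f x \<partial>M) + d * (\<integral>\<^sup>+x. g x \<partial>M)"
  using assms nn_integral_completion_add[of "\<lambda>x. c * f x" M "\<lambda>x. d * g x"]
  by (simp add: nn_integral_completion_cmult)

lemma nn_integral_completion_scale:
  fixes f :: "'s \<Rightarrow> real"
  assumes "(\<lambda>x. ennreal (f x)) \<in> borel_measurable (completion M)" "0 \<le> c"
  shows "(\<integral>\<^sup>+x. ennreal (c * f x) \<partial>M) = ennreal c * (\<integral>\<^sup>+x. ennreal (f x) \<partial>M)"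
  using nn_integral_completion_cmult[OF assms(1), of "ennreal c"] assms(2) by (simp add: ennreal_mult')

text \<open>Continuity is asked only at the values taken. This covers sums and products through
  pairs, and also the map \<open>(r, y) \<mapsto> T r y\<close>, whose continuity is established
  only at times \<open>r > 0\<close>.\<close>

lemma strongly_measurable_isCont:
  assumes F: "strongly_measurable M F" and \<Phi>: "AE x in M. isCont \<Phi> (F x)"
  shows "strongly_measurable M (\<lambda>x. \<Phi> (F x))"
proof -
  obtain s where s: "\<And>i. simple_function M (s i)" "AE x in M. (\<lambda>i. s i x) \<longlonglongrightarrow> F x"
    using F by (auto simp: strongly_measurable_def)
  have "AE x in M. (\<lambda>i. \<Phi> (s i x)) \<longlonglongrightarrow> \<Phi> (F x)"
    using s(2) \<Phi> by eventually_elim (rule isCont_tendsto_compose)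
  with s(1) show ?thesis unfolding strongly_measurable_def
    by (intro exI[of _ "\<lambda>i x. \<Phi> (s i x)"]) (auto intro: simple_function_compose1)
qed

lemma strongly_measurable_Pair:
  assumes "strongly_measurable M f" "strongly_measurable M g"
  shows "strongly_measurable M (\<lambda>x. (f x, g x))"
proof -
  obtain s where s: "\<And>i. simple_function M (s i)" "AE x in M. (\<lambda>i. s i x) \<longlonglongrightarrow> f x"
    using assms(1) by (auto simp: strongly_measurable_def)
  obtain r where r: "\<And>i. simple_function M (r i)" "AE x in M. (\<lambda>i. r i x) \<longlonglongrightarrow> g x"
    using assms(2) by (auto simp: strongly_measurable_def)
  have "AE x in M. (\<lambda>i. (s i x, r i x)) \<longlonglongrightarrow> (f x, g x)"
    using s(2) r(2) by eventually_elim (rule tendsto_Pair)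
  with s(1) r(1) show ?thesis unfolding strongly_measurable_def
    by (intro exI[of _ "\<lambda>i x. (s i x, r i x)"]) auto
qed

lemma strongly_measurable_add:
  "strongly_measurable M f \<Longrightarrow> strongly_measurable M g \<Longrightarrow> strongly_measurable M (\<lambda>x. f x + g x)"
  using strongly_measurable_isCont[OF strongly_measurable_Pair, of M f g "\<lambda>p. fst p + snd p"]
  by simp

lemma strongly_measurable_diff:
  "strongly_measurable M f \<Longrightarrow> strongly_measurable M g \<Longrightarrow> strongly_measurable M (\<lambda>x. f x - g x)"
  using strongly_measurable_isCont[OF strongly_measurable_Pair, of M f g "\<lambda>p. fst p - snd p"]
  by simp

lemma strongly_measurable_scaleR:
  "strongly_measurable M f \<Longrightarrow> strongly_measurable M g \<Longrightarrow> strongly_measurable M (\<lambda>x. f x *\<^sub>R g x)"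
  using strongly_measurable_isCont[OF strongly_measurable_Pair, of M f g "\<lambda>p. fst p *\<^sub>R snd p"]
  by simp

lemma strongly_measurable_bounded_linear:
  "bounded_linear \<Phi> \<Longrightarrow> strongly_measurable M f \<Longrightarrow> strongly_measurable M (\<lambda>x. \<Phi> (f x))"
  by (rule strongly_measurable_isCont) (auto intro: linear_continuous_at)

lemma strongly_measurable_scaleC:
  fixes f :: "'s \<Rightarrow> 'b::complex_inner"
  shows "strongly_measurable M f \<Longrightarrow> strongly_measurable M (\<lambda>x. c *\<^sub>C f x)"
  by (rule strongly_measurable_bounded_linear[OF bounded_linear_scaleC_compose[OF bounded_linear_ident]])

lemma strongly_measurable_simple: "simple_function M f \<Longrightarrow> strongly_measurable M f"
  unfolding strongly_measurable_def by (rule exI[of _ "\<lambda>_. f"]) simp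

lemma strongly_measurable_const [simp]: "strongly_measurable M (\<lambda>x. c)"
  by (rule strongly_measurable_simple) simp

lemma strongly_measurable_borel:
  fixes f :: "'s \<Rightarrow> 'b::{second_countable_topology, real_normed_vector}"
  shows "f \<in> borel_measurable M \<Longrightarrow> strongly_measurable M f"
  using borel_measurable_implies_sequence_metric[of f M 0]
  unfolding strongly_measurable_def by (meson AE_I2)

lemma strongly_measurable_cong_AE:
  assumes "strongly_measurable M f" "AE x in M. f x = g x"
  shows "strongly_measurable M g"
proof -
  obtain s where s: "\<And>i. simple_function M (s i)" "AE x in M. (\<lambda>i. s i x) \<longlonglongrightarrow> f x"
    using assms(1) by (auto simp: strongly_measurable_def)
  have "AE x in M. (\<lambda>i. s i x) \<longlonglongrightarrow> g x" using s(2) assms(2) by eventually_elim simp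
  with s(1) show ?thesis unfolding strongly_measurable_def by blast
qed

lemma simple_function_restrict_spaceI:
  assumes "simple_function M f" "B \<in> sets M"
  shows "simple_function (restrict_space M B) f"
proof -
  have sub: "B \<subseteq> space M" using assms(2) by (rule sets.sets_into_space)
  have "finite (f ` B)"
    using assms(1) sub finite_subset[of "f ` B" "f ` space M"] unfolding simple_function_def by auto
  moreover have "f -` {f x} \<inter> B \<in> sets (restrict_space M B)" if "x \<in> B" for x
  proof -
    have "f -` {f x} \<inter> space M \<in> sets M"
      using assms(1) sub that unfolding simple_function_def by auto
    then have "B \<inter> (f -` {f x} \<inter> space M) \<in> sets (restrict_space M B)"
      unfolding sets_restrict_space by blast
    moreover have "B \<inter> (f -` {f x} \<inter> space M) = f -` {f x} \<inter> B" using sub by auto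
    ultimately show ?thesis by simp
  qed
  ultimately show ?thesis
    using sub by (auto simp: simple_function_def space_restrict_space Int_absorb2)
qed

lemma strongly_measurable_restrict_space:
  assumes "strongly_measurable M f" "B \<in> sets M"
  shows "strongly_measurable (restrict_space M B) f"
proof -
  obtain s where s: "\<And>i. simple_function M (s i)" "AE x in M. (\<lambda>i. s i x) \<longlonglongrightarrow> f x"
    using assms(1) by (auto simp: strongly_measurable_def)
  have "AE x in restrict_space M B. (\<lambda>i. s i x) \<longlonglongrightarrow> f x"
    using s(2) sets.sets_into_space[OF assms(2)] assms(2)
    by (subst AE_restrict_space_iff) (auto simp: Int_absorb2)
  then show ?thesis unfolding strongly_measurable_def
    using simple_function_restrict_spaceI[OF s(1) assms(2)] by blast
qed

text \<open>\<open>B i\<close> is the set where the \<open>i\<close>-th function is at most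
  \<open>2 * norm (F x)\<close>. Where \<open>F x = 0\<close> this forces the value 0, and elsewhere
  the cut is eventually inactive. The sets themselves are returned, so that a cut found for the pair
  \<open>(s, A s)\<close> can be applied to \<open>s\<close>.\<close>

lemma dominated_simple_functions:
  fixes F :: "'s \<Rightarrow> 'b::real_normed_vector"
  assumes "\<And>i. simple_function M (s i)" "AE x in M. (\<lambda>i. s i x) \<longlonglongrightarrow> F x"
  shows "\<exists>B. (\<forall>i::nat. B i \<in> sets M) \<and>
    (AE x in M. (\<lambda>i. indicat_real (B i) x *\<^sub>R s i x) \<longlonglongrightarrow> F x) \<and>
    (AE x in M. \<forall>i. norm (indicat_real (B i) x *\<^sub>R s i x) \<le> 2 * norm (F x))"
proof -
  obtain s' F' where s': "\<And>i. simple_function M (s' i)" "\<And>x. (\<lambda>i. s' i x) \<longlonglongrightarrow> F' x"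
    "AE x in M. F x = F' x \<and> (\<forall>i. s' i x = s i x)"
    using strongly_measurable_version[OF assms] by auto
  have ns: "(\<lambda>x. norm (s' i x)) \<in> borel_measurable M" for i
    using s'(1) by (intro borel_measurable_simple_function simple_function_compose1[where g = norm])
  have nF: "(\<lambda>x. norm (F' x)) \<in> borel_measurable M"
    by (rule borel_measurable_LIMSEQ_real[where u = "\<lambda>i x. norm (s' i x)", OF _ ns]) (use s'(2) tendsto_norm in blast)
  define B where "B = (\<lambda>i. {x\<in>space M. norm (s' i x) \<le> 2 * norm (F' x)})"
  have "B i \<in> sets M" for i
    unfolding B_def using ns[of i] nF by measurable
  moreover have lim: "(\<lambda>i. indicat_real (B i) x *\<^sub>R s' i x) \<longlonglongrightarrow> F' x" if x: "x \<in> space M" for x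
  proof (cases "F' x = 0")
    case True
    then have "indicat_real (B i) x *\<^sub>R s' i x = 0" for i
      by (auto simp: B_def indicator_def)
    then show ?thesis unfolding True by (simp only: tendsto_const)
  next
    case False
    have "\<forall>\<^sub>F i in sequentially. norm (s' i x) < 2 * norm (F' x)"
      using tendsto_norm[OF s'(2)[of x]] False by (intro order_tendstoD(2)) auto
    then have "\<forall>\<^sub>F i in sequentially. s' i x = indicat_real (B i) x *\<^sub>R s' i x"
      by eventually_elim (use x in \<open>auto simp: B_def\<close>)
    from Lim_transform_eventually[OF s'(2) this] show ?thesis .
  qed
  moreover have "AE x in M. (\<lambda>i. indicat_real (B i) x *\<^sub>R s i x) \<longlonglongrightarrow> F x"
    using s'(3) AE_space
  proof eventually_elim
    case (elim x)
    then show ?case using lim[of x] by simp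
  qed
  moreover have "AE x in M. \<forall>i. norm (indicat_real (B i) x *\<^sub>R s i x) \<le> 2 * norm (F x)"
    using s'(3) AE_space by eventually_elim (auto simp: B_def indicator_def)
  ultimately show ?thesis by blast
qed

text \<open>Dominated convergence is carried out for the completed measure, where norms of strongly
  measurable functions are measurable, and gives the same integrals.\<close>

lemma nn_integral_dominated_null:
  fixes u :: "nat \<Rightarrow> 's \<Rightarrow> real"
  assumes u: "\<And>i. u i \<in> borel_measurable (completion M)" and w: "w \<in> borel_measurable (completion M)"
    and bound: "\<And>i. AE x in M. u i x \<le> w x" and fin: "(\<integral>\<^sup>+x. ennreal (w x) \<partial>M) < \<infinity>"
    and lim: "AE x in M. (\<lambda>i. u i x) \<longlonglongrightarrow> 0"
  shows "(\<lambda>i. \<integral>\<^sup>+x. ennreal (u i x) \<partial>M) \<longlonglongrightarrow> 0"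
proof -
  have "(\<lambda>i. \<integral>\<^sup>+x. ennreal (u i x) \<partial>completion M) \<longlonglongrightarrow> (\<integral>\<^sup>+x. 0 \<partial>completion M)"
  proof (rule nn_integral_dominated_convergence)
    show "(\<lambda>x. ennreal (u i x)) \<in> borel_measurable (completion M)" for i using u by measurable
    show "(\<lambda>x. ennreal (w x)) \<in> borel_measurable (completion M)" using w by measurable
    show "AE x in completion M. ennreal (u i x) \<le> ennreal (w x)" for i
      using bound[of i] by (auto simp: AE_completion_iff ennreal_leI)
    show "(\<integral>\<^sup>+x. ennreal (w x) \<partial>completion M) < \<infinity>" using fin by (simp add: nn_integral_completion)
    show "AE x in completion M. (\<lambda>i. ennreal (u i x)) \<longlonglongrightarrow> 0"
      using lim unfolding AE_completion_iff
      by eventually_elim (use tendsto_ennrealI in fastforce)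
  qed auto
  then show ?thesis by (simp add: nn_integral_completion)
qed

section \<open>The Bochner integral\<close>

lemma nn_integral_norm_triangle:
  assumes "strongly_measurable M f" "strongly_measurable M g"
    and "AE x in M. norm (k x) \<le> norm (f x) + norm (g x)"
  shows "(\<integral>\<^sup>+x. ennreal (norm (k x)) \<partial>M) \<le>
    (\<integral>\<^sup>+x. ennreal (norm (f x)) \<partial>M) + (\<integral>\<^sup>+x. ennreal (norm (g x)) \<partial>M)"
proof -
  have "(\<integral>\<^sup>+x. ennreal (norm (k x)) \<partial>M) \<le> (\<integral>\<^sup>+x. ennreal (norm (f x)) + ennreal (norm (g x)) \<partial>M)"
    using assms(3) by (intro nn_integral_mono_AE)
      (auto simp: ennreal_plus[symmetric] ennreal_leI simp del: ennreal_plus)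
  also have "\<dots> = (\<integral>\<^sup>+x. ennreal (norm (f x)) \<partial>M) + (\<integral>\<^sup>+x. ennreal (norm (g x)) \<partial>M)"
    by (intro nn_integral_completion_add strongly_measurable_ennreal_norm assms)
  finally show ?thesis .
qed

lemma simple_bochner_integrable_strongly_measurable:
  "Bochner_Integration.simple_bochner_integrable M s \<Longrightarrow> strongly_measurable M s"
  by (auto elim!: simple_bochner_integrable.cases intro: strongly_measurable_simple)

lemma simple_bochner_integral_norm_le:
  assumes "Bochner_Integration.simple_bochner_integrable M s"
  shows "ennreal (norm (Bochner_Integration.simple_bochner_integral M s)) \<le> (\<integral>\<^sup>+x. ennreal (norm (s x)) \<partial>M)"
proof -
  have "ennreal (norm (Bochner_Integration.simple_bochner_integral M s)) \<le> Bochner_Integration.simple_bochner_integral M (\<lambda>x. norm (s x))"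
    by (rule ennreal_leI[OF simple_bochner_integral_norm_bound[OF assms]])
  also have "\<dots> = (\<integral>\<^sup>+x. ennreal (norm (s x)) \<partial>M)"
    using simple_bochner_integrable_compose2[of "\<lambda>x y. norm x", OF _ assms assms]
    by (intro simple_bochner_integral_eq_nn_integral) auto
  finally show ?thesis .
qed

lemma bochner_has_integral_norm_le:
  assumes "bochner_has_integral M f v"
  shows "ennreal (norm v) \<le> (\<integral>\<^sup>+x. ennreal (norm (f x)) \<partial>M)"
proof -
  obtain s where f: "strongly_measurable M f" and s: "\<And>i. Bochner_Integration.simple_bochner_integrable M (s i)"
    "(\<lambda>i. \<integral>\<^sup>+x. ennreal (norm (f x - s i x)) \<partial>M) \<longlonglongrightarrow> 0"
    "(\<lambda>i. Bochner_Integration.simple_bochner_integral M (s i)) \<longlonglongrightarrow> v"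
    using assms by (auto simp: bochner_has_integral_def)
  have 1: "(\<lambda>i. ennreal (norm (Bochner_Integration.simple_bochner_integral M (s i)))) \<longlonglongrightarrow> ennreal (norm v)"
    by (intro tendsto_ennrealI tendsto_norm s)
  have 2: "(\<lambda>i. (\<integral>\<^sup>+x. ennreal (norm (f x)) \<partial>M) + (\<integral>\<^sup>+x. ennreal (norm (f x - s i x)) \<partial>M))
      \<longlonglongrightarrow> (\<integral>\<^sup>+x. ennreal (norm (f x)) \<partial>M) + 0"
    by (intro tendsto_add tendsto_const s)
  have 3: "ennreal (norm (Bochner_Integration.simple_bochner_integral M (s i))) \<le>
      (\<integral>\<^sup>+x. ennreal (norm (f x)) \<partial>M) + (\<integral>\<^sup>+x. ennreal (norm (f x - s i x)) \<partial>M)" for i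
  proof (rule order_trans[OF simple_bochner_integral_norm_le[OF s(1)] nn_integral_norm_triangle])
    show "AE x in M. norm (s i x) \<le> norm (f x) + norm (f x - s i x)"
      by (intro always_eventually allI) (metis norm_triangle_sub add.commute norm_minus_commute)
  qed (use f s in \<open>auto intro: strongly_measurable_diff simple_bochner_integrable_strongly_measurable\<close>)
  show ?thesis
    using LIMSEQ_le[OF 1 2] 3 by (metis add.right_neutral)
qed

text \<open>The difference is the basic operation here: with \<open>f - f\<close> it yields
  uniqueness, and with \<open>f - (0 - g)\<close> it yields the sum.\<close>

lemma bochner_has_integral_diff:
  assumes "bochner_has_integral M f v" "bochner_has_integral M g w"
  shows "bochner_has_integral M (\<lambda>x. f x - g x) (v - w)"
proof -
  obtain s where f: "strongly_measurable M f" and s: "\<And>i. Bochner_Integration.simple_bochner_integrable M (s i)"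
    "(\<lambda>i. \<integral>\<^sup>+x. ennreal (norm (f x - s i x)) \<partial>M) \<longlonglongrightarrow> 0"
    "(\<lambda>i. Bochner_Integration.simple_bochner_integral M (s i)) \<longlonglongrightarrow> v"
    using assms(1) by (auto simp: bochner_has_integral_def)
  obtain r where g: "strongly_measurable M g" and r: "\<And>i. Bochner_Integration.simple_bochner_integrable M (r i)"
    "(\<lambda>i. \<integral>\<^sup>+x. ennreal (norm (g x - r i x)) \<partial>M) \<longlonglongrightarrow> 0"
    "(\<lambda>i. Bochner_Integration.simple_bochner_integral M (r i)) \<longlonglongrightarrow> w"
    using assms(2) by (auto simp: bochner_has_integral_def)
  show ?thesis unfolding bochner_has_integral_def
  proof (intro conjI exI allI)
    show "strongly_measurable M (\<lambda>x. f x - g x)" by (intro strongly_measurable_diff f g)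
    show "Bochner_Integration.simple_bochner_integrable M (\<lambda>x. s i x - r i x)" for i
      by (rule simple_bochner_integrable_compose2[of "(-)"]) (auto intro: s r)
    show "(\<lambda>i. Bochner_Integration.simple_bochner_integral M (\<lambda>x. s i x - r i x)) \<longlonglongrightarrow> v - w"
      using s r by (simp add: simple_bochner_integral_diff tendsto_diff)
    show "(\<lambda>i. \<integral>\<^sup>+x. ennreal (norm (f x - g x - (s i x - r i x))) \<partial>M) \<longlonglongrightarrow> 0"
    proof (rule tendsto_sandwich[OF _ _ tendsto_const])
      show "(\<lambda>i. (\<integral>\<^sup>+x. ennreal (norm (f x - s i x)) \<partial>M) + (\<integral>\<^sup>+x. ennreal (norm (g x - r i x)) \<partial>M)) \<longlonglongrightarrow> 0"
        using tendsto_add[OF s(2) r(2)] by simp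
      have "norm (f x - g x - (s i x - r i x)) \<le> norm (f x - s i x) + norm (g x - r i x)" for i x
        using norm_triangle_ineq4[of "f x - s i x" "g x - r i x"] by (simp add: algebra_simps)
      then show "\<forall>\<^sub>F i in sequentially. (\<integral>\<^sup>+x. ennreal (norm (f x - g x - (s i x - r i x))) \<partial>M) \<le>
          (\<integral>\<^sup>+x. ennreal (norm (f x - s i x)) \<partial>M) + (\<integral>\<^sup>+x. ennreal (norm (g x - r i x)) \<partial>M)"
        by (intro always_eventually allI nn_integral_norm_triangle)
          (auto intro!: strongly_measurable_diff f g
            simple_bochner_integrable_strongly_measurable[OF s(1)] simple_bochner_integrable_strongly_measurable[OF r(1)])
    qed simp
  qed
qed

text \<open>\<open>v - w\<close> is an integral of \<open>f - f = 0\<close>, so the norm estimate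
  makes it 0. This gives the \<open>THE\<close> in \<open>bochner_integral\<close> its
  meaning.\<close>

lemma bochner_has_integral_unique:
  assumes "bochner_has_integral M f v" "bochner_has_integral M f w"
  shows "v = w"
  using bochner_has_integral_norm_le[OF bochner_has_integral_diff[OF assms]] by simp

lemma bochner_integral_eq: "bochner_has_integral M f v \<Longrightarrow> bochner_integral M f = v"
  unfolding bochner_integral_def by (rule the_equality) (auto intro: bochner_has_integral_unique)

lemma bochner_has_integral_integral:
  "bochner_integrable M f \<Longrightarrow> bochner_has_integral M f (bochner_integral M f)"
  unfolding bochner_integrable_def using bochner_integral_eq by blast

lemma bochner_has_integral_bounded_linear:
  assumes "bochner_has_integral M f v" and L: "bounded_linear L"
  shows "bochner_has_integral M (\<lambda>x. L (f x)) (L v)"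
proof -
  interpret L: bounded_linear L by fact
  obtain s where f: "strongly_measurable M f" and s: "\<And>i. Bochner_Integration.simple_bochner_integrable M (s i)"
    "(\<lambda>i. \<integral>\<^sup>+x. ennreal (norm (f x - s i x)) \<partial>M) \<longlonglongrightarrow> 0"
    "(\<lambda>i. Bochner_Integration.simple_bochner_integral M (s i)) \<longlonglongrightarrow> v"
    using assms by (auto simp: bochner_has_integral_def)
  obtain B where B: "0 < B" "\<And>x. norm (L x) \<le> norm x * B" using L.pos_bounded by blast
  show ?thesis unfolding bochner_has_integral_def
  proof (intro conjI exI allI)
    show "strongly_measurable M (\<lambda>x. L (f x))" by (rule strongly_measurable_bounded_linear[OF L f])
    show "Bochner_Integration.simple_bochner_integrable M (\<lambda>x. L (s i x))" for i
      by (rule simple_bochner_integrable_compose2[of "\<lambda>x y. L x", OF _ s(1) s(1)]) (simp add: L.zero)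
    show "(\<lambda>i. Bochner_Integration.simple_bochner_integral M (\<lambda>x. L (s i x))) \<longlonglongrightarrow> L v"
      using s by (simp add: simple_bochner_integral_linear[OF L.linear] L.tendsto)
    show "(\<lambda>i. \<integral>\<^sup>+x. ennreal (norm (L (f x) - L (s i x))) \<partial>M) \<longlonglongrightarrow> 0"
    proof (rule tendsto_sandwich[OF _ _ tendsto_const])
      show "(\<lambda>i. ennreal B * (\<integral>\<^sup>+x. ennreal (norm (f x - s i x)) \<partial>M)) \<longlonglongrightarrow> 0"
        using ennreal_tendsto_cmult[OF _ s(2), of "ennreal B"] by simp
      have "(\<integral>\<^sup>+x. ennreal (norm (L (f x) - L (s i x))) \<partial>M) \<le>
          ennreal B * (\<integral>\<^sup>+x. ennreal (norm (f x - s i x)) \<partial>M)" for i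
      proof -
        have "(\<integral>\<^sup>+x. ennreal (norm (L (f x) - L (s i x))) \<partial>M) \<le>
            (\<integral>\<^sup>+x. ennreal B * ennreal (norm (f x - s i x)) \<partial>M)"
          using B by (intro nn_integral_mono)
            (simp add: ennreal_leI mult.commute flip: L.diff ennreal_mult)
        also have "\<dots> = ennreal B * (\<integral>\<^sup>+x. ennreal (norm (f x - s i x)) \<partial>M)"
          by (intro nn_integral_completion_cmult strongly_measurable_ennreal_norm strongly_measurable_diff f
              simple_bochner_integrable_strongly_measurable[OF s(1)])
        finally show ?thesis .
      qed
      then show "\<forall>\<^sub>F i in sequentially. (\<integral>\<^sup>+x. ennreal (norm (L (f x) - L (s i x))) \<partial>M) \<le>
          ennreal B * (\<integral>\<^sup>+x. ennreal (norm (f x - s i x)) \<partial>M)" by simp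
    qed simp
  qed
qed

lemma bochner_has_integral_zero: "bochner_has_integral M (\<lambda>x. 0) 0"
proof -
  have "Bochner_Integration.simple_bochner_integrable M (\<lambda>x. 0 :: 'b)" by (intro simple_bochner_integrable.intros) auto
  then show ?thesis
    unfolding bochner_has_integral_def
    by (intro conjI exI[of _ "\<lambda>_ _. 0"]) (auto simp: simple_bochner_integral_def image_constant_conv)
qed

lemma bochner_has_integral_add:
  assumes "bochner_has_integral M f v" "bochner_has_integral M g w"
  shows "bochner_has_integral M (\<lambda>x. f x + g x) (v + w)"
  using bochner_has_integral_diff[OF assms(1) bochner_has_integral_diff[OF bochner_has_integral_zero assms(2)]]
  by simp

lemma bochner_has_integral_sum:
  assumes "\<And>i. i \<in> I \<Longrightarrow> bochner_has_integral M (f i) (v i)"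
  shows "bochner_has_integral M (\<lambda>x. \<Sum>i\<in>I. f i x) (\<Sum>i\<in>I. v i)"
  using assms by (induction I rule: infinite_finite_induct)
    (auto intro: bochner_has_integral_zero bochner_has_integral_add)

lemma bochner_has_integral_cong_AE:
  assumes "bochner_has_integral M f v" "AE x in M. f x = g x"
  shows "bochner_has_integral M g v"
proof -
  have "(\<integral>\<^sup>+x. ennreal (norm (g x - s x)) \<partial>M) = (\<integral>\<^sup>+x. ennreal (norm (f x - s x)) \<partial>M)" for s
    using assms(2) by (intro nn_integral_cong_AE) auto
  with assms show ?thesis
    unfolding bochner_has_integral_def by (auto intro: strongly_measurable_cong_AE)
qed

text \<open>The dominated simple functions converge to \<open>f\<close> in \<open>L1\<close>; their
  integrals form a Cauchy sequence, which converges by completeness of the target.\<close>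

lemma bochner_integrableI:
  fixes f :: "'s \<Rightarrow> 'b::banach"
  assumes f: "strongly_measurable M f" and fin: "(\<integral>\<^sup>+x. ennreal (norm (f x)) \<partial>M) < \<infinity>"
  shows "bochner_integrable M f"
proof -
  obtain s where s: "\<And>i. simple_function M (s i)" "AE x in M. (\<lambda>i. s i x) \<longlonglongrightarrow> f x"
    using f by (auto simp: strongly_measurable_def)
  obtain B where B: "\<And>i::nat. B i \<in> sets M"
    "AE x in M. (\<lambda>i. indicat_real (B i) x *\<^sub>R s i x) \<longlonglongrightarrow> f x"
    "AE x in M. \<forall>i. norm (indicat_real (B i) x *\<^sub>R s i x) \<le> 2 * norm (f x)"
    using dominated_simple_functions[OF s] by auto
  define w where "w = (\<lambda>i x. indicat_real (B i) x *\<^sub>R s i x)"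
  have w: "simple_function M (w i)" for i
    unfolding w_def using s(1)[of i] B(1)[of i]
    by (intro simple_function_compose2[where h="(*\<^sub>R)"] simple_function_indicator)
  have mf: "(\<lambda>x. norm (f x)) \<in> borel_measurable (completion M)" using f by (rule strongly_measurable_norm)
  have lim: "(\<lambda>i. \<integral>\<^sup>+x. ennreal (norm (f x - w i x)) \<partial>M) \<longlonglongrightarrow> 0"
  proof (rule nn_integral_dominated_null)
    show "(\<lambda>x. norm (f x - w i x)) \<in> borel_measurable (completion M)" for i
      by (intro strongly_measurable_norm strongly_measurable_diff f strongly_measurable_simple[OF w])
    \<comment> \<open>The approximants are at most \<open>2 * norm (f x)\<close>, so their distance
      to \<open>f\<close> is at most three times the norm.\<close>
    show "(\<lambda>x. 3 * norm (f x)) \<in> borel_measurable (completion M)" using mf by simp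
    show "AE x in M. norm (f x - w i x) \<le> 3 * norm (f x)" for i
      using B(3)
    proof eventually_elim
      case (elim x)
      then show ?case
        using norm_triangle_ineq4[of "f x" "w i x"] unfolding w_def
        by (smt (verit, best))
    qed
    show "(\<integral>\<^sup>+x. ennreal (3 * norm (f x)) \<partial>M) < \<infinity>"
      using fin nn_integral_completion_scale[OF strongly_measurable_ennreal_norm(1)[OF f], of 3]
      by (simp add: ennreal_mult_less_top)
    show "AE x in M. (\<lambda>i. norm (f x - w i x)) \<longlonglongrightarrow> 0"
      using B(2) unfolding w_def
    proof eventually_elim
      case (elim x)
      from tendsto_norm[OF tendsto_diff[OF tendsto_const[of "f x"] elim]] show ?case by simp
    qed
  qed
  have int: "Bochner_Integration.simple_bochner_integrable M (w i)" for i
  proof (rule simple_bochner_integrableI_bounded[OF w])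
    have "(\<integral>\<^sup>+x. ennreal (norm (w i x)) \<partial>M) \<le> (\<integral>\<^sup>+x. ennreal (2 * norm (f x)) \<partial>M)"
    proof (rule nn_integral_mono_AE)
      show "AE x in M. ennreal (norm (w i x)) \<le> ennreal (2 * norm (f x))"
        unfolding w_def using B(3) by eventually_elim (blast intro: ennreal_leI)
    qed
    also have "\<dots> = ennreal 2 * (\<integral>\<^sup>+x. ennreal (norm (f x)) \<partial>M)"
      by (intro nn_integral_completion_scale strongly_measurable_ennreal_norm f) simp
    also have "\<dots> < \<infinity>" using fin by (simp add: ennreal_mult_less_top)
    finally show "(\<integral>\<^sup>+x. ennreal (norm (w i x)) \<partial>M) < \<infinity>" .
  qed
  have "Cauchy (\<lambda>i. Bochner_Integration.simple_bochner_integral M (w i))"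
  proof (rule metric_CauchyI)
    fix e :: real assume "0 < e"
    then have "\<forall>\<^sub>F i in sequentially. (\<integral>\<^sup>+x. ennreal (norm (f x - w i x)) \<partial>M) < ennreal (e / 2)"
      using lim by (intro order_tendstoD(2)) auto
    then obtain N where N: "\<And>i. N \<le> i \<Longrightarrow> (\<integral>\<^sup>+x. ennreal (norm (f x - w i x)) \<partial>M) < ennreal (e / 2)"
      by (auto simp: eventually_sequentially)
    show "\<exists>N. \<forall>m\<ge>N. \<forall>n\<ge>N. dist (Bochner_Integration.simple_bochner_integral M (w m)) (Bochner_Integration.simple_bochner_integral M (w n)) < e"
    proof (intro exI allI impI)
      fix m n assume mn: "N \<le> m" "N \<le> n"
      have "ennreal (dist (Bochner_Integration.simple_bochner_integral M (w m)) (Bochner_Integration.simple_bochner_integral M (w n))) =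
          ennreal (norm (Bochner_Integration.simple_bochner_integral M (\<lambda>x. w m x - w n x)))"
        using int by (simp add: dist_norm simple_bochner_integral_diff)
      also have "\<dots> \<le> (\<integral>\<^sup>+x. ennreal (norm (w m x - w n x)) \<partial>M)"
        by (intro simple_bochner_integral_norm_le simple_bochner_integrable_compose2[of "(-)"] int) simp
      also have "\<dots> \<le> (\<integral>\<^sup>+x. ennreal (norm (f x - w m x)) \<partial>M) + (\<integral>\<^sup>+x. ennreal (norm (f x - w n x)) \<partial>M)"
      proof (rule nn_integral_norm_triangle)
        show "AE x in M. norm (w m x - w n x) \<le> norm (f x - w m x) + norm (f x - w n x)"
        proof (intro always_eventually allI)
          fix x show "norm (w m x - w n x) \<le> norm (f x - w m x) + norm (f x - w n x)"
            using norm_triangle_ineq4[of "f x - w n x" "f x - w m x"] by simp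
        qed
      qed (use f w in \<open>auto intro: strongly_measurable_diff strongly_measurable_simple\<close>)
      also have "\<dots> < ennreal (e / 2) + ennreal (e / 2)"
        using N[OF mn(1)] N[OF mn(2)] by (rule add_strict_mono)
      also have "\<dots> = ennreal e" using \<open>0 < e\<close> by (simp flip: ennreal_plus)
      finally show "dist (Bochner_Integration.simple_bochner_integral M (w m)) (Bochner_Integration.simple_bochner_integral M (w n)) < e"
        using \<open>0 < e\<close> by (simp add: ennreal_less_iff)
    qed
  qed
  then obtain v where "(\<lambda>i. Bochner_Integration.simple_bochner_integral M (w i)) \<longlonglongrightarrow> v"
    using Cauchy_convergent convergent_def by blast
  then show ?thesis
    unfolding bochner_integrable_def bochner_has_integral_def using f int lim by blast
qed

text \<open>The link to the scalar theory: after pairing with a fixed vector, the fundamental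
  theorem of calculus becomes available.\<close>

lemma bochner_has_integral_has_bochner_integral:
  fixes f :: "'s \<Rightarrow> 'b::{real_normed_vector, second_countable_topology}"
  assumes "bochner_has_integral M f v" "f \<in> borel_measurable M"
  shows "has_bochner_integral M f v"
  using assms unfolding bochner_has_integral_def by (auto intro: has_bochner_integral.intros)

lemma norm_add_square_le: "(norm (x + y))\<^sup>2 \<le> 2 * (norm x)\<^sup>2 + 2 * (norm (y :: 'a::real_normed_vector))\<^sup>2"
proof -
  have "(norm (x + y))\<^sup>2 \<le> (norm x + norm y)\<^sup>2" by (intro power_mono norm_triangle_ineq) simp
  also have "\<dots> \<le> 2 * (norm x)\<^sup>2 + 2 * (norm y)\<^sup>2"
    using sum_squares_bound[of "norm x" "norm y"] by (simp add: power2_sum)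
  finally show ?thesis .
qed

lemma norm_diff_square_le: "(norm (x - y))\<^sup>2 \<le> 2 * (norm x)\<^sup>2 + 2 * (norm (y :: 'a::real_normed_vector))\<^sup>2"
  using norm_add_square_le[of x "- y"] by simp

lemma tendsto_scaleC:
  fixes x :: "'b \<Rightarrow> 'a::complex_inner"
  assumes z: "(z \<longlongrightarrow> w) F" and x: "(x \<longlongrightarrow> y) F"
  shows "((\<lambda>i. z i *\<^sub>C x i) \<longlongrightarrow> w *\<^sub>C y) F"
proof (rule LIM_zero_cancel, rule Lim_null_comparison)
  have "((\<lambda>i. cmod (z i) * norm (x i - y) + cmod (z i - w) * norm y) \<longlongrightarrow>
      cmod w * norm (y - y) + cmod (w - w) * norm y) F"
    by (intro tendsto_intros z x)
  then show "((\<lambda>i. cmod (z i) * norm (x i - y) + cmod (z i - w) * norm y) \<longlongrightarrow> 0) F" by simp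
  have "norm (z i *\<^sub>C x i - w *\<^sub>C y) \<le> cmod (z i) * norm (x i - y) + cmod (z i - w) * norm y" for i
    using norm_triangle_ineq[of "z i *\<^sub>C (x i - y)" "(z i - w) *\<^sub>C y"]
    by (simp add: norm_scaleC[symmetric] scaleC_diff_left scaleC_diff_right del: norm_scaleC)
  then show "\<forall>\<^sub>F i in F. norm (z i *\<^sub>C x i - w *\<^sub>C y) \<le> cmod (z i) * norm (x i - y) + cmod (z i - w) * norm y"
    by simp
qed

section \<open>The half-line\<close>

lemma space_half_line [simp]: "space half_line = {0<..}"
  by (simp add: half_line_def space_restrict_space)

lemma AE_half_line: "(AE t in half_line. P t) \<longleftrightarrow> (AE t in lborel. 0 < t \<longrightarrow> P t)"
  unfolding half_line_def by (subst AE_restrict_space_iff) auto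

lemma AE_half_lineI: "(\<And>t. 0 < t \<Longrightarrow> P t) \<Longrightarrow> AE t in half_line. P t"
  by (rule AE_I2) simp

lemma AE_restrict_half_line:
  assumes "0 \<le> t" "AE s in half_line. P s"
  shows "AE s in restrict_space lborel {t<..}. P s"
proof -
  have "AE s in lborel. s \<in> {t<..} \<longrightarrow> P s"
    by (rule eventually_mono[OF assms(2)[unfolded AE_half_line]]) (use assms(1) in simp)
  then show ?thesis by (simp add: AE_restrict_space_iff)
qed

lemma sets_half_line: "B \<in> sets borel \<Longrightarrow> B \<subseteq> {0<..} \<Longrightarrow> B \<in> sets half_line"
  unfolding half_line_def sets_restrict_space by (rule image_eqI[where x = B]) auto

lemma sets_half_line_imp_borel: "B \<in> sets half_line \<Longrightarrow> B \<in> sets borel"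
  unfolding half_line_def by (auto simp: sets_restrict_space)

lemma borel_measurable_half_line: "f \<in> borel_measurable borel \<Longrightarrow> f \<in> borel_measurable half_line"
  unfolding half_line_def by (rule measurable_restrict_space1) simp

lemma borel_measurable_half_line_continuous:
  "continuous_on {0<..} f \<Longrightarrow> f \<in> borel_measurable half_line"
  unfolding half_line_def measurable_cong_sets[OF sets_restrict_space_cong[OF sets_lborel] refl]
  by (rule borel_measurable_continuous_on_restrict)

lemma nn_integral_half_line:
  "(\<integral>\<^sup>+t. f t \<partial>half_line) = (\<integral>\<^sup>+t. f t * indicator {0<..} t \<partial>lborel)"
  unfolding half_line_def by (rule nn_integral_restrict_space) auto

lemma restrict_half_line:
  "0 \<le> t \<Longrightarrow> restrict_space half_line {t<..} = restrict_space lborel {t<..}"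
  unfolding half_line_def by (subst restrict_restrict_space) (auto intro: arg_cong)

lemma strongly_measurable_restrict_half_line:
  assumes "0 \<le> t" "strongly_measurable half_line f"
  shows "strongly_measurable (restrict_space lborel {t<..}) f"
  using strongly_measurable_restrict_space[OF assms(2), of "{t<..}"] assms(1)
  by (simp add: restrict_half_line sets_half_line)

lemma nn_integral_restrict_half_line_le:
  assumes "0 \<le> t"
  shows "(\<integral>\<^sup>+s. f s \<partial>restrict_space lborel {t<..}) \<le> (\<integral>\<^sup>+s. f s \<partial>half_line)"
  unfolding nn_integral_half_line
  by (subst nn_integral_restrict_space) (use assms in \<open>auto intro!: nn_integral_mono split: split_indicator\<close>)

text \<open>Separability of the target is avoided by approximating the real argument: the identity
  is strongly measurable, and \<open>g\<close> is composed with it.\<close>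

lemma strongly_measurable_continuous_on:
  fixes g :: "real \<Rightarrow> 'b::real_normed_vector"
  assumes "continuous_on {c<..} g"
  shows "strongly_measurable (restrict_space lborel {c<..}) g"
proof (rule strongly_measurable_isCont[where F = "\<lambda>s. s"])
  show "strongly_measurable (restrict_space lborel {c<..}) (\<lambda>s::real. s)"
    by (intro strongly_measurable_borel measurable_restrict_space1) simp
  show "AE s in restrict_space lborel {c<..}. isCont g s"
    using assms by (intro AE_I2) (auto simp: continuous_on_eq_continuous_at space_restrict_space)
qed

section \<open>The operator on its initial domain\<close>

context semigroup_estimates
begin

lemma A_zero [simp]: "A 0 = 0"
  using A_scaleC[OF D_zero, of 0] by simp

lemma D_scaleR: "x \<in> D \<Longrightarrow> r *\<^sub>R x \<in> D"
  by (simp add: scaleR_scaleC D_scaleC)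

lemma A_scaleR: "x \<in> D \<Longrightarrow> A (r *\<^sub>R x) = r *\<^sub>R A x"
  by (simp add: scaleR_scaleC A_scaleC)

lemma D_sum: "(\<And>i. i \<in> I \<Longrightarrow> f i \<in> D) \<Longrightarrow> (\<Sum>i\<in>I. f i) \<in> D"
  by (induction I rule: infinite_finite_induct) (auto simp: D_zero D_add)

lemma A_sum: "(\<And>i. i \<in> I \<Longrightarrow> f i \<in> D) \<Longrightarrow> A (\<Sum>i\<in>I. f i) = (\<Sum>i\<in>I. A (f i))"
  by (induction I rule: infinite_finite_induct) (auto simp: A_add D_sum)

text \<open>Strong continuity in time becomes joint continuity because the operators
  \<open>T r\<close> are bounded uniformly by \<open>K\<close>.\<close>

lemma T_jointly_isCont:
  assumes "0 < r"
  shows "isCont (\<lambda>p. T (fst p) (snd p)) (r, y)"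
  unfolding isCont_def
proof (rule LIM_zero_cancel, rule Lim_null_comparison)
  have "isCont (\<lambda>u. T u y) r"
    using continuous_T[of y] assms
    by (intro continuous_on_interior[of "{0..}"]) (auto simp: interior_Ici[of "-1"])
  then have "((\<lambda>p. T (fst p) y) \<longlongrightarrow> T r y) (at (r, y))"
    by (rule isCont_tendsto_compose) (auto intro!: tendsto_eq_intros)
  then have "((\<lambda>p. K * norm (snd p - y) + norm (T (fst p) y - T r y)) \<longlongrightarrow>
      K * norm (y - y) + norm (T r y - T r y)) (at (r, y))"
    by (intro tendsto_intros) (auto intro!: tendsto_eq_intros)
  then show "((\<lambda>p. K * norm (snd p - y) + norm (T (fst p) y - T r y)) \<longlongrightarrow> 0) (at (r, y))"
    by simp
  have "\<forall>\<^sub>F p in at (r, y). 0 < fst p"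
    using assms by (intro order_tendstoD(1)[of fst r]) (auto intro!: tendsto_eq_intros)
  then show "\<forall>\<^sub>F p in at (r, y). norm (T (fst p) (snd p) - T (fst (r, y)) (snd (r, y)))
      \<le> K * norm (snd p - y) + norm (T (fst p) y - T r y)"
  proof eventually_elim
    case (elim p)
    then have "T (fst p) (snd p) - T r y = T (fst p) (snd p - y) + (T (fst p) y - T r y)"
      by (simp add: T_diff)
    also have "norm \<dots> \<le> K * norm (snd p - y) + norm (T (fst p) y - T r y)"
      using elim by (intro order_trans[OF norm_triangle_ineq] add_mono norm_T) auto
    finally show ?case by simp
  qed
qed

lemma strongly_measurable_T:
  assumes "0 \<le> t" "strongly_measurable half_line g"
  shows "strongly_measurable (restrict_space lborel {t<..}) (\<lambda>s. T (s - t) (g s))"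
proof -
  have "strongly_measurable (restrict_space lborel {t<..}) (\<lambda>s. (s - t, g s))"
    by (intro strongly_measurable_Pair strongly_measurable_restrict_half_line assms
        strongly_measurable_borel measurable_restrict_space1) simp
  moreover have "AE s in restrict_space lborel {t<..}. isCont (\<lambda>p. T (fst p) (snd p)) (s - t, g s)"
    by (intro AE_I2 T_jointly_isCont) (simp add: space_restrict_space)
  ultimately show ?thesis
    using strongly_measurable_isCont[of "restrict_space lborel {t<..}" "\<lambda>s. (s - t, g s)"
        "\<lambda>p. T (fst p) (snd p)"] by simp
qed

section \<open>The initial domain as a function space\<close>

lemma L2c_domainE:
  assumes "f \<in> L2c_domain D A"
  obtains a b where "0 < a" "a \<le> b" "AE t in half_line. t \<notin> {a..b} \<longrightarrow> f t = 0"
proof -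
  obtain Z where Z: "compact Z" "Z \<subseteq> {0<..}" "AE t in half_line. t \<notin> Z \<longrightarrow> f t = 0"
    using assms unfolding L2c_domain_def by blast
  \<comment> \<open>The added point keeps the set nonempty, so that its least and greatest elements
    exist even for \<open>f = 0\<close>.\<close>
  define Y where "Y = insert 1 Z"
  have Y: "compact Y" "Y \<noteq> {}" using Z by (auto simp: Y_def)
  obtain a where a: "a \<in> Y" "\<And>t. t \<in> Y \<Longrightarrow> a \<le> t" using compact_attains_inf[OF Y] by blast
  obtain b where b: "b \<in> Y" "\<And>t. t \<in> Y \<Longrightarrow> t \<le> b" using compact_attains_sup[OF Y] by blast
  have "0 < a" using a(1) Z(2) by (auto simp: Y_def)
  moreover have "a \<le> b" using a(2) b(1) by blast
  moreover have "AE t in half_line. t \<notin> {a..b} \<longrightarrow> f t = 0"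
    using Z(3) by eventually_elim (use a b in \<open>auto simp: Y_def\<close>)
  ultimately show ?thesis by (rule that)
qed

lemma L2c_domain_simple:
  assumes "f \<in> L2c_domain D A"
  shows "\<exists>s. (\<forall>i::nat. simple_function half_line (s i) \<and> (\<forall>t>0. s i t \<in> D)) \<and>
    (AE t in half_line. (\<lambda>i. s i t) \<longlonglongrightarrow> f t \<and> (\<lambda>i. A (s i t)) \<longlonglongrightarrow> A (f t))"
  using assms unfolding L2c_domain_def by blast

lemma L2c_domain_in_D: "f \<in> L2c_domain D A \<Longrightarrow> 0 < t \<Longrightarrow> f t \<in> D"
  unfolding L2c_domain_def by blast

lemma L2c_domain_integral:
  "f \<in> L2c_domain D A \<Longrightarrow> (\<integral>\<^sup>+t. ennreal ((norm (f t))\<^sup>2 + (norm (A (f t)))\<^sup>2) \<partial>half_line) < \<infinity>"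
  unfolding L2c_domain_def by blast

lemma L2c_domainI:
  assumes "\<And>t. 0 < t \<Longrightarrow> f t \<in> D"
    and "\<And>i::nat. simple_function half_line (s i)" "\<And>i t. 0 < t \<Longrightarrow> s i t \<in> D"
    and "AE t in half_line. (\<lambda>i. s i t) \<longlonglongrightarrow> f t \<and> (\<lambda>i. A (s i t)) \<longlonglongrightarrow> A (f t)"
    and "AE t in half_line. (norm (f t))\<^sup>2 + (norm (A (f t)))\<^sup>2 \<le> w t"
    and "(\<integral>\<^sup>+t. ennreal (w t) \<partial>half_line) < \<infinity>"
    and "0 < a" "AE t in half_line. t \<notin> {a..b} \<longrightarrow> f t = 0"
  shows "f \<in> L2c_domain D A"
proof -
  have "(\<integral>\<^sup>+t. ennreal ((norm (f t))\<^sup>2 + (norm (A (f t)))\<^sup>2) \<partial>half_line) \<le> (\<integral>\<^sup>+t. ennreal (w t) \<partial>half_line)"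
  proof (rule nn_integral_mono_AE)
    show "AE t in half_line. ennreal ((norm (f t))\<^sup>2 + (norm (A (f t)))\<^sup>2) \<le> ennreal (w t)"
      using assms(5) by eventually_elim (rule ennreal_leI)
  qed
  with assms(6) have "(\<integral>\<^sup>+t. ennreal ((norm (f t))\<^sup>2 + (norm (A (f t)))\<^sup>2) \<partial>half_line) < \<infinity>" by simp
  moreover have "compact {a..b} \<and> {a..b} \<subseteq> {0<..} \<and> (AE t in half_line. t \<notin> {a..b} \<longrightarrow> f t = 0)"
    using assms(7,8) by auto
  ultimately show ?thesis
    unfolding L2c_domain_def using assms(1-4) by blast
qed

lemma L2c_domain_strongly_measurable:
  assumes "f \<in> L2c_domain D A"
  shows "strongly_measurable half_line f" "strongly_measurable half_line (\<lambda>t. A (f t))"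
proof -
  obtain s where s: "\<And>i. simple_function half_line (s i)"
    "AE t in half_line. (\<lambda>i. s i t) \<longlonglongrightarrow> f t \<and> (\<lambda>i. A (s i t)) \<longlonglongrightarrow> A (f t)"
    using L2c_domain_simple[OF assms] by blast
  show "strongly_measurable half_line f"
    unfolding strongly_measurable_def using s by (auto intro!: exI[of _ s])
  show "strongly_measurable half_line (\<lambda>t. A (f t))"
    unfolding strongly_measurable_def using s
    by (auto intro!: exI[of _ "\<lambda>i t. A (s i t)"] simple_function_compose1[where g = A])
qed

lemma L2c_domain_graph_measurable:
  assumes "f \<in> L2c_domain D A"
  shows "(\<lambda>t. ennreal ((norm (f t))\<^sup>2 + (norm (A (f t)))\<^sup>2)) \<in> borel_measurable (completion half_line)"
proof -
  note [measurable] = L2c_domain_strongly_measurable[OF assms, THEN strongly_measurable_norm]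
  show ?thesis by measurable
qed

lemma L2c_domain_scaled_integral:
  assumes "f \<in> L2c_domain D A" "0 \<le> c"
  shows "(\<integral>\<^sup>+t. ennreal (c * ((norm (f t))\<^sup>2 + (norm (A (f t)))\<^sup>2)) \<partial>half_line) < \<infinity>"
  using nn_integral_completion_scale[OF L2c_domain_graph_measurable[OF assms(1)] assms(2)]
    L2c_domain_integral[OF assms(1)]
  by (simp add: ennreal_mult_less_top)

lemma indicator_Icc_measurable:
  "(\<lambda>t. c * indicat_real {a..b} t) \<in> borel_measurable (completion half_line)"
  by (intro measurable_completion borel_measurable_half_line) simp

lemma indicator_Icc_integral_finite:
  "(\<integral>\<^sup>+t. ennreal (c * indicat_real {a..b} t) \<partial>half_line) < \<infinity>"
proof -
  have "(\<integral>\<^sup>+t. ennreal (c * indicat_real {a..b} t) \<partial>half_line) \<le>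
      (\<integral>\<^sup>+t. ennreal c * indicator {a..b} t \<partial>lborel)"
    unfolding nn_integral_half_line by (intro nn_integral_mono) (auto split: split_indicator)
  also have "\<dots> = ennreal c * emeasure lborel {a..b}"
    by (rule nn_integral_cmult_indicator) simp
  also have "\<dots> < \<infinity>" by (simp add: ennreal_mult_less_top emeasure_lborel_Icc_eq)
  finally show ?thesis .
qed

text \<open>On a bounded support, \<open>u \<le> 1 + u^2\<close> turns square integrability into
  integrability.\<close>

lemma L2c_domain_A_integrable:
  assumes "f \<in> L2c_domain D A"
  shows "(\<integral>\<^sup>+t. ennreal (norm (A (f t))) \<partial>half_line) < \<infinity>"
proof -
  obtain a b where ab: "0 < a" "a \<le> b" "AE t in half_line. t \<notin> {a..b} \<longrightarrow> f t = 0"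
    by (rule L2c_domainE[OF assms])
  have "(\<integral>\<^sup>+t. ennreal (norm (A (f t))) \<partial>half_line) \<le> (\<integral>\<^sup>+t. ennreal (1 * indicat_real {a..b} t) +
      ennreal ((norm (f t))\<^sup>2 + (norm (A (f t)))\<^sup>2) \<partial>half_line)"
  proof (rule nn_integral_mono_AE)
    show "AE t in half_line. ennreal (norm (A (f t))) \<le>
      ennreal (1 * indicat_real {a..b} t) + ennreal ((norm (f t))\<^sup>2 + (norm (A (f t)))\<^sup>2)"
      using ab(3)
    proof eventually_elim
      case (elim t)
      have "norm (A (f t)) \<le> 1 + (norm (A (f t)))\<^sup>2"
        using sum_squares_bound[of "norm (A (f t))" 1, unfolded one_power2 mult_1_right]
          norm_ge_zero[of "A (f t)"] by linarith
      then have "norm (A (f t)) \<le> 1 * indicat_real {a..b} t + ((norm (f t))\<^sup>2 + (norm (A (f t)))\<^sup>2)"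
        using elim by (cases "t \<in> {a..b}") (auto intro: order_trans add_increasing)
      then show ?case by (subst ennreal_plus[symmetric]) (simp, simp, rule ennreal_leI)
    qed
  qed
  also have "\<dots> = (\<integral>\<^sup>+t. ennreal (1 * indicat_real {a..b} t) \<partial>half_line) +
      (\<integral>\<^sup>+t. ennreal ((norm (f t))\<^sup>2 + (norm (A (f t)))\<^sup>2) \<partial>half_line)"
    by (intro nn_integral_completion_add L2c_domain_graph_measurable assms
        measurable_compose[OF indicator_Icc_measurable measurable_ennreal])
  also have "\<dots> < \<infinity>"
    using indicator_Icc_integral_finite[of 1 a b] L2c_domain_integral[OF assms] by simp
  finally show ?thesis .
qed

lemma L2c_domain_add:
  assumes f: "f \<in> L2c_domain D A" and g: "g \<in> L2c_domain D A"
  shows "(\<lambda>t. f t + g t) \<in> L2c_domain D A"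
proof -
  obtain a b where ab: "0 < a" "a \<le> b" "AE t in half_line. t \<notin> {a..b} \<longrightarrow> f t = 0"
    by (rule L2c_domainE[OF f])
  obtain a' b' where ab': "0 < a'" "a' \<le> b'" "AE t in half_line. t \<notin> {a'..b'} \<longrightarrow> g t = 0"
    by (rule L2c_domainE[OF g])
  obtain s where s: "\<And>i. simple_function half_line (s i)" "\<And>i t. 0 < t \<Longrightarrow> s i t \<in> D"
    "AE t in half_line. (\<lambda>i. s i t) \<longlonglongrightarrow> f t \<and> (\<lambda>i. A (s i t)) \<longlonglongrightarrow> A (f t)"
    using L2c_domain_simple[OF f] by blast
  obtain r where r: "\<And>i. simple_function half_line (r i)" "\<And>i t. 0 < t \<Longrightarrow> r i t \<in> D"
    "AE t in half_line. (\<lambda>i. r i t) \<longlonglongrightarrow> g t \<and> (\<lambda>i. A (r i t)) \<longlonglongrightarrow> A (g t)"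
    using L2c_domain_simple[OF g] by blast
  have pos: "AE t in half_line. 0 < t" by (rule AE_half_lineI)
  let ?w = "\<lambda>f t. (norm (f t))\<^sup>2 + (norm (A (f t)))\<^sup>2"
  show ?thesis
  proof (rule L2c_domainI[where s = "\<lambda>i t. s i t + r i t" and a = "min a a'" and b = "max b b'"
        and w = "\<lambda>t. 2 * ?w f t + 2 * ?w g t"])
    show "AE t in half_line. (\<lambda>i. s i t + r i t) \<longlonglongrightarrow> f t + g t \<and>
        (\<lambda>i. A (s i t + r i t)) \<longlonglongrightarrow> A (f t + g t)"
      using s(3) r(3) pos
    proof eventually_elim
      case (elim t)
      then show ?case
        using tendsto_add[of "\<lambda>i. A (s i t)" "A (f t)" sequentially "\<lambda>i. A (r i t)"]
        by (auto simp: A_add s(2) r(2) L2c_domain_in_D f g intro: tendsto_add)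
    qed
    show "AE t in half_line. (norm (f t + g t))\<^sup>2 + (norm (A (f t + g t)))\<^sup>2 \<le> 2 * ?w f t + 2 * ?w g t"
      using pos
    proof eventually_elim
      case (elim t)
      then have "A (f t + g t) = A (f t) + A (g t)" by (simp add: A_add L2c_domain_in_D f g)
      then show ?case
        using norm_add_square_le[of "f t" "g t"] norm_add_square_le[of "A (f t)" "A (g t)"] by simp
    qed
    have w: "ennreal (2 * ?w f t + 2 * ?w g t) = 2 * ennreal (?w f t) + 2 * ennreal (?w g t)" for t
    proof -
      have e: "ennreal (2 * x + 2 * y) = 2 * ennreal x + 2 * ennreal y" if "0 \<le> x" "0 \<le> y" for x y
        using that by (simp add: ennreal_mult)
      show ?thesis by (rule e) auto
    qed
    have "(\<integral>\<^sup>+t. ennreal (2 * ?w f t + 2 * ?w g t) \<partial>half_line) =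
        2 * (\<integral>\<^sup>+t. ennreal (?w f t) \<partial>half_line) + 2 * (\<integral>\<^sup>+t. ennreal (?w g t) \<partial>half_line)"
      unfolding w by (intro nn_integral_completion_linear L2c_domain_graph_measurable f g)
    also have "\<dots> < \<infinity>"
      using L2c_domain_integral[OF f] L2c_domain_integral[OF g] by (simp add: ennreal_mult_less_top)
    finally show "(\<integral>\<^sup>+t. ennreal (2 * ?w f t + 2 * ?w g t) \<partial>half_line) < \<infinity>" .
    show "AE t in half_line. t \<notin> {min a a'..max b b'} \<longrightarrow> f t + g t = 0"
      using ab(3) ab'(3) by eventually_elim auto
  qed (use ab ab' s r L2c_domain_in_D[OF f] L2c_domain_in_D[OF g] in \<open>auto intro!: D_add\<close>)
qed

text \<open>Only local boundedness of \<open>c\<close> is required, because the support stays away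
  from 0 and infinity. So the same lemma serves constants and the weights \<open>t powr a\<close> of
  either sign.\<close>

lemma L2c_domain_scale:
  assumes f: "f \<in> L2c_domain D A" and c: "c \<in> borel_measurable half_line"
    and bound: "\<And>a b. 0 < a \<Longrightarrow> \<exists>B. \<forall>t\<in>{a..b}. cmod (c t) \<le> B"
  shows "(\<lambda>t. c t *\<^sub>C f t) \<in> L2c_domain D A"
proof -
  obtain a b where ab: "0 < a" "a \<le> b" "AE t in half_line. t \<notin> {a..b} \<longrightarrow> f t = 0"
    by (rule L2c_domainE[OF f])
  obtain s where s: "\<And>i. simple_function half_line (s i)" "\<And>i t. 0 < t \<Longrightarrow> s i t \<in> D"
    "AE t in half_line. (\<lambda>i. s i t) \<longlonglongrightarrow> f t \<and> (\<lambda>i. A (s i t)) \<longlonglongrightarrow> A (f t)"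
    using L2c_domain_simple[OF f] by blast
  obtain r where r: "\<And>i::nat. simple_function half_line (r i)"
    "AE t in half_line. (\<lambda>i. r i t) \<longlonglongrightarrow> c t"
    using strongly_measurable_borel[OF c] unfolding strongly_measurable_def by blast
  obtain B where B: "\<And>t. t \<in> {a..b} \<Longrightarrow> cmod (c t) \<le> B" using bound[OF ab(1)] by blast
  have pos: "AE t in half_line. 0 < t" by (rule AE_half_lineI)
  let ?w = "\<lambda>t. B\<^sup>2 * ((norm (f t))\<^sup>2 + (norm (A (f t)))\<^sup>2)"
  show ?thesis
  proof (rule L2c_domainI[where s = "\<lambda>i t. r i t *\<^sub>C s i t" and a = a and b = b and w = ?w])
    show "simple_function half_line (\<lambda>t. r i t *\<^sub>C s i t)" for i
      by (rule simple_function_compose2[OF r(1) s(1)])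
    show "AE t in half_line. (\<lambda>i. r i t *\<^sub>C s i t) \<longlonglongrightarrow> c t *\<^sub>C f t \<and>
        (\<lambda>i. A (r i t *\<^sub>C s i t)) \<longlonglongrightarrow> A (c t *\<^sub>C f t)"
      using s(3) r(2) pos
      by eventually_elim (auto simp: A_scaleC s(2) L2c_domain_in_D f intro: tendsto_scaleC)
    show "AE t in half_line. (norm (c t *\<^sub>C f t))\<^sup>2 + (norm (A (c t *\<^sub>C f t)))\<^sup>2 \<le> ?w t"
      using ab(3) pos
    proof eventually_elim
      case (elim t)
      show ?case
      proof (cases "t \<in> {a..b}")
        case True
        have "(cmod (c t))\<^sup>2 * ((norm (f t))\<^sup>2 + (norm (A (f t)))\<^sup>2) \<le> ?w t"
          by (intro mult_right_mono power_mono B True) auto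
        then show ?thesis
          using elim by (simp add: A_scaleC L2c_domain_in_D f power_mult_distrib algebra_simps)
      qed (use elim in auto)
    qed
    show "(\<integral>\<^sup>+t. ennreal (?w t) \<partial>half_line) < \<infinity>" by (rule L2c_domain_scaled_integral[OF f]) simp
    show "AE t in half_line. t \<notin> {a..b} \<longrightarrow> c t *\<^sub>C f t = 0"
      using ab(3) by eventually_elim auto
  qed (use ab s L2c_domain_in_D[OF f] in \<open>auto intro!: D_scaleC\<close>)
qed

section \<open>The operator as a Bochner integral\<close>

definition M_op :: "(real \<Rightarrow> 'a) \<Rightarrow> real \<Rightarrow> 'a" where
  "M_op f t = bochner_integral (restrict_space lborel {t<..}) (\<lambda>s. A (T (s - t) (f s)))"

text \<open>This replaces the singular factor \<open>A (T (s - t))\<close> by the bounded operator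
  \<open>T (s - t)\<close> applied to \<open>A (f s)\<close>; it is the reason why the integral
  converges absolutely on the initial domain.\<close>

lemma M_op_integrand:
  assumes "f \<in> L2c_domain D A" "0 \<le> t" "t < s"
  shows "A (T (s - t) (f s)) = T (s - t) (A (f s))"
  using assms by (intro A_T L2c_domain_in_D) auto

lemma M_op_integrable:
  assumes f: "f \<in> L2c_domain D A" and t: "0 \<le> t"
  shows "bochner_integrable (restrict_space lborel {t<..}) (\<lambda>s. A (T (s - t) (f s)))"
proof (rule bochner_integrableI)
  let ?R = "restrict_space lborel {t<..}"
  have eq: "AE s in ?R. T (s - t) (A (f s)) = A (T (s - t) (f s))"
    by (intro AE_I2) (simp add: space_restrict_space M_op_integrand[OF f t])
  show "strongly_measurable ?R (\<lambda>s. A (T (s - t) (f s)))"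
    by (rule strongly_measurable_cong_AE[OF strongly_measurable_T[OF t] eq])
      (rule L2c_domain_strongly_measurable(2)[OF f])
  have "(\<integral>\<^sup>+s. ennreal (norm (A (T (s - t) (f s)))) \<partial>?R) \<le> (\<integral>\<^sup>+s. ennreal (K * norm (A (f s))) \<partial>?R)"
    by (intro nn_integral_mono ennreal_leI)
      (use norm_T in \<open>auto simp: space_restrict_space M_op_integrand[OF f t]\<close>)
  also have "\<dots> \<le> (\<integral>\<^sup>+s. ennreal (K * norm (A (f s))) \<partial>half_line)"
    by (rule nn_integral_restrict_half_line_le[OF t])
  also have "\<dots> = ennreal K * (\<integral>\<^sup>+s. ennreal (norm (A (f s))) \<partial>half_line)"
    using K_ge_1 by (intro nn_integral_completion_scale strongly_measurable_ennreal_norm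
        L2c_domain_strongly_measurable f) auto
  also have "\<dots> < \<infinity>" using L2c_domain_A_integrable[OF f] by (simp add: ennreal_mult_less_top)
  finally show "(\<integral>\<^sup>+s. ennreal (norm (A (T (s - t) (f s)))) \<partial>?R) < \<infinity>" .
qed

lemma M_op_has_integral:
  assumes f: "f \<in> L2c_domain D A" and t: "0 \<le> t"
  shows "bochner_has_integral (restrict_space lborel {t<..}) (\<lambda>s. A (T (s - t) (f s))) (M_op f t)"
  unfolding M_op_def by (rule bochner_has_integral_integral[OF M_op_integrable[OF f t]])

lemma M_op_eqI:
  assumes f: "f \<in> L2c_domain D A" and t: "0 \<le> t"
    and "bochner_has_integral (restrict_space lborel {t<..}) (\<lambda>s. T (s - t) (A (f s))) v"
  shows "M_op f t = v"
  unfolding M_op_def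
  by (rule bochner_integral_eq, rule bochner_has_integral_cong_AE[OF assms(3)])
    (auto intro!: AE_I2 simp: space_restrict_space M_op_integrand[OF f t])

lemma M_op_add:
  assumes f: "f \<in> L2c_domain D A" and g: "g \<in> L2c_domain D A" and t: "0 \<le> t"
  shows "M_op (\<lambda>s. f s + g s) t = M_op f t + M_op g t"
  unfolding M_op_def[of "\<lambda>s. f s + g s"]
  by (rule bochner_integral_eq, rule bochner_has_integral_cong_AE[OF
        bochner_has_integral_add[OF M_op_has_integral[OF f t] M_op_has_integral[OF g t]]])
    (use t in \<open>auto intro!: AE_I2 simp: space_restrict_space T_add A_add T_in_D\<close>)

lemma M_op_scaleC:
  assumes f: "f \<in> L2c_domain D A" and t: "0 \<le> t"
  shows "M_op (\<lambda>s. c *\<^sub>C f s) t = c *\<^sub>C M_op f t"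
  unfolding M_op_def[of "\<lambda>s. c *\<^sub>C f s"]
  by (rule bochner_integral_eq, rule bochner_has_integral_cong_AE[OF
        bochner_has_integral_bounded_linear[OF M_op_has_integral[OF f t]
          bounded_linear_scaleC_compose[OF bounded_linear_ident]]])
    (use t in \<open>auto intro!: AE_I2 simp: space_restrict_space T_scaleC A_scaleC T_in_D\<close>)

text \<open>The right-hand side does not depend on \<open>t\<close>. Convergence of
  \<open>A (f s)\<close> in \<open>L1\<close> therefore gives uniform convergence of the
  images.\<close>

lemma norm_M_op_diff_le:
  assumes f: "f \<in> L2c_domain D A" and g: "g \<in> L2c_domain D A" and t: "0 \<le> t"
  shows "ennreal (norm (M_op f t - M_op g t)) \<le>
    (\<integral>\<^sup>+s. ennreal (K * norm (A (f s) - A (g s))) \<partial>half_line)"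
proof -
  have "ennreal (norm (M_op f t - M_op g t)) \<le>
      (\<integral>\<^sup>+s. ennreal (norm (A (T (s - t) (f s)) - A (T (s - t) (g s)))) \<partial>restrict_space lborel {t<..})"
    by (intro bochner_has_integral_norm_le bochner_has_integral_diff M_op_has_integral f g t)
  also have "\<dots> \<le> (\<integral>\<^sup>+s. ennreal (K * norm (A (f s) - A (g s))) \<partial>restrict_space lborel {t<..})"
  proof (intro nn_integral_mono ennreal_leI)
    fix s assume "s \<in> space (restrict_space lborel {t<..})"
    then have "t < s" by (simp add: space_restrict_space)
    then show "norm (A (T (s - t) (f s)) - A (T (s - t) (g s))) \<le> K * norm (A (f s) - A (g s))"
      using norm_T[of "s - t" "A (f s) - A (g s)"] t
      by (simp add: M_op_integrand f g flip: T_diff)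
  qed
  also have "\<dots> \<le> (\<integral>\<^sup>+s. ennreal (K * norm (A (f s) - A (g s))) \<partial>half_line)"
    by (rule nn_integral_restrict_half_line_le[OF t])
  finally show ?thesis .
qed

end

section \<open>Step functions\<close>

lemma nat_floor_divide_eq:
  fixes h s :: real
  assumes "0 < h" "0 \<le> s"
  shows "nat \<lfloor>s / h\<rfloor> = m \<longleftrightarrow> s \<in> {real m * h..<real (Suc m) * h}"
proof -
  have "nat \<lfloor>s / h\<rfloor> = m \<longleftrightarrow> \<lfloor>s / h\<rfloor> = int m"
    using assms by auto
  also have "\<dots> \<longleftrightarrow> real m \<le> s / h \<and> s / h < real m + 1"
    by (simp add: floor_eq_iff)
  also have "\<dots> \<longleftrightarrow> s \<in> {real m * h..<real (Suc m) * h}"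
    using assms by (simp add: field_simps)
  finally show ?thesis .
qed

lemma nn_integral_half_line_step:
  fixes g :: "nat \<Rightarrow> real"
  assumes h: "0 < h" and g: "\<And>n. 0 \<le> g n" "\<And>n. L \<le> n \<Longrightarrow> g n = 0"
  shows "(\<integral>\<^sup>+t. ennreal (g (nat \<lfloor>t / h\<rfloor>)) \<partial>half_line) = ennreal (h * (\<Sum>n<L. g n))"
proof -
  let ?I = "\<lambda>n. {real n * h..<real (Suc n) * h} \<inter> {0<..}"
  have sets: "?I n \<in> sets half_line" for n by (intro sets_half_line) auto
  have meas: "emeasure half_line (?I n) = ennreal h" for n
  proof -
    have "emeasure half_line (?I n) = emeasure lborel (?I n)"
      unfolding half_line_def by (rule emeasure_restrict_space) auto
    also have "\<dots> = ennreal h"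
    \<comment> \<open>The cell \<open>n = 0\<close> loses its end point 0, which does not change its
      measure.\<close>
    proof (cases n)
      case 0
      then have "?I n = {0<..<h}" by auto
      then show ?thesis using h by simp
    next
      case (Suc m)
      then have "0 < real n * h" using h by simp
      then have "?I n = {real n * h..<real (Suc n) * h}" by auto
      then show ?thesis using h by (simp add: algebra_simps)
    qed
    finally show ?thesis .
  qed
  have "(\<integral>\<^sup>+t. ennreal (g (nat \<lfloor>t / h\<rfloor>)) \<partial>half_line) =
      (\<integral>\<^sup>+t. (\<Sum>n<L. ennreal (g n) * indicator (?I n) t) \<partial>half_line)"
  proof (rule nn_integral_cong)
    fix t :: real assume "t \<in> space half_line"
    then have t: "0 < t" by simp
    define m where "m = nat \<lfloor>t / h\<rfloor>"
    have ind: "indicator (?I n) t = (if n = m then 1 else 0 :: ennreal)" for n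
      using nat_floor_divide_eq[of h t n] h t by (auto simp: m_def indicator_def)
    show "ennreal (g (nat \<lfloor>t / h\<rfloor>)) = (\<Sum>n<L. ennreal (g n) * indicator (?I n) t)"
      unfolding ind using g(2)[of m] by (cases "m < L") (auto simp: m_def[symmetric] if_distrib cong: if_cong)
  qed
  also have "\<dots> = (\<Sum>n<L. ennreal (g n) * emeasure half_line (?I n))"
  proof -
    have "(\<lambda>t. ennreal (g n) * indicator (?I n) t) \<in> borel_measurable half_line" for n
      by (intro borel_measurable_times_ennreal borel_measurable_const borel_measurable_indicator sets)
    then show ?thesis by (subst nn_integral_sum) (simp_all only: nn_integral_cmult_indicator[OF sets])
  qed
  also have "\<dots> = ennreal (h * (\<Sum>n<L. g n))"
    unfolding meas using g h by (simp add: sum_distrib_left mult.commute flip: ennreal_mult sum_ennreal)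
  finally show ?thesis .
qed

lemma has_integral_has_bochner_integral:
  fixes f :: "real \<Rightarrow> real"
  assumes "has_bochner_integral lborel f v"
  shows "(f has_integral v) UNIV"
  using has_integral_integral_real[of f] assms by (simp add: has_bochner_integral_iff)

context semigroup_estimates
begin

text \<open>The integrand is minus the derivative of \<open>s \<mapsto> T (s - t) x\<close>.
  Existence of the integral follows from absolute integrability, and its value is found by pairing
  with an arbitrary \<open>y\<close> and using the fundamental theorem for real functions. The
  truncations \<open>max 0\<close> remove the part of \<open>{a..<b}\<close> to the left of
  \<open>t\<close>.\<close>

lemma T_A_integral:
  assumes x: "x \<in> D" and ab: "a \<le> b" and t: "0 \<le> t"
  shows "bochner_has_integral (restrict_space lborel {t<..})
    (\<lambda>s. indicat_real {a..<b} s *\<^sub>R T (s - t) (A x)) (T (max 0 (a - t)) x - T (max 0 (b - t)) x)"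
proof -
  let ?R = "restrict_space lborel {t<..}"
  let ?g = "\<lambda>s. indicat_real {a..<b} s *\<^sub>R T (s - t) (A x)"
  have ind: "indicat_real {a..<b} \<in> borel_measurable ?R"
    by (rule measurable_restrict_space1) simp
  have "bochner_integrable ?R ?g"
  proof (rule bochner_integrableI)
    show "strongly_measurable ?R ?g"
      by (intro strongly_measurable_scaleR strongly_measurable_T t strongly_measurable_borel ind) simp
    have "(\<integral>\<^sup>+s. ennreal (norm (?g s)) \<partial>?R) \<le> (\<integral>\<^sup>+s. ennreal (K * norm (A x) * indicat_real {a..b} s) \<partial>?R)"
      using norm_T K_ge_1 by (intro nn_integral_mono ennreal_leI)
        (auto simp: space_restrict_space indicator_def)
    also have "\<dots> \<le> (\<integral>\<^sup>+s. ennreal (K * norm (A x) * indicat_real {a..b} s) \<partial>half_line)"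
      by (rule nn_integral_restrict_half_line_le[OF t])
    also have "\<dots> < \<infinity>" by (rule indicator_Icc_integral_finite)
    finally show "(\<integral>\<^sup>+s. ennreal (norm (?g s)) \<partial>?R) < \<infinity>" .
  qed
  then obtain v where v: "bochner_has_integral ?R ?g v" by (auto simp: bochner_integrable_def)
  have "v \<bullet> y = (T (max 0 (a - t)) x - T (max 0 (b - t)) x) \<bullet> y" for y
  proof -
    let ?F = "\<lambda>s. T (s - t) (A x) \<bullet> y"
    let ?a = "max t a" and ?b = "max t b"
    have cont: "continuous_on {t..} (\<lambda>s. T (s - t) z \<bullet> y)" for z
      by (intro continuous_intros continuous_on_compose2[OF continuous_T]) auto
    have "?F \<in> borel_measurable ?R"
      unfolding measurable_cong_sets[OF sets_restrict_space_cong[OF sets_lborel] refl]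
      by (intro borel_measurable_continuous_on_restrict continuous_on_subset[OF cont]) auto
    then have m: "(\<lambda>s. ?g s \<bullet> y) \<in> borel_measurable ?R"
      using ind by simp
    have "has_bochner_integral ?R (\<lambda>s. ?g s \<bullet> y) (v \<bullet> y)"
      by (rule bochner_has_integral_has_bochner_integral[OF
            bochner_has_integral_bounded_linear[OF v bounded_linear_inner_left] m])
    then have "has_bochner_integral lborel (\<lambda>s. indicator {t<..} s *\<^sub>R (?g s \<bullet> y)) (v \<bullet> y)"
      by (simp add: has_bochner_integral_restrict_space)
    then have 1: "((\<lambda>s. indicator {t<..} s *\<^sub>R (?g s \<bullet> y)) has_integral (v \<bullet> y)) UNIV"
      by (rule has_integral_has_bochner_integral)
    \<comment> \<open>The interior form of the theorem is used, as the orbit is known to be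
      differentiable at positive times only and \<open>s = t\<close> may be an end point.\<close>
    have "(?F has_integral (- (T (?b - t) x \<bullet> y) - - (T (?a - t) x \<bullet> y))) {?a..?b}"
    proof (rule fundamental_theorem_of_calculus_interior)
      show "continuous_on {?a..?b} (\<lambda>s. - (T (s - t) x \<bullet> y))"
        by (intro continuous_on_minus continuous_on_subset[OF cont]) auto
      fix s assume "s \<in> {?a<..<?b}"
      then have "0 < s - t" by auto
      have "((\<lambda>s. s - t) has_vector_derivative 1) (at s)"
        by (auto intro!: derivative_eq_intros)
      from vector_diff_chain_at[where f = "\<lambda>s. s - t" and f' = 1 and x = s, OF this deriv_T[OF \<open>0 < s - t\<close> x]]
      have "((\<lambda>s. T (s - t) x) has_vector_derivative - T (s - t) (A x)) (at s)"
        by (simp add: o_def)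
      from bounded_linear.has_vector_derivative[OF bounded_linear_inner_left this, of y]
      show "((\<lambda>s. - (T (s - t) x \<bullet> y)) has_vector_derivative ?F s) (at s)"
        by (auto intro!: derivative_eq_intros)
    qed (use ab in auto)
    then have "((\<lambda>s. if s \<in> {?a..?b} then ?F s else 0) has_integral
        (- (T (?b - t) x \<bullet> y) - - (T (?a - t) x \<bullet> y))) UNIV"
      by (simp only: has_integral_restrict_UNIV)
    then have "((\<lambda>s. indicator {t<..} s *\<^sub>R (?g s \<bullet> y)) has_integral
        (- (T (?b - t) x \<bullet> y) - - (T (?a - t) x \<bullet> y))) UNIV"
      \<comment> \<open>The indicators and the closed interval disagree at most at the two end
        points.\<close>
      by (rule has_integral_spike_finite[of "{?a, ?b}", rotated 2]) (auto simp: indicator_def)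
    from has_integral_unique[OF 1 this]
    have "v \<bullet> y = T (?a - t) x \<bullet> y - T (?b - t) x \<bullet> y" by simp
    also have "?a - t = max 0 (a - t)" by simp
    also have "?b - t = max 0 (b - t)" by simp
    finally show ?thesis by (simp add: inner_diff_left)
  qed
  then have "v = T (max 0 (a - t)) x - T (max 0 (b - t)) x" by (metis vector_eq_rdot)
  with v show ?thesis by simp
qed

text \<open>From \<open>(u + v)^2 \<le> 2 * u^2 + 2 * v^2\<close> applied to the two terms of
  \<open>M_op_step_discrete\<close>.\<close>

definition M_op_const :: real where
  "M_op_const = 2 * (1 + K)\<^sup>2 + 2 * K\<^sup>2 * multiplier_const\<^sup>2"

section \<open>Step functions with value \<open>X m\<close> on the \<open>m\<close>-th cell of a
  grid of mesh \<open>h\<close>\<close>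

context
  fixes h :: real and X :: "nat \<Rightarrow> 'a" and L :: nat
  assumes h: "0 < h" and X: "\<And>m. X m \<in> D" "X 0 = 0" "\<And>m. L \<le> m \<Longrightarrow> X m = 0"
begin

text \<open>The map \<open>F\<close> is arbitrary, so that the decomposition applies to the step
  function and equally to its image under \<open>T (s - t)\<close> composed with
  \<open>A\<close>.\<close>

lemma step_eq_sum:
  fixes F :: "'a \<Rightarrow> 'b::real_vector"
  assumes "0 < s" "F 0 = 0"
  shows "F (X (nat \<lfloor>s / h\<rfloor>)) = (\<Sum>m<L. indicat_real {real m * h..<real (Suc m) * h} s *\<^sub>R F (X m))"
proof -
  have "indicat_real {real m * h..<real (Suc m) * h} s *\<^sub>R F (X m) =
      (if m = nat \<lfloor>s / h\<rfloor> then F (X m) else 0)" for m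
    using nat_floor_divide_eq[of h s m] assms h by (auto simp: indicator_def)
  then show ?thesis
    using X(3)[of "nat \<lfloor>s / h\<rfloor>"] assms(2) by (cases "nat \<lfloor>s / h\<rfloor> < L") auto
qed

lemma simple_function_step: "simple_function half_line (\<lambda>s. X (nat \<lfloor>s / h\<rfloor>))" (is "simple_function _ ?f")
proof -
  have "simple_function half_line (\<lambda>s. \<Sum>m\<in>{1..<L}. indicat_real ({real m * h..<real (Suc m) * h}) s *\<^sub>R X m)"
  proof (rule simple_function_sum)
    fix m assume "m \<in> {1..<L}"
    then have "{real m * h..<real (Suc m) * h} \<in> sets half_line"
      using h by (intro sets_half_line) (auto intro: less_le_trans[of 0 "real m * h"])
    from simple_function_indicator[OF this]
    show "simple_function half_line (\<lambda>s. indicat_real {real m * h..<real (Suc m) * h} s *\<^sub>R X m)"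
      by (rule simple_function_compose1[where g = "\<lambda>r. r *\<^sub>R X m"])
  qed
  moreover have "(\<Sum>m\<in>{1..<L}. indicat_real ({real m * h..<real (Suc m) * h}) s *\<^sub>R X m) = ?f s" if "0 < s" for s
    unfolding step_eq_sum[where F = "\<lambda>x. x", OF that refl]
    by (rule sum.mono_neutral_left) (auto simp: X(2) Suc_le_eq)
  ultimately show ?thesis by (subst simple_function_cong[symmetric]) auto
qed

text \<open>\<open>X 0 = 0\<close> keeps the support away from 0, and the vanishing from
  \<open>L\<close> on keeps it bounded. The function is its own approximating sequence.\<close>

lemma step_in_L2c_domain: "(\<lambda>s. X (nat \<lfloor>s / h\<rfloor>)) \<in> L2c_domain D A"
proof -
  let ?f = "\<lambda>s. X (nat \<lfloor>s / h\<rfloor>)"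
  let ?c = "\<Sum>m<L. (norm (X m))\<^sup>2 + (norm (A (X m)))\<^sup>2"
  have zero: "?f s = 0" if "s \<notin> {h..real L * h}" "0 < s" for s
  proof -
    have "nat \<lfloor>s / h\<rfloor> = 0" if "s < h"
      using nat_floor_divide_eq[of h s 0] h that \<open>0 < s\<close> by simp
    moreover have "L \<le> nat \<lfloor>s / h\<rfloor>" if "real L * h < s"
      using that h \<open>0 < s\<close> by (simp add: le_nat_iff le_floor_iff field_simps)
    ultimately show ?thesis using that X(2,3) by (cases "s < h") auto
  qed
  show ?thesis
  proof (rule L2c_domainI[where s = "\<lambda>_. ?f" and a = h and b = "real L * h"
        and w = "\<lambda>s. ?c * indicat_real {h..real L * h} s"])
    show "AE s in half_line. (norm (?f s))\<^sup>2 + (norm (A (?f s)))\<^sup>2 \<le> ?c * indicat_real {h..real L * h} s"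
    proof (rule AE_half_lineI)
      fix s :: real assume s: "0 < s"
      show "(norm (?f s))\<^sup>2 + (norm (A (?f s)))\<^sup>2 \<le> ?c * indicat_real {h..real L * h} s"
      proof (cases "s \<in> {h..real L * h} \<and> nat \<lfloor>s / h\<rfloor> < L")
        case True
        then have "(norm (?f s))\<^sup>2 + (norm (A (?f s)))\<^sup>2 \<le> ?c"
          by (intro member_le_sum) auto
        then show ?thesis using True by simp
      next
        case False
        then have "?f s = 0" using zero[OF _ s] X(3) by (meson not_le)
        moreover have "0 \<le> ?c" by (intro sum_nonneg) auto
        ultimately show ?thesis by simp
      qed
    qed
    show "(\<integral>\<^sup>+s. ennreal (?c * indicat_real {h..real L * h} s) \<partial>half_line) < \<infinity>"
      by (rule indicator_Icc_integral_finite)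
    show "AE s in half_line. s \<notin> {h..real L * h} \<longrightarrow> ?f s = 0"
      using zero by (intro AE_half_lineI) auto
  qed (use simple_function_step X h in auto)
qed

text \<open>Each cell is integrated exactly, so the discretisation introduces no quadrature
  error.\<close>

lemma M_op_step:
  assumes t: "0 \<le> t"
  shows "M_op (\<lambda>s. X (nat \<lfloor>s / h\<rfloor>)) t =
    (\<Sum>m<L. T (max 0 (real m * h - t)) (X m) - T (max 0 (real (Suc m) * h - t)) (X m))"
proof (rule M_op_eqI[OF step_in_L2c_domain t])
  let ?R = "restrict_space lborel {t<..}"
  have "bochner_has_integral ?R
      (\<lambda>s. \<Sum>m<L. indicat_real {real m * h..<real (Suc m) * h} s *\<^sub>R T (s - t) (A (X m)))
      (\<Sum>m<L. T (max 0 (real m * h - t)) (X m) - T (max 0 (real (Suc m) * h - t)) (X m))"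
    using h t by (intro bochner_has_integral_sum T_A_integral X) (auto intro: mult_right_mono)
  moreover have "AE s in ?R. (\<Sum>m<L. indicat_real {real m * h..<real (Suc m) * h} s *\<^sub>R T (s - t) (A (X m))) =
      T (s - t) (A (X (nat \<lfloor>s / h\<rfloor>)))"
    using t by (intro AE_I2 step_eq_sum[where F = "\<lambda>x. T (_ - t) (A x)", symmetric])
      (auto simp: space_restrict_space)
  ultimately show "bochner_has_integral ?R (\<lambda>s. T (s - t) (A (X (nat \<lfloor>s / h\<rfloor>))))
      (\<Sum>m<L. T (max 0 (real m * h - t)) (X m) - T (max 0 (real (Suc m) * h - t)) (X m))"
    by (rule bochner_has_integral_cong_AE)
qed

lemma continuous_M_op_step: "continuous_on {0<..} (M_op (\<lambda>s. X (nat \<lfloor>s / h\<rfloor>)))"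
proof -
  have "continuous_on {0<..} (\<lambda>t. T (max 0 (c - t)) x)" for c x
    by (rule continuous_on_compose2[OF continuous_T, of _ "\<lambda>t. max 0 (c - t)"])
      (auto intro!: continuous_intros)
  then have "continuous_on {0<..} (\<lambda>t. \<Sum>m<L. T (max 0 (real m * h - t)) (X m) - T (max 0 (real (Suc m) * h - t)) (X m))"
    by (intro continuous_intros)
  then show ?thesis by (rule continuous_on_eq) (simp add: M_op_step)
qed

text \<open>At the left end of the cell after the one that contains \<open>t\<close>, the operator is exactly
  the discrete convolution.\<close>

lemma M_op_step_discrete:
  assumes t: "0 < t"
  defines "n \<equiv> nat \<lfloor>t / h\<rfloor>"
  shows "norm (M_op (\<lambda>s. X (nat \<lfloor>s / h\<rfloor>)) t) \<le>
    (1 + K) * norm (X n) + K * norm (\<Sum>k<L. T_increment h (real k * h) (X (Suc (n + k))))"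
proof -
  \<comment> \<open>The distance from \<open>t\<close> to the right end of its cell. The factor
    \<open>T \<tau>\<close>, bounded by \<open>K\<close>, is all that separates the value at
    \<open>t\<close> from the value at a grid point.\<close>
  define \<tau> where "\<tau> = real (Suc n) * h - t"
  have n: "real n * h \<le> t" "t < real (Suc n) * h"
    using nat_floor_divide_eq[of h t n] h t by (auto simp: n_def)
  then have \<tau>: "0 < \<tau>" by (simp add: \<tau>_def)
  have split: "(\<Sum>m<p + q. u m) = (\<Sum>m<p. u m) + (\<Sum>k<q. u (p + k))" for u :: "nat \<Rightarrow> 'a" and p q
    by (induction q) (auto simp: algebra_simps)
  let ?u = "\<lambda>m. T (max 0 (real m * h - t)) (X m) - T (max 0 (real (Suc m) * h - t)) (X m)"
  have "M_op (\<lambda>s. X (nat \<lfloor>s / h\<rfloor>)) t = (\<Sum>m<L. ?u m)" using t by (simp add: M_op_step)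
  \<comment> \<open>Zero terms are appended so that the sum can be split at \<open>n\<close>
    regardless of whether \<open>n < L\<close>.\<close>
  also have "\<dots> = (\<Sum>m<Suc n + L. ?u m)"
    by (rule sum.mono_neutral_left) (auto simp: X)
  also have "\<dots> = (\<Sum>m<n. ?u m) + ?u n + (\<Sum>k<L. ?u (Suc n + k))"
    unfolding split by simp
  \<comment> \<open>Cells entirely to the left of \<open>t\<close>: both truncated times are
    0.\<close>
  also have "(\<Sum>m<n. ?u m) = 0"
  proof (intro sum.neutral ballI)
    fix m assume "m \<in> {..<n}"
    then have "real (Suc m) * h \<le> real n * h" using h by (intro mult_right_mono) auto
    moreover have "real m * h \<le> real (Suc m) * h" using h by (intro mult_right_mono) auto
    ultimately have "max 0 (real m * h - t) = 0" "max 0 (real (Suc m) * h - t) = 0"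
      using n by linarith+
    then show "?u m = 0" by simp
  qed
  \<comment> \<open>The cell containing \<open>t\<close> contributes only its part to the right of
    \<open>t\<close>.\<close>
  also have "?u n = X n - T \<tau> (X n)"
  proof -
    have "max 0 (real n * h - t) = 0" "max 0 (real (Suc n) * h - t) = \<tau>"
      using n unfolding \<tau>_def by linarith+
    then show ?thesis by (simp only: T_zero)
  qed
  also have "(\<Sum>k<L. ?u (Suc n + k)) = (\<Sum>k<L. T \<tau> (T_increment h (real k * h) (X (Suc (n + k)))))"
  proof (rule sum.cong[OF refl])
    fix k
    have 1: "real (Suc n + k) * h - t = \<tau> + real k * h"
      and 2: "real (Suc (Suc n + k)) * h - t = \<tau> + (real k * h + h)"
      by (simp_all add: \<tau>_def algebra_simps)
    show "?u (Suc n + k) = T \<tau> (T_increment h (real k * h) (X (Suc (n + k))))"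
      unfolding 1 2 using \<tau> h by (simp add: max_def T_increment_def T_diff T_plus)
  qed
  also have "\<dots> = T \<tau> (\<Sum>k<L. T_increment h (real k * h) (X (Suc (n + k))))"
    using \<tau> by (induction L) (auto simp: T_add)
  finally have eq: "M_op (\<lambda>s. X (nat \<lfloor>s / h\<rfloor>)) t =
      X n - T \<tau> (X n) + T \<tau> (\<Sum>k<L. T_increment h (real k * h) (X (Suc (n + k))))" by simp
  have "norm (X n - T \<tau> (X n)) \<le> (1 + K) * norm (X n)"
    using norm_triangle_ineq4[of "X n" "T \<tau> (X n)"] norm_T[of \<tau> "X n"] \<tau> by (simp add: algebra_simps)
  then show ?thesis
    unfolding eq using norm_T[of \<tau>] \<tau> by (intro order_trans[OF norm_triangle_ineq] add_mono) auto
qed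

text \<open>The pointwise bound depends on \<open>t\<close> through its cell only, so both integrals
  are \<open>h\<close> times sums over cells and the factor \<open>h\<close> cancels. The constant
  does not depend on the mesh.\<close>

lemma M_op_step_bound:
  "(\<integral>\<^sup>+t. ennreal ((norm (M_op (\<lambda>s. X (nat \<lfloor>s / h\<rfloor>)) t))\<^sup>2) \<partial>half_line) \<le>
    ennreal M_op_const * (\<integral>\<^sup>+t. ennreal ((norm (X (nat \<lfloor>t / h\<rfloor>)))\<^sup>2) \<partial>half_line)"
proof -
  define Y where "Y = (\<lambda>n. \<Sum>k<L. T_increment h (real k * h) (X (Suc (n + k))))"
  define G where "G = (\<lambda>n. 2 * (1 + K)\<^sup>2 * (norm (X n))\<^sup>2 + 2 * K\<^sup>2 * (norm (Y n))\<^sup>2)"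
  have "(\<integral>\<^sup>+t. ennreal ((norm (M_op (\<lambda>s. X (nat \<lfloor>s / h\<rfloor>)) t))\<^sup>2) \<partial>half_line) \<le>
      (\<integral>\<^sup>+t. ennreal (G (nat \<lfloor>t / h\<rfloor>)) \<partial>half_line)"
  proof (intro nn_integral_mono ennreal_leI)
    fix t :: real assume "t \<in> space half_line"
    then have t: "0 < t" by simp
    let ?n = "nat \<lfloor>t / h\<rfloor>"
    have "(norm (M_op (\<lambda>s. X (nat \<lfloor>s / h\<rfloor>)) t))\<^sup>2 \<le> ((1 + K) * norm (X ?n) + K * norm (Y ?n))\<^sup>2"
      using M_op_step_discrete[OF t] by (intro power_mono) (auto simp: Y_def)
    also have "\<dots> \<le> 2 * ((1 + K) * norm (X ?n))\<^sup>2 + 2 * (K * norm (Y ?n))\<^sup>2"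
      using sum_squares_bound[of "(1 + K) * norm (X ?n)" "K * norm (Y ?n)"]
      unfolding power2_sum by linarith
    finally show "(norm (M_op (\<lambda>s. X (nat \<lfloor>s / h\<rfloor>)) t))\<^sup>2 \<le> G ?n"
      by (simp add: G_def power_mult_distrib)
  qed
  also have "\<dots> = ennreal (h * (\<Sum>n<L. G n))"
  proof (rule nn_integral_half_line_step[OF h])
    fix n assume "L \<le> n"
    then have "Y n = 0" unfolding Y_def by (intro sum.neutral) (auto simp: X T_increment_def h less_imp_le)
    then show "G n = 0" using X(3)[OF \<open>L \<le> n\<close>] by (simp add: G_def)
  qed (simp add: G_def)
  also have "\<dots> \<le> ennreal (M_op_const * (h * (\<Sum>n<L. (norm (X n))\<^sup>2)))"
  proof (rule ennreal_leI)
    have "(\<Sum>n<L. (norm (Y n))\<^sup>2) \<le> multiplier_const\<^sup>2 * (\<Sum>n<L. (norm (X (Suc n)))\<^sup>2)"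
      using discrete_maximal_regularity[OF h, of L "\<lambda>n. X (Suc n)"] by (simp add: Y_def X)
    \<comment> \<open>The shift by one cell drops \<open>X 0\<close> and adds \<open>X L\<close>,
      both of which are 0.\<close>
    also have "(\<Sum>n<L. (norm (X (Suc n)))\<^sup>2) \<le> (\<Sum>n<L. (norm (X n))\<^sup>2)"
      using sum.lessThan_Suc_shift[of "\<lambda>n. (norm (X n))\<^sup>2" L] by (simp add: X)
    finally have "(\<Sum>n<L. (norm (Y n))\<^sup>2) \<le> multiplier_const\<^sup>2 * (\<Sum>n<L. (norm (X n))\<^sup>2)"
      by (simp add: mult_left_mono)
    then have "2 * K\<^sup>2 * (\<Sum>n<L. (norm (Y n))\<^sup>2) \<le> 2 * K\<^sup>2 * (multiplier_const\<^sup>2 * (\<Sum>n<L. (norm (X n))\<^sup>2))"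
      by (rule mult_left_mono) simp
    then have "(\<Sum>n<L. G n) \<le> M_op_const * (\<Sum>n<L. (norm (X n))\<^sup>2)"
      by (simp add: G_def M_op_const_def sum.distrib sum_distrib_left[symmetric] algebra_simps)
    then show "h * (\<Sum>n<L. G n) \<le> M_op_const * (h * (\<Sum>n<L. (norm (X n))\<^sup>2))"
      using h by (simp add: mult.left_commute)
  qed
  also have "\<dots> = ennreal M_op_const * ennreal (h * (\<Sum>n<L. (norm (X n))\<^sup>2))"
    by (rule ennreal_mult) (use h in \<open>auto simp: M_op_const_def sum_nonneg\<close>)
  also have "ennreal (h * (\<Sum>n<L. (norm (X n))\<^sup>2)) = (\<integral>\<^sup>+t. ennreal ((norm (X (nat \<lfloor>t / h\<rfloor>)))\<^sup>2) \<partial>half_line)"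
    by (rule nn_integral_half_line_step[OF h, symmetric]) (auto simp: X)
  finally show ?thesis .
qed

end

end

section \<open>The unweighted estimate\<close>

lemma negligible_imp_AE_half_line:
  assumes "negligible N"
  shows "AE t in half_line. t \<notin> N"
proof -
  have "AE t in lebesgue. t \<notin> N"
    using assms by (intro AE_not_in) (simp add: negligible_iff_null_sets)
  then have "AE t in lborel. t \<notin> N" by (simp add: AE_completion_iff)
  then show ?thesis unfolding AE_half_line by eventually_elim simp
qed

context semigroup_estimates
begin

text \<open>Continuity is carried along because it provides the measurability that Fatou's lemma
  needs, and later the strong measurability of the image.\<close>

definition M_op_bounded :: "(real \<Rightarrow> 'a) \<Rightarrow> bool" where
  "M_op_bounded f \<longleftrightarrow> continuous_on {0<..} (M_op f) \<and>
    (\<integral>\<^sup>+t. ennreal ((norm (M_op f t))\<^sup>2) \<partial>half_line) \<le>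
      ennreal M_op_const * (\<integral>\<^sup>+t. ennreal ((norm (f t))\<^sup>2) \<partial>half_line)"

text \<open>Dominated convergence gives \<open>A (F n t)\<close> tending to \<open>A (f t)\<close>
  in \<open>L1\<close>, hence uniform convergence of the images; continuity survives. The inequality
  passes to the limit by Fatou's lemma on the left and dominated convergence on the right.\<close>

lemma M_op_bounded_limit:
  fixes F :: "nat \<Rightarrow> real \<Rightarrow> 'a"
  assumes f: "f \<in> L2c_domain D A" and F: "\<And>n. F n \<in> L2c_domain D A" "\<And>n. M_op_bounded (F n)"
    and lim: "AE t in half_line. (\<lambda>n. F n t) \<longlonglongrightarrow> f t \<and> (\<lambda>n. A (F n t)) \<longlonglongrightarrow> A (f t)"
    and bound: "AE t in half_line. \<forall>n. (norm (F n t))\<^sup>2 + (norm (A (F n t)))\<^sup>2 \<le> w t"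
    and w: "w \<in> borel_measurable (completion half_line)" "\<And>t. 0 \<le> w t"
      "(\<integral>\<^sup>+t. ennreal (w t) \<partial>half_line) < \<infinity>"
    and supp: "AE t in half_line. t \<notin> {a..b} \<longrightarrow> (\<forall>n. F n t = 0)"
  shows "M_op_bounded f"
proof -
  note mf = L2c_domain_strongly_measurable[OF f]
  note mF = L2c_domain_strongly_measurable[OF F(1)]
  have bound_f: "AE t in half_line. (norm (f t))\<^sup>2 + (norm (A (f t)))\<^sup>2 \<le> w t"
    using lim bound
  proof eventually_elim
    case (elim t)
    then have "(\<lambda>n. (norm (F n t))\<^sup>2 + (norm (A (F n t)))\<^sup>2) \<longlonglongrightarrow> (norm (f t))\<^sup>2 + (norm (A (f t)))\<^sup>2"
      by (intro tendsto_intros) auto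
    then show ?case by (rule LIMSEQ_le_const2) (use elim in auto)
  qed
  let ?\<delta> = "\<lambda>n. \<integral>\<^sup>+t. ennreal (K * norm (A (F n t) - A (f t))) \<partial>half_line"
  have \<delta>: "?\<delta> \<longlonglongrightarrow> 0"
  proof (rule nn_integral_dominated_null)
    show "(\<lambda>t. K * norm (A (F n t) - A (f t))) \<in> borel_measurable (completion half_line)" for n
      by (intro borel_measurable_times borel_measurable_const strongly_measurable_norm
          strongly_measurable_diff mf mF)
    \<comment> \<open>On the support, \<open>u \<le> 1 + u^2\<close> and
      \<open>norm_diff_square_le\<close> give \<open>1 + 4 * w t\<close>; off the support both
      functions vanish.\<close>
    show W: "(\<lambda>t. K * indicat_real {a..b} t + 4 * K * w t) \<in> borel_measurable (completion half_line)"
      by (intro borel_measurable_add borel_measurable_times borel_measurable_const w indicator_Icc_measurable)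
    show "AE t in half_line. K * norm (A (F n t) - A (f t)) \<le> K * indicat_real {a..b} t + 4 * K * w t" for n
      using bound bound_f supp lim
    proof eventually_elim
      case (elim t)
      show ?case
      proof (cases "t \<in> {a..b}")
        case True
        have "norm (A (F n t) - A (f t)) \<le> 1 + (norm (A (F n t) - A (f t)))\<^sup>2"
          using sum_squares_bound[of "norm (A (F n t) - A (f t))" 1, unfolded one_power2 mult_1_right]
            norm_ge_zero[of "A (F n t) - A (f t)"] by linarith
        also have "\<dots> \<le> 1 + (2 * (norm (A (F n t)))\<^sup>2 + 2 * (norm (A (f t)))\<^sup>2)"
          by (intro add_left_mono norm_diff_square_le)
        also have "\<dots> \<le> 1 + 4 * w t"
          using elim(1)[rule_format, of n] elim(2) zero_le_power2[of "norm (F n t)"]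
            zero_le_power2[of "norm (f t)"] by linarith
        finally have "K * norm (A (F n t) - A (f t)) \<le> K * (1 + 4 * w t)"
          using K_ge_1 by (intro mult_left_mono) auto
        then show ?thesis using True by (simp add: algebra_simps)
      next
        case False
        then have 0: "F n t = 0" for n using elim by auto
        then have "f t = 0" using elim(4) by (simp add: LIMSEQ_const_iff)
        then show ?thesis using w(2)[of t] K_ge_1 False 0 by simp
      qed
    qed
    have "(\<integral>\<^sup>+t. ennreal (K * indicat_real {a..b} t + 4 * K * w t) \<partial>half_line) =
        (\<integral>\<^sup>+t. 1 * ennreal (K * indicat_real {a..b} t) + ennreal (4 * K) * ennreal (w t) \<partial>half_line)"
      using w(2) K_ge_1 by (intro nn_integral_cong) (simp add: ennreal_mult)
    also have "\<dots> = 1 * (\<integral>\<^sup>+t. ennreal (K * indicat_real {a..b} t) \<partial>half_line) +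
        ennreal (4 * K) * (\<integral>\<^sup>+t. ennreal (w t) \<partial>half_line)"
      by (intro nn_integral_completion_linear measurable_compose[OF _ measurable_ennreal]
          indicator_Icc_measurable w)
    also have "\<dots> < \<infinity>"
      using indicator_Icc_integral_finite[of K a b] w(3) by (simp add: ennreal_mult_less_top)
    finally show "(\<integral>\<^sup>+t. ennreal (K * indicat_real {a..b} t + 4 * K * w t) \<partial>half_line) < \<infinity>" .
    show "AE t in half_line. (\<lambda>n. K * norm (A (F n t) - A (f t))) \<longlonglongrightarrow> 0"
      using lim
    proof eventually_elim
      case (elim t)
      then have "(\<lambda>n. K * norm (A (F n t) - A (f t))) \<longlonglongrightarrow> K * norm (A (f t) - A (f t))"
        by (intro tendsto_intros) auto
      then show ?case by simp
    qed
  qed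
  have unif: "uniform_limit {0<..} (\<lambda>n. M_op (F n)) (M_op f) sequentially"
    unfolding uniform_limit_iff
  proof (intro allI impI)
    fix e :: real assume "0 < e"
    then have "\<forall>\<^sub>F n in sequentially. ?\<delta> n < ennreal e"
      by (intro order_tendstoD(2)[OF \<delta>]) simp
    then show "\<forall>\<^sub>F n in sequentially. \<forall>t\<in>{0<..}. dist (M_op (F n) t) (M_op f t) < e"
    proof eventually_elim
      case (elim n)
      show ?case
      proof
        fix t :: real assume "t \<in> {0<..}"
        then have "ennreal (norm (M_op (F n) t - M_op f t)) < ennreal e"
          by (intro le_less_trans[OF norm_M_op_diff_le[OF F(1) f] elim]) simp
        then show "dist (M_op (F n) t) (M_op f t) < e"
          using \<open>0 < e\<close> by (simp add: dist_norm ennreal_less_iff)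
      qed
    qed
  qed
  have cont: "continuous_on {0<..} (M_op f)"
    by (rule uniform_limit_theorem[OF _ unif]) (use F(2) in \<open>auto simp: M_op_bounded_def\<close>)
  have pt: "(\<lambda>n. ennreal ((norm (M_op (F n) t))\<^sup>2)) \<longlonglongrightarrow> ennreal ((norm (M_op f t))\<^sup>2)" if "0 < t" for t
    using tendsto_uniform_limitI[OF unif, of t] that by (intro tendsto_intros tendsto_ennrealI) auto
  have "(\<integral>\<^sup>+t. ennreal ((norm (M_op f t))\<^sup>2) \<partial>half_line) =
      (\<integral>\<^sup>+t. liminf (\<lambda>n. ennreal ((norm (M_op (F n) t))\<^sup>2)) \<partial>half_line)"
    by (intro nn_integral_cong lim_imp_Liminf[symmetric] pt) auto
  \<comment> \<open>Fatou's lemma; convergence of the images in \<open>L2\<close> is not yet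
    known.\<close>
  also have "\<dots> \<le> liminf (\<lambda>n. \<integral>\<^sup>+t. ennreal ((norm (M_op (F n) t))\<^sup>2) \<partial>half_line)"
  proof (rule nn_integral_liminf)
    fix n
    have "continuous_on {0<..} (\<lambda>t. (norm (M_op (F n) t))\<^sup>2)"
      using F(2)[of n] unfolding M_op_bounded_def by (intro continuous_intros) auto
    from measurable_compose[OF borel_measurable_half_line_continuous[OF this] measurable_ennreal]
    show "(\<lambda>t. ennreal ((norm (M_op (F n) t))\<^sup>2)) \<in> borel_measurable half_line" .
  qed
  also have "\<dots> \<le> liminf (\<lambda>n. ennreal M_op_const * (\<integral>\<^sup>+t. ennreal ((norm (F n t))\<^sup>2) \<partial>half_line))"
    by (intro Liminf_mono always_eventually allI) (use F(2) in \<open>auto simp: M_op_bounded_def\<close>)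
  also have "\<dots> = ennreal M_op_const * (\<integral>\<^sup>+t. ennreal ((norm (f t))\<^sup>2) \<partial>half_line)"
  proof (intro lim_imp_Liminf ennreal_tendsto_cmult)
    have "(\<lambda>n. \<integral>\<^sup>+t. ennreal ((norm (F n t))\<^sup>2) \<partial>completion half_line) \<longlonglongrightarrow>
        (\<integral>\<^sup>+t. ennreal ((norm (f t))\<^sup>2) \<partial>completion half_line)"
    proof (rule nn_integral_dominated_convergence[where w = "\<lambda>t. ennreal (w t)"])
      note [measurable] = mf(1)[THEN strongly_measurable_norm] mF(1)[THEN strongly_measurable_norm] w(1)
      show "(\<lambda>t. ennreal ((norm (F n t))\<^sup>2)) \<in> borel_measurable (completion half_line)" for n by measurable
      show "(\<lambda>t. ennreal ((norm (f t))\<^sup>2)) \<in> borel_measurable (completion half_line)" by measurable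
      show "(\<lambda>t. ennreal (w t)) \<in> borel_measurable (completion half_line)" by measurable
      show "AE t in completion half_line. ennreal ((norm (F n t))\<^sup>2) \<le> ennreal (w t)" for n
        unfolding AE_completion_iff using bound
      proof eventually_elim
        case (elim t)
        then show ?case using zero_le_power2[of "norm (A (F n t))"]
          by (intro ennreal_leI) (smt (verit))
      qed
      show "AE t in completion half_line. (\<lambda>n. ennreal ((norm (F n t))\<^sup>2)) \<longlonglongrightarrow> ennreal ((norm (f t))\<^sup>2)"
        unfolding AE_completion_iff using lim
        by eventually_elim (intro tendsto_intros tendsto_ennrealI, auto)
    qed (use w(3) in \<open>simp add: nn_integral_completion\<close>)
    then show "(\<lambda>n. \<integral>\<^sup>+t. ennreal ((norm (F n t))\<^sup>2) \<partial>half_line) \<longlonglongrightarrow>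
        (\<integral>\<^sup>+t. ennreal ((norm (f t))\<^sup>2) \<partial>half_line)" by (simp add: nn_integral_completion)
  qed simp_all
  finally show ?thesis using cont by (simp add: M_op_bounded_def)
qed

section \<open>From step functions to the whole initial domain\<close>

lemma A_combination: "P \<subseteq> D \<Longrightarrow> A (\<Sum>x\<in>P. d x *\<^sub>R x) = (\<Sum>x\<in>P. d x *\<^sub>R A x)"
  by (subst A_sum) (auto intro!: D_scaleR sum.cong A_scaleR)

definition graph_bound :: "'a set \<Rightarrow> real" where
  "graph_bound P = (\<Sum>x\<in>P. norm x)\<^sup>2 + (\<Sum>x\<in>P. norm (A x))\<^sup>2"

lemma graph_bound_nonneg: "0 \<le> graph_bound P"
  by (simp add: graph_bound_def)

lemma combination_le_graph_bound:
  assumes "P \<subseteq> D" "\<And>x. \<bar>d x\<bar> \<le> 1"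
  shows "(norm (\<Sum>x\<in>P. d x *\<^sub>R x))\<^sup>2 + (norm (A (\<Sum>x\<in>P. d x *\<^sub>R x)))\<^sup>2 \<le> graph_bound P"
proof -
  have "norm (\<Sum>x\<in>P. d x *\<^sub>R g x) \<le> (\<Sum>x\<in>P. norm (g x))" for g :: "'a \<Rightarrow> 'a"
    using assms(2) by (intro order_trans[OF norm_sum] sum_mono) (simp add: mult_left_le_one_le)
  then show ?thesis
    unfolding graph_bound_def A_combination[OF assms(1)] by (intro add_mono power_mono) auto
qed

text \<open>The coefficients are sampled at the left ends of the cells of a refining grid. The
  samples converge wherever the coefficients are continuous, that is, off a null set. The values
  stay in the span of the finite set \<open>P\<close>, which bounds the graph norm
  uniformly.\<close>

lemma M_op_bounded_continuous_coefficients: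
  fixes c :: "'a \<Rightarrow> real \<Rightarrow> real"
  assumes P: "finite P" "P \<subseteq> D" and ab: "0 < a"
    and c: "\<And>x t. \<bar>c x t\<bar> \<le> 1" "\<And>x t. t \<notin> {a..b} \<Longrightarrow> c x t = 0"
      "\<And>x t. x \<in> P \<Longrightarrow> t \<notin> {a, b} \<Longrightarrow> isCont (c x) t"
  shows "(\<lambda>t. \<Sum>x\<in>P. c x t *\<^sub>R x) \<in> L2c_domain D A \<and> M_op_bounded (\<lambda>t. \<Sum>x\<in>P. c x t *\<^sub>R x)"
proof -
  let ?f = "\<lambda>t. \<Sum>x\<in>P. c x t *\<^sub>R x"
  define h where "h = (\<lambda>n. 1 / real (Suc n))"
  define X where "X = (\<lambda>n m. ?f (real m * h n))"
  define L where "L = (\<lambda>n. Suc (nat \<lceil>b / h n\<rceil>))"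
  define F where "F = (\<lambda>n t. X n (nat \<lfloor>t / h n\<rfloor>))"
  have h: "0 < h n" "h n \<le> 1" for n by (auto simp: h_def)
  have fD: "?f t \<in> D" for t using P by (intro D_sum D_scaleR) auto
  have f0: "?f t = 0" if "t \<notin> {a..b}" for t using c(2)[OF that] by simp
  have X: "X n m \<in> D" "X n 0 = 0" for n m
    unfolding X_def by (rule fD) (rule f0, use ab in simp)
  have XL: "X n m = 0" if "L n \<le> m" for n m
  proof -
    have "b / h n < real m" using that unfolding L_def by linarith
    then have "b < real m * h n" using h(1)[of n] by (simp add: divide_less_eq)
    then show ?thesis unfolding X_def by (intro f0) auto
  qed
  have F_simple: "simple_function half_line (F n)" for n
    unfolding F_def by (rule simple_function_step[where L = "L n"]) (use h X XL in auto)
  have F_V: "F n \<in> L2c_domain D A" for n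
    unfolding F_def by (rule step_in_L2c_domain[where L = "L n"]) (use h X XL in auto)
  have F_bounded: "M_op_bounded (F n)" for n
    unfolding F_def M_op_bounded_def
    by (intro conjI continuous_M_op_step[where L = "L n"] M_op_step_bound[where L = "L n"])
      (use h X XL in auto)
  have fb: "(norm (?f t))\<^sup>2 + (norm (A (?f t)))\<^sup>2 \<le> graph_bound P" for t
    by (rule combination_le_graph_bound[OF P(2) c(1)])
  \<comment> \<open>A sample is taken up to \<open>h n \<le> 1\<close> to the left of
    \<open>t\<close>, so the sampled function may live slightly beyond \<open>b\<close>. It cannot
    be nonzero before \<open>a\<close>.\<close>
  let ?w = "\<lambda>t. graph_bound P * indicat_real {a..b + 1} t"
  have near: "real (nat \<lfloor>t / h n\<rfloor>) * h n \<le> t \<and> t \<le> real (nat \<lfloor>t / h n\<rfloor>) * h n + h n" if "0 < t" for t n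
    using nat_floor_divide_eq[of "h n" t "nat \<lfloor>t / h n\<rfloor>"] that h(1)[of n] by (simp add: algebra_simps)
  have F0: "F n t = 0" if "t \<notin> {a..b + 1}" "0 < t" for n t
    unfolding F_def X_def using near[OF that(2), of n] that(1) h(2)[of n] by (intro f0) auto
  have bound: "(norm (F n t))\<^sup>2 + (norm (A (F n t)))\<^sup>2 \<le> ?w t" if "0 < t" for n t
  proof (cases "t \<in> {a..b + 1}")
    case True
    then show ?thesis using fb by (simp add: F_def X_def)
  next
    case False
    then show ?thesis using F0[OF False that] graph_bound_nonneg[of P] by simp
  qed
  have pos: "AE t in half_line. 0 < t" by (rule AE_half_lineI)
  have ne: "AE t in half_line. t \<notin> {a, b}" by (rule negligible_imp_AE_half_line) simp
  have lim: "AE t in half_line. (\<lambda>n. F n t) \<longlonglongrightarrow> ?f t \<and> (\<lambda>n. A (F n t)) \<longlonglongrightarrow> A (?f t)"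
    using pos ne
  proof eventually_elim
    case (elim t)
    have "(\<lambda>n. real (nat \<lfloor>t / h n\<rfloor>) * h n) \<longlonglongrightarrow> t"
    proof (rule tendsto_sandwich[OF _ _ _ tendsto_const])
      show "(\<lambda>n. t - h n) \<longlonglongrightarrow> t"
        using tendsto_diff[OF tendsto_const LIMSEQ_inverse_real_of_nat, of t]
        by (simp add: h_def inverse_eq_divide)
    qed (use near[of t] elim in \<open>auto intro!: always_eventually simp: algebra_simps\<close>)
    then have "(\<lambda>n. c x (real (nat \<lfloor>t / h n\<rfloor>) * h n)) \<longlonglongrightarrow> c x t" if "x \<in> P" for x
      using c(3)[OF that, of t] elim by (intro isCont_tendsto_compose[of t "c x"]) auto
    then show ?case
      unfolding F_def X_def A_combination[OF P(2)] by (intro conjI tendsto_sum tendsto_scaleR tendsto_const)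
  qed
  have fin: "(\<integral>\<^sup>+t. ennreal (?w t) \<partial>half_line) < \<infinity>" by (rule indicator_Icc_integral_finite)
  have V: "?f \<in> L2c_domain D A"
  proof (rule L2c_domainI[where s = F and w = ?w and a = a and b = b])
    show "AE t in half_line. (norm (?f t))\<^sup>2 + (norm (A (?f t)))\<^sup>2 \<le> ?w t"
    proof (rule AE_half_lineI)
      fix t show "(norm (?f t))\<^sup>2 + (norm (A (?f t)))\<^sup>2 \<le> ?w t"
        using fb[of t] f0[of t] graph_bound_nonneg[of P] by (cases "t \<in> {a..b}") auto
    qed
    show "AE t in half_line. t \<notin> {a..b} \<longrightarrow> ?f t = 0" using f0 by (intro AE_half_lineI) auto
  qed (use fD F_simple X lim fin ab in \<open>auto simp: F_def\<close>)
  moreover have "M_op_bounded ?f"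
  proof (rule M_op_bounded_limit[OF V _ _ lim])
    show "F n \<in> L2c_domain D A" "M_op_bounded (F n)" for n
      by (rule F_V F_bounded)+
    show "AE t in half_line. \<forall>n. (norm (F n t))\<^sup>2 + (norm (A (F n t)))\<^sup>2 \<le> ?w t"
      using bound by (intro AE_half_lineI) auto
    show "AE t in half_line. t \<notin> {a..b + 1} \<longrightarrow> (\<forall>n. F n t = 0)"
      using F0 by (intro AE_half_lineI) auto
    show "?w \<in> borel_measurable (completion half_line)" by (rule indicator_Icc_measurable)
  qed (use graph_bound_nonneg[of P] fin in auto)
  ultimately show ?thesis by blast
qed

text \<open>The indicator of a Borel set is an almost everywhere limit of continuous functions, to
  which the preceding lemma applies after truncation.\<close>

lemma M_op_bounded_simple:
  fixes E :: "'a \<Rightarrow> real set"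
  assumes P: "finite P" "P \<subseteq> D" and ab: "0 < a"
    and E: "\<And>x. E x \<in> sets borel" "\<And>x. E x \<subseteq> {a..b}"
  shows "(\<lambda>t. \<Sum>x\<in>P. indicat_real (E x) t *\<^sub>R x) \<in> L2c_domain D A \<and>
    M_op_bounded (\<lambda>t. \<Sum>x\<in>P. indicat_real (E x) t *\<^sub>R x)"
proof -
  let ?f = "\<lambda>t. \<Sum>x\<in>P. indicat_real (E x) t *\<^sub>R x"
  have "\<exists>N g. negligible N \<and> (\<forall>n. continuous_on UNIV (g n)) \<and>
      (\<forall>t. t \<notin> N \<longrightarrow> (\<lambda>n. g n t) \<longlonglongrightarrow> indicat_real (E x) t)" for x
  proof -
    have "indicat_real (E x) \<in> borel_measurable lebesgue"
      using E(1)[of x] by (intro borel_measurable_indicator) auto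
    then have "indicat_real (E x) measurable_on UNIV"
      by (intro lebesgue_measurable_imp_measurable_on) auto
    then show ?thesis unfolding measurable_on_def by auto
  qed
  then obtain N g where Ng: "\<And>x. negligible (N x)" "\<And>x n. continuous_on UNIV (g x n)"
    "\<And>x t. t \<notin> N x \<Longrightarrow> (\<lambda>n. g x n t) \<longlonglongrightarrow> indicat_real (E x) t"
    by metis
  \<comment> \<open>Clamping to the unit interval gives the uniform bound, and cutting to
    \<open>{a..b}\<close> the support. The cut creates jumps at \<open>a\<close> and
    \<open>b\<close> alone, which is why these two points are exempt in the preceding lemma.\<close>
  define c where "c = (\<lambda>n x t. indicat_real {a..b} t * max 0 (min 1 (g x n t)))"
  define F where "F = (\<lambda>n t. \<Sum>x\<in>P. c n x t *\<^sub>R x)"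
  have c1: "\<bar>c n x t\<bar> \<le> 1" for n x t by (auto simp: c_def indicator_def)
  have c0: "c n x t = 0" if "t \<notin> {a..b}" for n x t using that by (simp add: c_def)
  have F: "F n \<in> L2c_domain D A \<and> M_op_bounded (F n)" for n
    unfolding F_def
  proof (rule M_op_bounded_continuous_coefficients[OF P ab c1 c0])
    fix x t assume "t \<notin> {a, b}"
    have "isCont (indicat_real {a..b}) t"
      using \<open>t \<notin> {a, b}\<close> by (simp add: isCont_indicator frontier_def)
    moreover have "isCont (g x n) t" using Ng(2) by (simp add: continuous_on_eq_continuous_at)
    ultimately show "isCont (c n x) t" unfolding c_def by (intro continuous_intros)
  qed
  have fD: "?f t \<in> D" for t using P by (intro D_sum D_scaleR) auto
  let ?w = "\<lambda>t. graph_bound P * indicat_real {a..b} t"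
  have F0: "F n t = 0" if "t \<notin> {a..b}" for n t using c0[OF that] by (simp add: F_def)
  have f0: "?f t = 0" if "t \<notin> {a..b}" for t
  proof -
    have "t \<notin> E x" for x using that E(2) by blast
    then show ?thesis by simp
  qed
  have Fw: "(norm (F n t))\<^sup>2 + (norm (A (F n t)))\<^sup>2 \<le> ?w t" for n t
    using combination_le_graph_bound[OF P(2), of "\<lambda>x. c n x t", OF c1] F0[of t n] graph_bound_nonneg[of P] by (cases "t \<in> {a..b}") (auto simp: F_def)
  have fw: "(norm (?f t))\<^sup>2 + (norm (A (?f t)))\<^sup>2 \<le> ?w t" for t
    using combination_le_graph_bound[OF P(2), of "\<lambda>x. indicat_real (E x) t"] f0[of t] graph_bound_nonneg[of P] by (cases "t \<in> {a..b}") auto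
  have fin: "(\<integral>\<^sup>+t. ennreal (?w t) \<partial>half_line) < \<infinity>" by (rule indicator_Icc_integral_finite)
  have simple: "simple_function half_line ?f"
  proof (rule simple_function_sum)
    fix x
    have "E x \<in> sets half_line" using E[of x] ab by (intro sets_half_line) auto
    from simple_function_indicator[OF this]
    show "simple_function half_line (\<lambda>t. indicat_real (E x) t *\<^sub>R x)"
      by (rule simple_function_compose1[where g = "\<lambda>r. r *\<^sub>R x"])
  qed
  have V: "?f \<in> L2c_domain D A"
    by (rule L2c_domainI[where s = "\<lambda>_. ?f" and w = ?w and a = a and b = b])
      (use fD simple fw f0 fin ab in \<open>auto intro!: AE_half_lineI\<close>)
  have "AE t in half_line. \<forall>x\<in>P. t \<notin> N x"
    using P(1) Ng(1) by (intro AE_finite_allI negligible_imp_AE_half_line)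
  then have lim: "AE t in half_line. (\<lambda>n. F n t) \<longlonglongrightarrow> ?f t \<and> (\<lambda>n. A (F n t)) \<longlonglongrightarrow> A (?f t)"
  proof eventually_elim
    case (elim t)
    have "(\<lambda>n. c n x t) \<longlonglongrightarrow> indicat_real (E x) t" if "x \<in> P" for x
    proof -
      have "(\<lambda>n. c n x t) \<longlonglongrightarrow> indicat_real {a..b} t * max 0 (min 1 (indicat_real (E x) t))"
        unfolding c_def using elim that by (intro tendsto_intros Ng(3)) auto
      also have "indicat_real {a..b} t * max 0 (min 1 (indicat_real (E x) t)) = indicat_real (E x) t"
        using E(2)[of x] by (auto simp: indicator_def)
      finally show ?thesis .
    qed
    then show ?case
      unfolding F_def A_combination[OF P(2)] by (intro conjI tendsto_sum tendsto_scaleR tendsto_const)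
  qed
  have "M_op_bounded ?f"
  proof (rule M_op_bounded_limit[OF V _ _ lim, where w = ?w and a = a and b = b])
    show "?w \<in> borel_measurable (completion half_line)" by (rule indicator_Icc_measurable)
  qed (use F Fw F0 graph_bound_nonneg[of P] fin in \<open>auto intro!: AE_half_lineI\<close>)
  with V show ?thesis by blast
qed

text \<open>A general element is approximated by simple functions with values in \<open>D\<close>,
  dominated in the graph norm; these are finite combinations of indicators.\<close>

theorem L2c_domain_M_op_bounded:
  assumes f: "f \<in> L2c_domain D A"
  shows "M_op_bounded f"
proof -
  obtain a b where ab: "0 < a" "a \<le> b" "AE t in half_line. t \<notin> {a..b} \<longrightarrow> f t = 0"
    by (rule L2c_domainE[OF f])
  obtain s where s: "\<And>i. simple_function half_line (s i)" "\<And>i t. 0 < t \<Longrightarrow> s i t \<in> D"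
    "AE t in half_line. (\<lambda>i. s i t) \<longlonglongrightarrow> f t \<and> (\<lambda>i. A (s i t)) \<longlonglongrightarrow> A (f t)"
    using L2c_domain_simple[OF f] by blast
  \<comment> \<open>The norm of the pair is the graph norm, so a single cut dominates
    \<open>s i t\<close> and \<open>A (s i t)\<close> together. The factor 2 becomes 4 in
    \<open>?w\<close>.\<close>
  have "AE t in half_line. (\<lambda>i. (s i t, A (s i t))) \<longlonglongrightarrow> (f t, A (f t))"
    using s(3) by eventually_elim (auto intro: tendsto_Pair)
  moreover have "simple_function half_line (\<lambda>t. (s i t, A (s i t)))" for i
    using simple_function_compose1[OF s(1)[of i], of "\<lambda>x. (x, A x)"] .
  ultimately obtain B where B: "\<And>i::nat. B i \<in> sets half_line"
    "AE t in half_line. (\<lambda>i. indicat_real (B i) t *\<^sub>R (s i t, A (s i t))) \<longlonglongrightarrow> (f t, A (f t))"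
    "AE t in half_line. \<forall>i. norm (indicat_real (B i) t *\<^sub>R (s i t, A (s i t))) \<le> 2 * norm (f t, A (f t))"
    using dominated_simple_functions[of half_line "\<lambda>i t. (s i t, A (s i t))" "\<lambda>t. (f t, A (f t))"] by auto
  define P where "P = (\<lambda>i. s i ` {0<..})"
  \<comment> \<open>Level sets of the cut function inside the support; they write it as a
    combination of fixed vectors with indicator coefficients.\<close>
  define E where "E = (\<lambda>i x. (s i -` {x} \<inter> {0<..}) \<inter> B i \<inter> {a..b})"
  define F where "F = (\<lambda>i t. \<Sum>x\<in>P i. indicat_real (E i x) t *\<^sub>R x)"
  have P: "finite (P i)" "P i \<subseteq> D" for i
    using s(1)[of i] s(2) by (auto simp: P_def simple_function_def)
  have E: "E i x \<in> sets borel" "E i x \<subseteq> {a..b}" for i x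
  proof -
    have "s i -` {x} \<inter> space half_line \<in> sets half_line"
      by (rule simple_functionD(2)[OF s(1)])
    then have "s i -` {x} \<inter> {0<..} \<in> sets borel" by (simp add: sets_half_line_imp_borel)
    from sets.Int[OF this sets_half_line_imp_borel[OF B(1)[of i]]]
    show "E i x \<in> sets borel" unfolding E_def by (rule sets.Int) simp
  qed (auto simp: E_def)
  have F: "F i \<in> L2c_domain D A \<and> M_op_bounded (F i)" for i
    unfolding F_def by (rule M_op_bounded_simple[OF P ab(1) E])
  have F_eq: "F i t = indicat_real (B i \<inter> {a..b}) t *\<^sub>R s i t" if "0 < t" for i t
  proof -
    have "F i t = (\<Sum>x\<in>P i. if x = s i t then indicat_real (B i \<inter> {a..b}) t *\<^sub>R x else 0)"
      unfolding F_def using that by (intro sum.cong) (auto simp: E_def indicator_def)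
    also have "\<dots> = indicat_real (B i \<inter> {a..b}) t *\<^sub>R s i t"
      using P(1)[of i] that by (simp add: P_def)
    finally show ?thesis .
  qed
  have A_F: "A (F i t) = indicat_real (B i \<inter> {a..b}) t *\<^sub>R A (s i t)" if "0 < t" for i t
    unfolding F_eq[OF that] by (rule A_scaleR[OF s(2)[OF that]])
  have pos: "AE t in half_line. 0 < t" by (rule AE_half_lineI)
  let ?w = "\<lambda>t. 4 * ((norm (f t))\<^sup>2 + (norm (A (f t)))\<^sup>2)"
  show ?thesis
  proof (rule M_op_bounded_limit[OF f, where F = F and w = ?w and a = a and b = b])
    show "AE t in half_line. (\<lambda>n. F n t) \<longlonglongrightarrow> f t \<and> (\<lambda>n. A (F n t)) \<longlonglongrightarrow> A (f t)"
      using B(2) ab(3) pos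
    proof eventually_elim
      case (elim t)
      show ?case
      proof (cases "t \<in> {a..b}")
        case True
        then have eq: "indicat_real (B n \<inter> {a..b}) t = indicat_real (B n) t" for n
          by (auto simp: indicator_def)
        then have "(\<lambda>n. F n t) \<longlonglongrightarrow> f t"
          using tendsto_fst[OF elim(1)] eq by (simp add: F_eq[OF elim(3)])
        moreover have "(\<lambda>n. A (F n t)) \<longlonglongrightarrow> A (f t)"
          using tendsto_snd[OF elim(1)] eq by (simp add: A_F[OF elim(3)])
        ultimately show ?thesis ..
      next
        case False
        then show ?thesis using elim by (simp add: F_eq A_F)
      qed
    qed
    show "AE t in half_line. \<forall>n. (norm (F n t))\<^sup>2 + (norm (A (F n t)))\<^sup>2 \<le> ?w t"
      using B(3) pos
    proof eventually_elim
      case (elim t)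
      show ?case
      proof
        fix n
        have "(norm (F n t))\<^sup>2 + (norm (A (F n t)))\<^sup>2 \<le> (norm (indicat_real (B n) t *\<^sub>R (s n t, A (s n t))))\<^sup>2"
          using elim(2) by (auto simp: F_eq A_F norm_Pair indicator_def)
        also have "\<dots> \<le> (2 * norm (f t, A (f t)))\<^sup>2"
          using elim(1) by (intro power_mono) auto
        also have "\<dots> = ?w t" by (simp add: norm_Pair power_mult_distrib)
        finally show "(norm (F n t))\<^sup>2 + (norm (A (F n t)))\<^sup>2 \<le> ?w t" .
      qed
    qed
    note m [measurable] = L2c_domain_strongly_measurable[OF f, THEN strongly_measurable_norm]
    show "?w \<in> borel_measurable (completion half_line)" by measurable
    show "(\<integral>\<^sup>+t. ennreal (?w t) \<partial>half_line) < \<infinity>" by (rule L2c_domain_scaled_integral[OF f]) simp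
    show "AE t in half_line. t \<notin> {a..b} \<longrightarrow> (\<forall>n. F n t = 0)"
      by (rule AE_half_lineI) (simp add: F_eq)
  qed (use F in auto)
qed

end

section \<open>The weighted estimate\<close>

text \<open>A Schur test with power weights: Cauchy-Schwarz in \<open>s\<close>, then Tonelli.
  Positivity of \<kappa> makes both elementary integrals converge, one at infinity and one at 0,
  each with value a power divided by \<kappa>; this gives \<open>1 / \<kappa>^2\<close>.\<close>

lemma Hardy_inequality:
  fixes q :: "real \<Rightarrow> ennreal" and \<gamma> \<kappa> :: real
  assumes q [measurable]: "q \<in> borel_measurable borel" and \<gamma>: "\<gamma> < 1 / 2" and \<kappa>: "\<kappa> = 1 / 2 - \<gamma>"
  shows "(\<integral>\<^sup>+t. (if 0 < t then (ennreal (t powr - \<gamma>) *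
      (\<integral>\<^sup>+s. (if t < s then ennreal (s powr (\<gamma> - 1)) * q s else 0) \<partial>lborel))\<^sup>2 else 0) \<partial>lborel)
    \<le> ennreal (1 / \<kappa>\<^sup>2) * (\<integral>\<^sup>+s. (if 0 < s then (q s)\<^sup>2 else 0) \<partial>lborel)"
proof -
  have \<kappa>0: "0 < \<kappa>" using \<gamma> \<kappa> by simp
  \<comment> \<open>Chosen so that the powers of \<open>t\<close> left after Cauchy-Schwarz,
    \<open>- 2 * \<gamma> - \<kappa>\<close>, combine to \<open>- p\<close>; the last integral then
    cancels \<open>s powr (p - 1)\<close>.\<close>
  define p where "p = 1 - \<kappa>"
  let ?Q = "\<lambda>t. \<integral>\<^sup>+s. (if t < s then ennreal (s powr (p - 1)) * (q s)\<^sup>2 else 0) \<partial>lborel"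
  have tail: "(\<integral>\<^sup>+s. (if t < s then ennreal (s powr (- 1 - \<kappa>)) else 0) \<partial>lborel) = ennreal (t powr - \<kappa> / \<kappa>)"
    if t: "0 < t" for t
  proof -
    have "((\<lambda>s. s powr (- 1 - \<kappa>)) has_integral - (t powr (- 1 - \<kappa> + 1)) / (- 1 - \<kappa> + 1)) {t..}"
      using \<kappa>0 t by (intro has_integral_powr_to_inf) auto
    from nn_integral_has_integral_lebesgue'[OF _ this]
    have "(\<integral>\<^sup>+s. ennreal (s powr (- 1 - \<kappa>)) * indicator {t..} s \<partial>lborel) = ennreal (t powr - \<kappa> / \<kappa>)"
      by simp
    moreover have "(\<integral>\<^sup>+s. (if t < s then ennreal (s powr (- 1 - \<kappa>)) else 0) \<partial>lborel) =
        (\<integral>\<^sup>+s. ennreal (s powr (- 1 - \<kappa>)) * indicator {t..} s \<partial>lborel)"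
      using AE_lborel_singleton[of t] by (intro nn_integral_cong_AE) (auto simp: indicator_def)
    ultimately show ?thesis by simp
  qed
  have head: "(\<integral>\<^sup>+t. (if 0 < t \<and> t < s then ennreal (t powr - p) else 0) \<partial>lborel) = ennreal (s powr \<kappa> / \<kappa>)"
    if s: "0 < s" for s
  proof -
    have "((\<lambda>t. t powr - p) has_integral (s powr (- p + 1) / (- p + 1))) {0..s}"
      using \<kappa>0 s by (intro has_integral_powr_from_0) (auto simp: p_def)
    from nn_integral_has_integral_lebesgue'[OF _ this]
    have "(\<integral>\<^sup>+t. ennreal (t powr - p) * indicator {0..s} t \<partial>lborel) = ennreal (s powr \<kappa> / \<kappa>)"
      by (simp add: p_def)
    moreover have "(\<integral>\<^sup>+t. (if 0 < t \<and> t < s then ennreal (t powr - p) else 0) \<partial>lborel) =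
        (\<integral>\<^sup>+t. ennreal (t powr - p) * indicator {0..s} t \<partial>lborel)"
      using AE_lborel_singleton[of 0] AE_lborel_singleton[of s]
      by (intro nn_integral_cong_AE) (auto simp: indicator_def)
    ultimately show ?thesis by simp
  qed
  have pt: "(ennreal (t powr - \<gamma>) * (\<integral>\<^sup>+s. (if t < s then ennreal (s powr (\<gamma> - 1)) * q s else 0) \<partial>lborel))\<^sup>2
      \<le> ennreal (t powr - p / \<kappa>) * ?Q t" if t: "0 < t" for t
  proof -
    define f where "f = (\<lambda>s. if t < s then ennreal (s powr ((- 1 - \<kappa>) / 2)) else 0)"
    define g where "g = (\<lambda>s. if t < s then ennreal (s powr ((p - 1) / 2)) * q s else 0)"
    have fg: "(if t < s then ennreal (s powr (\<gamma> - 1)) * q s else 0) = f s * g s" for s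
    proof (cases "t < s")
      case True
      \<comment> \<open>The kernel is split into a factor whose square is integrable at infinity and
        a remainder kept with \<open>q\<close>.\<close>
      have "(- 1 - \<kappa>) / 2 + (p - 1) / 2 = \<gamma> - 1" by (simp add: p_def \<kappa> field_simps)
      then have "s powr (\<gamma> - 1) = s powr ((- 1 - \<kappa>) / 2) * s powr ((p - 1) / 2)"
        using powr_add[of s "(- 1 - \<kappa>) / 2" "(p - 1) / 2"] by simp
      then show ?thesis using True by (simp add: f_def g_def ennreal_mult mult.assoc)
    qed (simp add: f_def)
    have sq: "(s powr (r / 2))\<^sup>2 = s powr r" for s r :: real
      by (simp add: power2_eq_square flip: powr_add)
    have f2: "(f s)\<^sup>2 = (if t < s then ennreal (s powr (- 1 - \<kappa>)) else 0)" for s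
      by (simp add: f_def ennreal_power sq)
    have g2: "(g s)\<^sup>2 = (if t < s then ennreal (s powr (p - 1)) * (q s)\<^sup>2 else 0)" for s
      by (simp add: g_def ennreal_power sq power_mult_distrib)
    have "(\<integral>\<^sup>+s. f s * g s \<partial>lborel)\<^sup>2 \<le> (\<integral>\<^sup>+s. (f s)\<^sup>2 \<partial>lborel) * (\<integral>\<^sup>+s. (g s)\<^sup>2 \<partial>lborel)"
      by (rule Cauchy_Schwarz_nn_integral) (simp_all add: f_def g_def)
    also have "\<dots> = ennreal (t powr - \<kappa> / \<kappa>) * ?Q t"
      unfolding f2 g2 tail[OF t] ..
    finally have "(ennreal (t powr - \<gamma>))\<^sup>2 * (\<integral>\<^sup>+s. f s * g s \<partial>lborel)\<^sup>2 \<le>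
        (ennreal (t powr - \<gamma>))\<^sup>2 * (ennreal (t powr - \<kappa> / \<kappa>) * ?Q t)"
      by (rule mult_left_mono) simp
    moreover have "(ennreal (t powr - \<gamma>))\<^sup>2 * ennreal (t powr - \<kappa> / \<kappa>) = ennreal (t powr - p / \<kappa>)"
    proof -
      have "(t powr - \<gamma>)\<^sup>2 * (t powr - \<kappa> / \<kappa>) = t powr (- \<gamma> + - \<gamma> + - \<kappa>) / \<kappa>"
        unfolding powr_add by (simp add: power2_eq_square)
      also have "- \<gamma> + - \<gamma> + - \<kappa> = - p" by (simp add: p_def \<kappa>)
      finally show ?thesis using \<kappa>0 by (simp add: ennreal_power flip: ennreal_mult)
    qed
    ultimately show ?thesis by (simp add: fg power_mult_distrib mult.assoc[symmetric])
  qed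
  have "(\<integral>\<^sup>+t. (if 0 < t then (ennreal (t powr - \<gamma>) *
      (\<integral>\<^sup>+s. (if t < s then ennreal (s powr (\<gamma> - 1)) * q s else 0) \<partial>lborel))\<^sup>2 else 0) \<partial>lborel) \<le>
      (\<integral>\<^sup>+t. (\<integral>\<^sup>+s. (if 0 < t \<and> t < s then ennreal (t powr - p / \<kappa>) * (ennreal (s powr (p - 1)) * (q s)\<^sup>2) else 0) \<partial>lborel) \<partial>lborel)"
  proof (rule nn_integral_mono)
    fix t :: real
    show "(if 0 < t then (ennreal (t powr - \<gamma>) *
        (\<integral>\<^sup>+s. (if t < s then ennreal (s powr (\<gamma> - 1)) * q s else 0) \<partial>lborel))\<^sup>2 else 0) \<le>
        (\<integral>\<^sup>+s. (if 0 < t \<and> t < s then ennreal (t powr - p / \<kappa>) * (ennreal (s powr (p - 1)) * (q s)\<^sup>2) else 0) \<partial>lborel)"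
    proof (cases "0 < t")
      case True
      have "ennreal (t powr - p / \<kappa>) * ?Q t = (\<integral>\<^sup>+s. ennreal (t powr - p / \<kappa>) *
          (if t < s then ennreal (s powr (p - 1)) * (q s)\<^sup>2 else 0) \<partial>lborel)"
        by (rule nn_integral_cmult[symmetric]) measurable
      also have "\<dots> = (\<integral>\<^sup>+s. (if 0 < t \<and> t < s then ennreal (t powr - p / \<kappa>) * (ennreal (s powr (p - 1)) * (q s)\<^sup>2) else 0) \<partial>lborel)"
        using True by (intro nn_integral_cong) auto
      finally show ?thesis using pt[OF True] True by simp
    qed simp
  qed
  also have "\<dots> = (\<integral>\<^sup>+s. (\<integral>\<^sup>+t. (if 0 < t \<and> t < s then ennreal (t powr - p / \<kappa>) * (ennreal (s powr (p - 1)) * (q s)\<^sup>2) else 0) \<partial>lborel) \<partial>lborel)"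
    by (rule lborel_pair.Fubini'[symmetric]) measurable
  also have "\<dots> = (\<integral>\<^sup>+s. ennreal (1 / \<kappa>\<^sup>2) * (if 0 < s then (q s)\<^sup>2 else 0) \<partial>lborel)"
  proof (rule nn_integral_cong)
    fix s :: real
    show "(\<integral>\<^sup>+t. (if 0 < t \<and> t < s then ennreal (t powr - p / \<kappa>) * (ennreal (s powr (p - 1)) * (q s)\<^sup>2) else 0) \<partial>lborel) =
        ennreal (1 / \<kappa>\<^sup>2) * (if 0 < s then (q s)\<^sup>2 else 0)"
    proof (cases "0 < s")
      case True
      have "(\<integral>\<^sup>+t. (if 0 < t \<and> t < s then ennreal (t powr - p / \<kappa>) * (ennreal (s powr (p - 1)) * (q s)\<^sup>2) else 0) \<partial>lborel) =
          (\<integral>\<^sup>+t. (if 0 < t \<and> t < s then ennreal (t powr - p) else 0) * (ennreal (1 / \<kappa>) * (ennreal (s powr (p - 1)) * (q s)\<^sup>2)) \<partial>lborel)"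
        using \<kappa>0 by (intro nn_integral_cong)
          (auto simp: mult.assoc[symmetric] simp flip: ennreal_mult)
      also have "\<dots> = ennreal (s powr \<kappa> / \<kappa>) * (ennreal (1 / \<kappa>) * (ennreal (s powr (p - 1)) * (q s)\<^sup>2))"
        by (subst nn_integral_multc) (simp_all add: head[OF True])
      also have "\<dots> = ennreal (s powr \<kappa> / \<kappa> * (1 / \<kappa>) * s powr (p - 1)) * (q s)\<^sup>2"
        using \<kappa>0 by (simp add: mult.assoc[symmetric] flip: ennreal_mult)
      also have "s powr \<kappa> / \<kappa> * (1 / \<kappa>) * s powr (p - 1) = (s powr \<kappa> * s powr (p - 1)) / \<kappa>\<^sup>2"
        by (simp add: power2_eq_square)
      also have "s powr \<kappa> * s powr (p - 1) = 1"
        using True by (simp add: p_def flip: powr_add)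
      finally show ?thesis using True by simp
    next
      case False
      then show ?thesis by (subst nn_integral_cong[where v = "\<lambda>_. 0"]) auto
    qed
  qed
  also have "\<dots> = ennreal (1 / \<kappa>\<^sup>2) * (\<integral>\<^sup>+s. (if 0 < s then (q s)\<^sup>2 else 0) \<partial>lborel)"
    by (rule nn_integral_cmult) measurable
  finally show ?thesis .
qed

section \<open>The commutator with multiplication by a power\<close>

lemma one_minus_powr_le:
  fixes x p :: real
  assumes "0 < x" "x \<le> 1" "p \<le> real n"
  shows "1 - x powr p \<le> real n * (1 - x)"
proof -
  \<comment> \<open>Bernoulli's inequality for an integer exponent at least \<open>p\<close>;
    enlarging the exponent decreases the power, because \<open>x \<le> 1\<close>.\<close>
  have "1 + real n * (x - 1) \<le> (1 + (x - 1)) ^ n"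
    using assms by (intro Bernoulli_inequality) auto
  also have "\<dots> = x powr real n" using assms by (simp add: powr_realpow)
  also have "\<dots> \<le> x powr p" using assms by (intro powr_mono') auto
  finally show ?thesis by (simp add: algebra_simps)
qed

text \<open>With \<open>a = \<beta> / 2\<close> this is where \<beta> > -1 enters. For
  \<open>a \<ge> 0\<close> one takes \<gamma> = 0; for \<open>a < 0\<close> factoring out
  \<open>x powr a\<close> leads to \<gamma> = -a. The factor \<open>1 - x\<close> is what will
  cancel the kernel singularity.\<close>

lemma powr_minus_one_bound:
  fixes a :: real
  assumes "- 1 / 2 < a"
  obtains \<gamma> c where "\<gamma> < 1 / 2" "0 \<le> c"
    "\<And>x. 0 < x \<Longrightarrow> x < 1 \<Longrightarrow> \<bar>x powr a - 1\<bar> \<le> c * (1 - x) * x powr - \<gamma>"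
proof (cases "0 \<le> a")
  case True
  obtain n :: nat where n: "a \<le> real n" using real_arch_simple by blast
  have "\<bar>x powr a - 1\<bar> \<le> real n * (1 - x) * x powr - 0" if "0 < x" "x < 1" for x
  proof -
    have "x powr a \<le> 1" using that True by (simp add: powr_le1)
    then show ?thesis using one_minus_powr_le[of x a n] that n by simp
  qed
  then show ?thesis by (intro that[of 0 "real n"]) auto
next
  case False
  obtain n :: nat where n: "- a \<le> real n" using real_arch_simple by blast
  have "\<bar>x powr a - 1\<bar> \<le> real n * (1 - x) * x powr - (- a)" if x: "0 < x" "x < 1" for x
  proof -
    have "x powr - a \<le> 1" using x False by (simp add: powr_le1)
    moreover have "x powr a - 1 = x powr a * (1 - x powr - a)"
      using x by (simp add: right_diff_distrib flip: powr_add)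
    ultimately have "\<bar>x powr a - 1\<bar> = x powr a * (1 - x powr - a)"
      by (simp add: abs_mult)
    also have "\<dots> \<le> x powr a * (real n * (1 - x))"
      using one_minus_powr_le[of x "- a" n] x n by (intro mult_left_mono) auto
    finally show ?thesis by (simp add: mult_ac)
  qed
  then show ?thesis using assms False by (intro that[of "- a" "real n"]) auto
qed

text \<open>The use of Tonelli's theorem in \<open>Hardy_inequality\<close> asks for a Borel
  function, while the norm of a strongly measurable function is measurable for the completion
  only.\<close>

lemma strongly_measurable_norm_borel_version:
  assumes "strongly_measurable half_line g"
  obtains q :: "real \<Rightarrow> ennreal" where "q \<in> borel_measurable borel"
    "AE t in half_line. q t = ennreal (norm (g t))" "\<And>t. t \<le> 0 \<Longrightarrow> q t = 0"
proof -
  have "(\<lambda>t. ennreal (norm (g t))) \<in> borel_measurable (completion half_line)"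
    by (rule measurable_compose[OF strongly_measurable_norm[OF assms] measurable_ennreal])
  from completion_ex_borel_measurable[OF this]
  obtain q' where q': "q' \<in> borel_measurable half_line" "AE t in half_line. ennreal (norm (g t)) = q' t"
    by blast
  define q where "q = (\<lambda>t. q' t * indicator {0<..} t)"
  have "q \<in> borel_measurable lborel"
    using q'(1) unfolding q_def half_line_def by (subst (asm) borel_measurable_restrict_space_iff_ennreal) auto
  then have "q \<in> borel_measurable borel" by simp
  moreover have "AE t in half_line. q t = ennreal (norm (g t))"
    using q'(2) AE_half_lineI[of "\<lambda>t. 0 < t", OF ] by (auto simp: AE_half_line q_def elim!: eventually_mono)
  moreover have "q t = 0" if "t \<le> 0" for t using that by (simp add: q_def)
  ultimately show ?thesis by (rule that)
qed

context semigroup_estimates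
begin

lemma L2c_domain_powr:
  assumes f: "f \<in> L2c_domain D A"
  shows "(\<lambda>s. complex_of_real (s powr a) *\<^sub>C f s) \<in> L2c_domain D A"
proof (rule L2c_domain_scale[OF f])
  show "(\<lambda>s. complex_of_real (s powr a)) \<in> borel_measurable half_line"
    by (intro borel_measurable_half_line) measurable
  show "\<exists>B. \<forall>s\<in>{u..v}. cmod (complex_of_real (s powr a)) \<le> B" if "0 < u" for u v
  proof -
    have "compact ((\<lambda>s. s powr a) ` {u..v})"
      using that by (intro compact_continuous_image continuous_intros) auto
    then have "bounded ((\<lambda>s. s powr a) ` {u..v})" by (rule compact_imp_bounded)
    then show ?thesis by (auto simp: bounded_iff)
  qed
qed

text \<open>The kernel is \<open>(t powr a - s powr a)\<close> times \<open>A (T (s - t))\<close>.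
  With \<open>x = t / s\<close> the first factor carries \<open>1 - x\<close>, which cancels against
  \<open>s - t = s * (1 - x)\<close> in the bound for the second.\<close>

lemma M_op_commutator:
  assumes f: "f \<in> L2c_domain D A" and t: "0 < t"
    and c: "0 \<le> c" "\<And>x. 0 < x \<Longrightarrow> x < 1 \<Longrightarrow> \<bar>x powr a - 1\<bar> \<le> c * (1 - x) * x powr - \<gamma>"
    and q: "q \<in> borel_measurable borel"
      "AE s in half_line. q s = ennreal (norm (complex_of_real (s powr a) *\<^sub>C f s))"
  shows "ennreal (norm (t powr a *\<^sub>R M_op f t - M_op (\<lambda>s. complex_of_real (s powr a) *\<^sub>C f s) t)) \<le>
    ennreal (C * c) * (ennreal (t powr - \<gamma>) *
      (\<integral>\<^sup>+s. (if t < s then ennreal (s powr (\<gamma> - 1)) * q s else 0) \<partial>lborel))"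
proof -
  let ?R = "restrict_space lborel {t<..}"
  let ?g = "\<lambda>s. complex_of_real (s powr a) *\<^sub>C f s"
  let ?k = "\<lambda>s. t powr a *\<^sub>R A (T (s - t) (f s)) - A (T (s - t) (?g s))"
  have "bochner_has_integral ?R ?k (t powr a *\<^sub>R M_op f t - M_op ?g t)"
    using t by (intro bochner_has_integral_diff M_op_has_integral L2c_domain_powr f
        bochner_has_integral_bounded_linear[OF M_op_has_integral[OF f] bounded_linear_scaleR_right]) auto
  then have "ennreal (norm (t powr a *\<^sub>R M_op f t - M_op ?g t)) \<le> (\<integral>\<^sup>+s. ennreal (norm (?k s)) \<partial>?R)"
    by (rule bochner_has_integral_norm_le)
  also have "\<dots> \<le> (\<integral>\<^sup>+s. ennreal (C * c * t powr - \<gamma>) * (ennreal (s powr (\<gamma> - 1)) * q s) \<partial>?R)"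
  proof (rule nn_integral_mono_AE)
    have "AE s in ?R. t < s" by (rule AE_I2) (simp add: space_restrict_space)
    moreover have "AE s in ?R. q s = ennreal (norm (?g s))"
      using t by (intro AE_restrict_half_line q) auto
    ultimately show "AE s in ?R. ennreal (norm (?k s)) \<le>
        ennreal (C * c * t powr - \<gamma>) * (ennreal (s powr (\<gamma> - 1)) * q s)"
    proof eventually_elim
      case (elim s)
      then have s: "0 < s" "0 < s - t" using t by auto
      define x where "x = t / s"
      have x: "0 < x" "x < 1" "t = s * x" using s t elim by (auto simp: x_def)
      have st: "s - t = s * (1 - x)" using x(3) by (simp add: algebra_simps)
      have "?k s = (t powr a - s powr a) *\<^sub>R A (T (s - t) (f s))"
        using s by (simp add: T_scaleC A_scaleC T_in_D scaleR_scaleC scaleC_diff_left)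
      then have "norm (?k s) = \<bar>t powr a - s powr a\<bar> * norm (A (T (s - t) (f s)))" by simp
      also have "\<dots> \<le> \<bar>t powr a - s powr a\<bar> * (C / (s - t) * norm (f s))"
        by (intro mult_left_mono norm_A_T s) simp
      also have "\<bar>t powr a - s powr a\<bar> = s powr a * \<bar>x powr a - 1\<bar>"
      proof -
        have "t powr a - s powr a = s powr a * (x powr a - 1)"
          unfolding x(3) using s x by (simp add: powr_mult algebra_simps)
        then show ?thesis by (simp add: abs_mult)
      qed
      also have "s powr a * \<bar>x powr a - 1\<bar> * (C / (s - t) * norm (f s)) \<le>
          s powr a * (c * (1 - x) * x powr - \<gamma>) * (C / (s - t) * norm (f s))"
        using c(2)[OF x(1,2)] s C_ge_0 by (intro mult_right_mono mult_left_mono) auto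
      \<comment> \<open>The cancellation: no singularity at \<open>s = t\<close> remains.\<close>
      also have "\<dots> = C * c * (x powr - \<gamma> / s) * (s powr a * norm (f s))"
        unfolding st using x s by (simp add: field_simps)
      also have "x powr - \<gamma> / s = t powr - \<gamma> * s powr (\<gamma> - 1)"
        unfolding x_def using s t by (simp add: powr_divide powr_minus powr_diff field_simps)
      finally have "norm (?k s) \<le> C * c * t powr - \<gamma> * (s powr (\<gamma> - 1) * norm (?g s))"
        by (simp add: mult.assoc)
      then have "ennreal (norm (?k s)) \<le> ennreal (C * c * t powr - \<gamma> * (s powr (\<gamma> - 1) * norm (?g s)))"
        by (rule ennreal_leI)
      also have "\<dots> = ennreal (C * c * t powr - \<gamma>) * (ennreal (s powr (\<gamma> - 1)) * q s)"
        unfolding elim(2) using C_ge_0 c(1)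
        by (subst ennreal_mult[symmetric], simp, simp, subst ennreal_mult[symmetric]) auto
      finally show ?case .
    qed
  qed
  also have "\<dots> = (\<integral>\<^sup>+s. ennreal (C * c * t powr - \<gamma>) * (if t < s then ennreal (s powr (\<gamma> - 1)) * q s else 0) \<partial>lborel)"
    by (subst nn_integral_restrict_space) (auto intro!: nn_integral_cong simp: indicator_def)
  also have "\<dots> = ennreal (C * c * t powr - \<gamma>) * (\<integral>\<^sup>+s. (if t < s then ennreal (s powr (\<gamma> - 1)) * q s else 0) \<partial>lborel)"
  proof (rule nn_integral_cmult)
    note [measurable] = q(1)
    show "(\<lambda>s. if t < s then ennreal (s powr (\<gamma> - 1)) * q s else 0) \<in> borel_measurable lborel"
      by measurable
  qed
  finally show ?thesis using C_ge_0 c(1) by (simp add: ennreal_mult mult.assoc)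
qed

text \<open>Multiplying by \<open>t powr a\<close> turns the weighted norm into the unweighted one.
  It is then moved inside the operator, where the unweighted bound applies, at the cost of the
  commutator, which Hardy's inequality bounds.\<close>

theorem M_op_weighted:
  assumes \<beta>: "- 1 < \<beta>"
  shows "\<exists>B\<ge>0. \<forall>f\<in>L2c_domain D A.
    (\<integral>\<^sup>+t. ennreal (t powr \<beta> * (norm (M_op f t))\<^sup>2) \<partial>half_line) \<le>
    ennreal B * (\<integral>\<^sup>+t. ennreal (t powr \<beta> * (norm (f t))\<^sup>2) \<partial>half_line)"
proof -
  define a where "a = \<beta> / 2"
  have "- 1 / 2 < a" using \<beta> by (simp add: a_def)
  then obtain \<gamma> c where c: "\<gamma> < 1 / 2" "0 \<le> c"
    "\<And>x. 0 < x \<Longrightarrow> x < 1 \<Longrightarrow> \<bar>x powr a - 1\<bar> \<le> c * (1 - x) * x powr - \<gamma>"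
    using powr_minus_one_bound by blast
  define \<kappa> where "\<kappa> = 1 / 2 - \<gamma>"
  \<comment> \<open>The factors 2 come from squaring the sum of the two contributions, and
    \<open>1 / \<kappa>^2\<close> from Hardy's inequality.\<close>
  define B where "B = 2 * M_op_const + 2 * ((C * c)\<^sup>2 * (1 / \<kappa>\<^sup>2))"
  have mc: "0 \<le> M_op_const" by (simp add: M_op_const_def)
  have B: "0 \<le> B" using mc by (simp add: B_def)
  have sq: "(t powr a)\<^sup>2 = t powr \<beta>" for t :: real
    by (simp add: a_def power2_eq_square flip: powr_add)
  have "(\<integral>\<^sup>+t. ennreal (t powr \<beta> * (norm (M_op f t))\<^sup>2) \<partial>half_line) \<le>
    ennreal B * (\<integral>\<^sup>+t. ennreal (t powr \<beta> * (norm (f t))\<^sup>2) \<partial>half_line)" if f: "f \<in> L2c_domain D A" for f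
  proof -
    define g where "g = (\<lambda>s. complex_of_real (s powr a) *\<^sub>C f s)"
    have g: "g \<in> L2c_domain D A" unfolding g_def by (rule L2c_domain_powr[OF f])
    have norm_g: "(norm (g t))\<^sup>2 = t powr \<beta> * (norm (f t))\<^sup>2" for t
      by (simp add: g_def power_mult_distrib sq)
    obtain q where q: "q \<in> borel_measurable borel" "AE t in half_line. q t = ennreal (norm (g t))"
      "\<And>t. t \<le> 0 \<Longrightarrow> q t = 0"
      using strongly_measurable_norm_borel_version[OF L2c_domain_strongly_measurable(1)[OF g]] by blast
    define H where "H = (\<lambda>t. ennreal (t powr - \<gamma>) *
        (\<integral>\<^sup>+s. (if t < s then ennreal (s powr (\<gamma> - 1)) * q s else 0) \<partial>lborel))"
    have H_meas: "(\<lambda>t. if 0 < t then (H t)\<^sup>2 else 0) \<in> borel_measurable borel"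
    proof -
      note [measurable] = q(1)
      have "(\<lambda>t. \<integral>\<^sup>+s. (if t < s then ennreal (s powr (\<gamma> - 1)) * q s else 0) \<partial>lborel) \<in> borel_measurable borel"
        by (rule lborel.borel_measurable_nn_integral) measurable
      then show ?thesis unfolding H_def by measurable
    qed
    have pt: "ennreal (t powr \<beta> * (norm (M_op f t))\<^sup>2) \<le>
        2 * ennreal ((norm (M_op g t))\<^sup>2) + 2 * ennreal ((C * c)\<^sup>2) * (if 0 < t then (H t)\<^sup>2 else 0)"
      if t: "0 < t" for t
    proof -
      let ?d = "t powr a *\<^sub>R M_op f t - M_op g t"
      have "t powr \<beta> * (norm (M_op f t))\<^sup>2 = (norm (M_op g t + ?d))\<^sup>2"
        by (simp add: power_mult_distrib sq)
      also have "\<dots> \<le> 2 * (norm (M_op g t))\<^sup>2 + 2 * (norm ?d)\<^sup>2" by (rule norm_add_square_le)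
      finally have "ennreal (t powr \<beta> * (norm (M_op f t))\<^sup>2) \<le>
          ennreal (2 * (norm (M_op g t))\<^sup>2 + 2 * (norm ?d)\<^sup>2)" by (rule ennreal_leI)
      also have "\<dots> = 2 * ennreal ((norm (M_op g t))\<^sup>2) + 2 * (ennreal (norm ?d))\<^sup>2"
        by (simp add: ennreal_mult ennreal_power)
      also have "(ennreal (norm ?d))\<^sup>2 \<le> (ennreal (C * c) * H t)\<^sup>2"
        unfolding H_def g_def
        by (intro power_mono M_op_commutator f t c q(1) q(2)[unfolded g_def]) auto
      also have "\<dots> = ennreal ((C * c)\<^sup>2) * (H t)\<^sup>2"
        using C_ge_0 c(2) by (simp add: power_mult_distrib ennreal_power)
      finally show ?thesis using t by (simp add: mult.assoc add_left_mono mult_left_mono)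
    qed
    have Mg: "(\<lambda>t. ennreal ((norm (M_op g t))\<^sup>2)) \<in> borel_measurable half_line"
    proof -
      have "continuous_on {0<..} (\<lambda>t. (norm (M_op g t))\<^sup>2)"
        using L2c_domain_M_op_bounded[OF g] unfolding M_op_bounded_def by (intro continuous_intros) auto
      from measurable_compose[OF borel_measurable_half_line_continuous[OF this] measurable_ennreal]
      show ?thesis .
    qed
    let ?h = "\<lambda>t. if 0 < t then (H t)\<^sup>2 else 0"
    have hm: "?h \<in> borel_measurable half_line" by (rule borel_measurable_half_line[OF H_meas])
    have q2: "(\<integral>\<^sup>+s. (if 0 < s then (q s)\<^sup>2 else 0) \<partial>lborel) = (\<integral>\<^sup>+t. ennreal ((norm (g t))\<^sup>2) \<partial>half_line)"
      unfolding nn_integral_half_line using q(2) unfolding AE_half_line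
      by (intro nn_integral_cong_AE) (auto simp: indicator_def ennreal_power elim!: eventually_mono)
    have "(\<integral>\<^sup>+t. ennreal (t powr \<beta> * (norm (M_op f t))\<^sup>2) \<partial>half_line) \<le>
        (\<integral>\<^sup>+t. 2 * ennreal ((norm (M_op g t))\<^sup>2) + 2 * ennreal ((C * c)\<^sup>2) * ?h t \<partial>half_line)"
      using pt by (intro nn_integral_mono) auto
    also have "\<dots> = 2 * (\<integral>\<^sup>+t. ennreal ((norm (M_op g t))\<^sup>2) \<partial>half_line) +
        2 * ennreal ((C * c)\<^sup>2) * (\<integral>\<^sup>+t. ?h t \<partial>half_line)"
      using Mg hm by (subst nn_integral_add) (simp_all add: nn_integral_cmult)
    also have "\<dots> \<le> 2 * (ennreal M_op_const * (\<integral>\<^sup>+t. ennreal ((norm (g t))\<^sup>2) \<partial>half_line)) +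
        2 * ennreal ((C * c)\<^sup>2) * (ennreal (1 / \<kappa>\<^sup>2) * (\<integral>\<^sup>+t. ennreal ((norm (g t))\<^sup>2) \<partial>half_line))"
    proof (intro add_mono mult_left_mono)
      show "(\<integral>\<^sup>+t. ennreal ((norm (M_op g t))\<^sup>2) \<partial>half_line) \<le>
          ennreal M_op_const * (\<integral>\<^sup>+t. ennreal ((norm (g t))\<^sup>2) \<partial>half_line)"
        using L2c_domain_M_op_bounded[OF g] by (simp add: M_op_bounded_def)
      have "(\<integral>\<^sup>+t. ?h t \<partial>half_line) = (\<integral>\<^sup>+t. ?h t \<partial>lborel)"
        unfolding nn_integral_half_line by (intro nn_integral_cong) (auto simp: indicator_def)
      also have "\<dots> \<le> ennreal (1 / \<kappa>\<^sup>2) * (\<integral>\<^sup>+s. (if 0 < s then (q s)\<^sup>2 else 0) \<partial>lborel)"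
        unfolding H_def by (rule Hardy_inequality[OF q(1) c(1) \<kappa>_def])
      finally show "(\<integral>\<^sup>+t. ?h t \<partial>half_line) \<le>
          ennreal (1 / \<kappa>\<^sup>2) * (\<integral>\<^sup>+t. ennreal ((norm (g t))\<^sup>2) \<partial>half_line)" unfolding q2 .
    qed auto
    also have "\<dots> = ennreal B * (\<integral>\<^sup>+t. ennreal ((norm (g t))\<^sup>2) \<partial>half_line)"
    proof -
      have "ennreal B = 2 * ennreal M_op_const + 2 * ennreal ((C * c)\<^sup>2) * ennreal (1 / \<kappa>\<^sup>2)"
      proof -
        have e: "ennreal (2 * m + 2 * (u * v)) = 2 * ennreal m + 2 * ennreal u * ennreal v"
          if "0 \<le> m" "0 \<le> u" "0 \<le> v" for m u v :: real
          using that by (simp add: ennreal_mult mult.assoc)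
        show ?thesis unfolding B_def by (rule e) (use mc in auto)
      qed
      then show ?thesis by (simp add: distrib_right mult.assoc)
    qed
    finally show ?thesis by (simp add: norm_g)
  qed
  with B show ?thesis by blast
qed

end

section \<open>Bounded extension in L2\<close>

text \<open>Squares in \<open>ennreal\<close> allow limits and infinite values to be treated before
  finiteness is known.\<close>

definition L2_square :: "'s measure \<Rightarrow> ('s \<Rightarrow> 'b::real_normed_vector) \<Rightarrow> ennreal" where
  "L2_square M f = (\<integral>\<^sup>+x. ennreal ((norm (f x))\<^sup>2) \<partial>M)"

lemma L2_space_iff: "f \<in> L2_space M \<longleftrightarrow> strongly_measurable M f \<and> L2_square M f < \<infinity>"
  by (simp add: L2_space_def L2_square_def)

lemma L2_norm_eq: "L2_norm M f = sqrt (enn2real (L2_square M f))"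
  by (simp add: L2_norm_def L2_square_def)

lemma L2_square_cong_AE: "(AE x in M. f x = g x) \<Longrightarrow> L2_square M f = L2_square M g"
  unfolding L2_square_def by (intro nn_integral_cong_AE) (auto elim: eventually_mono)

lemma L2_square_add_le:
  assumes f: "strongly_measurable M f" and g: "strongly_measurable M g"
  shows "L2_square M (\<lambda>x. f x + g x) \<le> 2 * L2_square M f + 2 * L2_square M g"
proof -
  have "ennreal ((norm (f x + g x))\<^sup>2) \<le> 2 * ennreal ((norm (f x))\<^sup>2) + 2 * ennreal ((norm (g x))\<^sup>2)" for x
    using ennreal_leI[OF norm_add_square_le[of "f x" "g x"]] by (simp add: ennreal_mult)
  then have "L2_square M (\<lambda>x. f x + g x) \<le>
      (\<integral>\<^sup>+x. 2 * ennreal ((norm (f x))\<^sup>2) + 2 * ennreal ((norm (g x))\<^sup>2) \<partial>M)"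
    unfolding L2_square_def by (rule nn_integral_mono)
  also have "\<dots> = 2 * L2_square M f + 2 * L2_square M g"
    unfolding L2_square_def by (intro nn_integral_completion_linear strongly_measurable_ennreal_norm f g)
  finally show ?thesis .
qed

lemma L2_square_scaleC:
  fixes f :: "'s \<Rightarrow> 'b::complex_inner"
  assumes f: "strongly_measurable M f"
  shows "L2_square M (\<lambda>x. c *\<^sub>C f x) = ennreal ((cmod c)\<^sup>2) * L2_square M f"
  unfolding L2_square_def norm_scaleC power_mult_distrib
  by (rule nn_integral_completion_scale[OF strongly_measurable_ennreal_norm(2)[OF f]]) simp

lemma L2_square_minus_commute: "L2_square M (\<lambda>x. f x - g x) = L2_square M (\<lambda>x. g x - f x)"
  by (simp add: L2_square_def norm_minus_commute)

text \<open>A quasi-triangle inequality: the factor 2 is harmless for convergence and only enlarges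
  the operator bound.\<close>

lemma L2_square_triangle:
  assumes f: "strongly_measurable M f" and g: "strongly_measurable M g" and h: "strongly_measurable M h"
  shows "L2_square M (\<lambda>x. f x - h x) \<le> 2 * L2_square M (\<lambda>x. f x - g x) + 2 * L2_square M (\<lambda>x. g x - h x)"
  using L2_square_add_le[OF strongly_measurable_diff[OF f g] strongly_measurable_diff[OF g h]] by simp

lemma L2_square_eq_0_imp_AE:
  assumes f: "strongly_measurable M f" and "L2_square M f = 0"
  shows "AE x in M. f x = 0"
proof -
  note mf = strongly_measurable_norm[OF f]
  have "(\<integral>\<^sup>+x. ennreal ((norm (f x))\<^sup>2) \<partial>completion M) = 0"
    using assms(2) by (simp add: L2_square_def nn_integral_completion)
  then have "AE x in completion M. ennreal ((norm (f x))\<^sup>2) = 0"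
    using mf by (subst (asm) nn_integral_0_iff_AE) simp_all
  then show ?thesis by (simp add: AE_completion_iff)
qed

lemma L2_square_tendsto_0:
  assumes F: "\<And>n. strongly_measurable M (F n)" and f: "strongly_measurable M f" "L2_square M f < \<infinity>"
    and lim: "AE x in M. (\<lambda>n. F n x) \<longlonglongrightarrow> f x"
    and bound: "\<And>n. AE x in M. norm (F n x) \<le> B * norm (f x)"
  shows "(\<lambda>n. L2_square M (\<lambda>x. F n x - f x)) \<longlonglongrightarrow> 0"
  unfolding L2_square_def
proof (rule nn_integral_dominated_null)
  note mf = strongly_measurable_norm[OF f(1)]
  show "(\<lambda>x. (norm (F n x - f x))\<^sup>2) \<in> borel_measurable (completion M)" for n
    by (intro borel_measurable_power strongly_measurable_norm strongly_measurable_diff F f)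
  show "(\<lambda>x. (2 * B\<^sup>2 + 2) * (norm (f x))\<^sup>2) \<in> borel_measurable (completion M)"
    using mf by simp
  show "AE x in M. (norm (F n x - f x))\<^sup>2 \<le> (2 * B\<^sup>2 + 2) * (norm (f x))\<^sup>2" for n
    using bound[of n]
  proof eventually_elim
    case (elim x)
    have "(norm (F n x))\<^sup>2 \<le> (B * norm (f x))\<^sup>2" using elim by (intro power_mono) auto
    with norm_diff_square_le[of "F n x" "f x"] show ?case
      by (simp add: power_mult_distrib algebra_simps)
  qed
  show "(\<integral>\<^sup>+x. ennreal ((2 * B\<^sup>2 + 2) * (norm (f x))\<^sup>2) \<partial>M) < \<infinity>"
    using f(2) nn_integral_completion_scale[OF strongly_measurable_ennreal_norm(2)[OF f(1)], of "2 * B\<^sup>2 + 2"]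
    by (simp add: L2_square_def ennreal_mult_less_top)
  show "AE x in M. (\<lambda>n. (norm (F n x - f x))\<^sup>2) \<longlonglongrightarrow> 0"
    using lim
  proof eventually_elim
    case (elim x)
    have "(\<lambda>n. (norm (F n x - f x))\<^sup>2) \<longlonglongrightarrow> (norm (f x - f x))\<^sup>2"
      by (intro tendsto_intros elim)
    then show ?case by simp
  qed
qed

lemma L2_simple_approximation:
  assumes f: "f \<in> L2_space M" and e: "0 < e"
  obtains s where "simple_function M s" "L2_square M (\<lambda>x. f x - s x) < e"
proof -
  have fm: "strongly_measurable M f" "L2_square M f < \<infinity>" using f by (auto simp: L2_space_iff)
  obtain s where s: "\<And>i. simple_function M (s i)" "AE x in M. (\<lambda>i. s i x) \<longlonglongrightarrow> f x"
    using fm by (auto simp: strongly_measurable_def)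
  obtain B where B: "\<And>i::nat. B i \<in> sets M"
    "AE x in M. (\<lambda>i. indicat_real (B i) x *\<^sub>R s i x) \<longlonglongrightarrow> f x"
    "AE x in M. \<forall>i. norm (indicat_real (B i) x *\<^sub>R s i x) \<le> 2 * norm (f x)"
    using dominated_simple_functions[OF s] by auto
  define w where "w = (\<lambda>i x. indicat_real (B i) x *\<^sub>R s i x)"
  have w: "simple_function M (w i)" for i
    unfolding w_def using s(1)[of i] B(1)[of i]
    by (intro simple_function_compose2[where h="(*\<^sub>R)"] simple_function_indicator)
  have "(\<lambda>n. L2_square M (\<lambda>x. w n x - f x)) \<longlonglongrightarrow> 0"
  proof (rule L2_square_tendsto_0[where B = 2])
    show "strongly_measurable M (w n)" for n by (rule strongly_measurable_simple[OF w])
    show "AE x in M. norm (w n x) \<le> 2 * norm (f x)" for n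
      unfolding w_def using B(3) by eventually_elim blast
  qed (use B(2) fm in \<open>simp_all add: w_def\<close>)
  then have "\<forall>\<^sub>F n in sequentially. L2_square M (\<lambda>x. w n x - f x) < e"
    using e by (rule order_tendstoD(2))
  then obtain n where "L2_square M (\<lambda>x. w n x - f x) < e"
    by (auto simp: eventually_sequentially)
  then show ?thesis
    using w[of n] that[of "w n"] by (simp add: L2_square_minus_commute)
qed

text \<open>The Riesz-Fischer argument for a rapidly Cauchy sequence. Starting from simple functions
  makes the limit strongly measurable by definition.\<close>

lemma L2_limit_of_simple:
  fixes s :: "nat \<Rightarrow> 's \<Rightarrow> 'b::banach"
  assumes s: "\<And>n. simple_function M (s n)" and c: "0 \<le> c"
    and cauchy: "\<And>n m. n \<le> m \<Longrightarrow> L2_square M (\<lambda>x. s n x - s m x) \<le> ennreal (c / 8 ^ n)"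
  obtains g where "strongly_measurable M g" "\<And>n. L2_square M (\<lambda>x. s n x - g x) \<le> ennreal (c / 8 ^ n)"
proof -
  have sm: "(\<lambda>x. ennreal ((norm (s n x - s m x))\<^sup>2)) \<in> borel_measurable M" for n m
    by (intro borel_measurable_simple_function
        simple_function_compose2[where h = "\<lambda>x y. ennreal ((norm (x - y))\<^sup>2)"] s)
  \<comment> \<open>Of the decay \<open>1 / 8^n\<close>, the weight \<open>4^n\<close> leaves
    \<open>1 / 2^n\<close> for summing the integrals. Finiteness of the weighted sum at a point then
    bounds consecutive distances there by a multiple of \<open>1 / 2^n\<close>, so the sequence
    converges.\<close>
  define d where "d = (\<lambda>n x. ennreal (4 ^ n) * ennreal ((norm (s n x - s (Suc n) x))\<^sup>2))"
  have d: "d n \<in> borel_measurable M" for n unfolding d_def using sm by simp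
  have "(\<integral>\<^sup>+x. (\<Sum>n. d n x) \<partial>M) = (\<Sum>n. \<integral>\<^sup>+x. d n x \<partial>M)"
    by (rule nn_integral_suminf[OF d])
  also have "\<dots> \<le> (\<Sum>n. ennreal (c * (1 / 2) ^ n))"
  proof (rule suminf_le)
    fix n
    have "(\<integral>\<^sup>+x. d n x \<partial>M) = ennreal (4 ^ n) * L2_square M (\<lambda>x. s n x - s (Suc n) x)"
      unfolding d_def L2_square_def by (rule nn_integral_cmult[OF sm])
    also have "\<dots> \<le> ennreal (4 ^ n) * ennreal (c / 8 ^ n)"
      by (intro mult_left_mono cauchy) auto
    also have "\<dots> = ennreal (4 ^ n * (c / 8 ^ n))"
      by (rule ennreal_mult[symmetric]) (use c in auto)
    also have "4 ^ n * (c / 8 ^ n) = c * (1 / 2) ^ n"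
    proof -
      have "(8::real) ^ n = 4 ^ n * 2 ^ n" by (simp flip: power_mult_distrib)
      then show ?thesis by (simp add: power_one_over)
    qed
    finally show "(\<integral>\<^sup>+x. d n x \<partial>M) \<le> ennreal (c * (1 / 2) ^ n)" .
  qed auto
  also have "\<dots> = ennreal (\<Sum>n. c * (1 / 2) ^ n)"
    using c by (intro suminf_ennreal2) (auto intro!: summable_mult summable_geometric)
  finally have "(\<integral>\<^sup>+x. (\<Sum>n. d n x) \<partial>M) \<noteq> \<infinity>" by (auto simp: top_unique)
  then have fin: "AE x in M. (\<Sum>n. d n x) \<noteq> \<infinity>"
    by (intro nn_integral_PInf_AE) (auto intro!: borel_measurable_suminf_order d)
  have conv: "convergent (\<lambda>n. s n x)" if dx: "(\<Sum>n. d n x) \<noteq> \<infinity>" for x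
  proof -
    obtain r where r: "0 \<le> r" "(\<Sum>n. d n x) = ennreal r"
      using dx by (cases "\<Sum>n. d n x") auto
    have "norm (s (Suc n) x - s n x) \<le> sqrt r * (1 / 2) ^ n" for n
    proof -
      have "d n x \<le> ennreal r"
        unfolding r(2)[symmetric] using sum_le_suminf[of "\<lambda>n. d n x" "{n}"] by simp
      then have "4 ^ n * (norm (s n x - s (Suc n) x))\<^sup>2 \<le> r"
        using r(1) by (simp add: d_def flip: ennreal_mult)
      then have "(2 ^ n * norm (s n x - s (Suc n) x))\<^sup>2 \<le> (sqrt r)\<^sup>2"
        using r(1) by (simp add: power_mult_distrib power_mult[symmetric] mult.commute[of n] power_mult[of 2 2 n])
      then have "2 ^ n * norm (s n x - s (Suc n) x) \<le> sqrt r"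
        using r(1) by (rule power2_le_imp_le[OF _ real_sqrt_ge_zero])
      then show ?thesis by (simp add: norm_minus_commute power_one_over field_simps)
    qed
    then have "summable (\<lambda>n. s (Suc n) x - s n x)"
      by (intro summable_comparison_test[OF _ summable_mult[OF summable_geometric[of "1 / 2"]]]) auto
    then have "convergent (\<lambda>n. \<Sum>i<n. s (Suc i) x - s i x)" by (simp add: summable_iff_convergent)
    then have "convergent (\<lambda>n. s n x - s 0 x)" by (simp add: sum_lessThan_telescope[of "\<lambda>n. s n x"])
    then have "convergent (\<lambda>n. (s n x - s 0 x) + s 0 x)" by (intro convergent_add convergent_const)
    then show ?thesis by simp
  qed
  define g where "g = (\<lambda>x. lim (\<lambda>n. s n x))"
  have lim: "AE x in M. (\<lambda>n. s n x) \<longlonglongrightarrow> g x"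
    using fin by eventually_elim (use conv in \<open>simp add: g_def convergent_LIMSEQ_iff\<close>)
  have "strongly_measurable M g" unfolding strongly_measurable_def using s lim by blast
  moreover have "L2_square M (\<lambda>x. s n x - g x) \<le> ennreal (c / 8 ^ n)" for n
  proof -
    have "L2_square M (\<lambda>x. s n x - g x) = (\<integral>\<^sup>+x. liminf (\<lambda>m. ennreal ((norm (s n x - s m x))\<^sup>2)) \<partial>M)"
      unfolding L2_square_def
    proof (rule nn_integral_cong_AE)
      show "AE x in M. ennreal ((norm (s n x - g x))\<^sup>2) = liminf (\<lambda>m. ennreal ((norm (s n x - s m x))\<^sup>2))"
        using lim by eventually_elim (intro lim_imp_Liminf[symmetric] tendsto_ennrealI tendsto_intros, auto)
    qed
    also have "\<dots> \<le> liminf (\<lambda>m. L2_square M (\<lambda>x. s n x - s m x))"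
      unfolding L2_square_def by (rule nn_integral_liminf[OF sm])
    also have "\<dots> \<le> liminf (\<lambda>m. ennreal (c / 8 ^ n))"
      by (rule Liminf_mono) (use cauchy[of n] in \<open>auto simp: eventually_sequentially\<close>)
    finally show ?thesis by (simp add: Liminf_const)
  qed
  ultimately show ?thesis by (rule that)
qed

lemma L2_null_add:
  assumes "\<And>n. strongly_measurable M (v n)" "\<And>n. strongly_measurable M (v' n)"
    and "\<And>n. AE x in M. w n x = v n x + v' n x"
    and "(\<lambda>n. L2_square M (v n)) \<longlonglongrightarrow> 0" "(\<lambda>n. L2_square M (v' n)) \<longlonglongrightarrow> 0"
  shows "(\<lambda>n. L2_square M (w n)) \<longlonglongrightarrow> 0"
proof (rule tendsto_sandwich[OF _ _ tendsto_const])
  have "(\<lambda>n. 2 * L2_square M (v n) + 2 * L2_square M (v' n)) \<longlonglongrightarrow> 2 * 0 + 2 * 0"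
    by (intro tendsto_add ennreal_tendsto_cmult assms) auto
  then show "(\<lambda>n. 2 * L2_square M (v n) + 2 * L2_square M (v' n)) \<longlonglongrightarrow> 0" by simp
  have "L2_square M (w n) \<le> 2 * L2_square M (v n) + 2 * L2_square M (v' n)" for n
    unfolding L2_square_cong_AE[OF assms(3)] by (rule L2_square_add_le[OF assms(1,2)])
  then show "\<forall>\<^sub>F n in sequentially. L2_square M (w n) \<le> 2 * L2_square M (v n) + 2 * L2_square M (v' n)"
    by simp
qed simp

text \<open>Extension by density, for functions in place of classes: all identities for the
  extension hold almost everywhere only.\<close>

theorem extends_to_bounded_operator_L2I:
  fixes F :: "('s \<Rightarrow> 'b::chilbert_space) \<Rightarrow> 's \<Rightarrow> 'b"
  assumes V: "V \<subseteq> L2_space M"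
    and V_add: "\<And>f g. f \<in> V \<Longrightarrow> g \<in> V \<Longrightarrow> (\<lambda>x. f x + g x) \<in> V"
    and V_scaleC: "\<And>c f. f \<in> V \<Longrightarrow> (\<lambda>x. c *\<^sub>C f x) \<in> V"
    and F_meas: "\<And>f. f \<in> V \<Longrightarrow> strongly_measurable M (F f)"
    and F_add: "\<And>f g. f \<in> V \<Longrightarrow> g \<in> V \<Longrightarrow> AE x in M. F (\<lambda>y. f y + g y) x = F f x + F g x"
    and F_scaleC: "\<And>c f. f \<in> V \<Longrightarrow> AE x in M. F (\<lambda>y. c *\<^sub>C f y) x = c *\<^sub>C F f x"
    and B: "0 \<le> B" and bound: "\<And>f. f \<in> V \<Longrightarrow> L2_square M (F f) \<le> ennreal B * L2_square M f"
    and dense: "\<And>f e. f \<in> L2_space M \<Longrightarrow> 0 < e \<Longrightarrow> \<exists>g\<in>V. L2_square M (\<lambda>x. f x - g x) < e"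
  shows "extends_to_bounded_operator_L2 M V F"
proof -
  have Vm: "strongly_measurable M f" if "f \<in> V" for f using that V by (auto simp: L2_space_iff)
  have F_diff: "L2_square M (\<lambda>x. F f x - F g x) \<le> ennreal B * L2_square M (\<lambda>x. f x - g x)"
    if f: "f \<in> V" and g: "g \<in> V" for f g
  proof -
    let ?g = "\<lambda>x. (-1) *\<^sub>C g x"
    have "AE x in M. F f x - F g x = F (\<lambda>y. f y + ?g y) x"
      using F_add[OF f V_scaleC[OF g, of "-1"]] F_scaleC[OF g, of "-1"]
      by eventually_elim (simp add: scaleC_minus_one)
    then have "L2_square M (\<lambda>x. F f x - F g x) = L2_square M (F (\<lambda>y. f y + ?g y))"
      by (rule L2_square_cong_AE)
    also have "\<dots> \<le> ennreal B * L2_square M (\<lambda>y. f y + ?g y)"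
      by (intro bound V_add f V_scaleC g)
    finally show ?thesis by (simp add: scaleC_minus_one)
  qed
  \<comment> \<open>The closure of the graph of \<open>F\<close> in \<open>L2\<close>. Working with
    a relation postpones the choice of representatives until uniqueness almost everywhere has been
    shown.\<close>
  define R where "R = (\<lambda>f g. strongly_measurable M f \<and> strongly_measurable M g \<and>
    (\<exists>u. (\<forall>n::nat. u n \<in> V) \<and> (\<lambda>n. L2_square M (\<lambda>x. u n x - f x)) \<longlonglongrightarrow> 0 \<and>
      (\<lambda>n. L2_square M (\<lambda>x. F (u n) x - g x)) \<longlonglongrightarrow> 0))"
  have R_exists: "\<exists>g. R f g" if f: "f \<in> L2_space M" for f
  proof -
    have fm: "strongly_measurable M f" using f by (simp add: L2_space_iff)
    have "\<exists>u\<in>V. L2_square M (\<lambda>x. f x - u x) < ennreal (1 / 8 ^ n)" for n :: nat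
      by (rule dense[OF f]) simp
    then obtain u where u: "\<And>n::nat. u n \<in> V" "\<And>n. L2_square M (\<lambda>x. f x - u n x) < ennreal (1 / 8 ^ n)"
      by metis
    have FL: "F (u n) \<in> L2_space M" for n
    proof -
      have "L2_square M (u n) < \<infinity>" using u(1)[of n] V by (auto simp: L2_space_iff)
      then have "L2_square M (F (u n)) < \<infinity>"
        by (intro le_less_trans[OF bound[OF u(1)]]) (simp add: ennreal_mult_less_top)
      then show ?thesis using F_meas[OF u(1)] by (simp add: L2_space_iff)
    qed
    \<comment> \<open>The images are replaced by nearby simple functions so that
      \<open>L2_limit_of_simple\<close> applies.\<close>
    have "\<exists>s. simple_function M s \<and> L2_square M (\<lambda>x. F (u n) x - s x) < ennreal (1 / 8 ^ n)" for n
      by (rule L2_simple_approximation[OF FL[of n], of "ennreal (1 / 8 ^ n)"]) auto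
    then obtain s where s: "\<And>n. simple_function M (s n)"
      "\<And>n. L2_square M (\<lambda>x. F (u n) x - s n x) < ennreal (1 / 8 ^ n)"
      by metis
    note m = fm Vm[OF u(1)] F_meas[OF u(1)] strongly_measurable_simple[OF s(1)]
    \<comment> \<open>The total of the nested quasi-triangle estimates from \<open>s n\<close>
      through \<open>F (u n)\<close> and \<open>F (u k)\<close> to \<open>s k\<close>, each link
      costing \<open>1 / 8^n\<close> or \<open>B\<close> times four of these.\<close>
    define c where "c = 6 + 16 * B"
    have "L2_square M (\<lambda>x. s n x - s k x) \<le> ennreal (c / 8 ^ n)" if "n \<le> k" for n k
    proof -
      let ?e = "1 / 8 ^ n :: real"
      have ek: "(1 / 8 ^ k :: real) \<le> ?e" using that by (intro divide_left_mono power_increasing) auto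
      have 1: "L2_square M (\<lambda>x. s j x - F (u j) x) \<le> ennreal ?e" if "j = n \<or> j = k" for j
        using s(2)[of j] ek that by (auto simp: L2_square_minus_commute intro: order_trans ennreal_leI less_imp_le)
      have 2: "L2_square M (\<lambda>x. f x - u j x) \<le> ennreal ?e" if "j = n \<or> j = k" for j
        using u(2)[of j] ek that by (auto intro: order_trans ennreal_leI less_imp_le)
      have "L2_square M (\<lambda>x. u n x - u k x) \<le> 2 * L2_square M (\<lambda>x. u n x - f x) + 2 * L2_square M (\<lambda>x. f x - u k x)"
        by (intro L2_square_triangle m)
      also have "\<dots> \<le> 2 * ennreal ?e + 2 * ennreal ?e"
        using 2[of n] 2[of k] by (intro add_mono mult_left_mono) (auto simp: L2_square_minus_commute)
      finally have "ennreal B * L2_square M (\<lambda>x. u n x - u k x) \<le> ennreal B * (2 * ennreal ?e + 2 * ennreal ?e)"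
        by (rule mult_left_mono) simp
      with F_diff[OF u(1) u(1), of n k]
      have 3: "L2_square M (\<lambda>x. F (u n) x - F (u k) x) \<le> ennreal B * (2 * ennreal ?e + 2 * ennreal ?e)"
        by (rule order_trans)
      have "L2_square M (\<lambda>x. s n x - s k x) \<le>
          2 * L2_square M (\<lambda>x. s n x - F (u n) x) + 2 * L2_square M (\<lambda>x. F (u n) x - s k x)"
        by (intro L2_square_triangle m)
      also have "\<dots> \<le> 2 * ennreal ?e + 2 * (2 * (ennreal B * (2 * ennreal ?e + 2 * ennreal ?e)) + 2 * ennreal ?e)"
      proof (intro add_mono mult_left_mono 1)
        have "L2_square M (\<lambda>x. F (u n) x - s k x) \<le>
            2 * L2_square M (\<lambda>x. F (u n) x - F (u k) x) + 2 * L2_square M (\<lambda>x. F (u k) x - s k x)"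
          by (intro L2_square_triangle m)
        also have "\<dots> \<le> 2 * (ennreal B * (2 * ennreal ?e + 2 * ennreal ?e)) + 2 * ennreal ?e"
          using 1[of k] by (intro add_mono mult_left_mono 3) (auto simp: L2_square_minus_commute)
        finally show "L2_square M (\<lambda>x. F (u n) x - s k x) \<le>
            2 * (ennreal B * (2 * ennreal ?e + 2 * ennreal ?e)) + 2 * ennreal ?e" .
      qed auto
      also have "\<dots> = ennreal (c / 8 ^ n)"
      proof -
        have "2 * ennreal e + 2 * (2 * (ennreal B * (2 * ennreal e + 2 * ennreal e)) + 2 * ennreal e) =
            ennreal (2 * e + 2 * (2 * (B * (2 * e + 2 * e)) + 2 * e))" if "0 \<le> e" for e
        proof -
          have n: "2 * ennreal x = ennreal (2 * x)" if "0 \<le> x" for x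
            using that by (simp add: ennreal_mult)
          show ?thesis
            using that B by (simp only: n ennreal_plus[symmetric] ennreal_mult[symmetric]
                mult_nonneg_nonneg add_nonneg_nonneg zero_le_numeral)
        qed
        from this[of ?e] show ?thesis by (simp add: c_def add_divide_distrib)
      qed
      finally show ?thesis .
    qed
    moreover have "0 \<le> c" using B by (simp add: c_def)
    ultimately obtain g where g: "strongly_measurable M g" "\<And>n. L2_square M (\<lambda>x. s n x - g x) \<le> ennreal (c / 8 ^ n)"
      using L2_limit_of_simple[of M s c] s(1) by blast
    have geom: "(\<lambda>n. ennreal (b / 8 ^ n)) \<longlonglongrightarrow> 0" for b :: real
    proof -
      have "(\<lambda>n. b * (1 / 8) ^ n) \<longlonglongrightarrow> b * 0"
        by (intro tendsto_intros LIMSEQ_power_zero) simp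
      from tendsto_ennrealI[OF this] show ?thesis by (simp add: power_one_over)
    qed
    have "(\<lambda>n. L2_square M (\<lambda>x. u n x - f x)) \<longlonglongrightarrow> 0"
      by (rule tendsto_sandwich[OF _ _ tendsto_const geom[of 1]])
        (use u(2) in \<open>auto intro!: always_eventually less_imp_le simp: L2_square_minus_commute\<close>)
    moreover have "(\<lambda>n. L2_square M (\<lambda>x. F (u n) x - g x)) \<longlonglongrightarrow> 0"
    proof (rule L2_null_add)
      show "(\<lambda>n. L2_square M (\<lambda>x. F (u n) x - s n x)) \<longlonglongrightarrow> 0"
        by (rule tendsto_sandwich[OF _ _ tendsto_const geom[of 1]])
          (use s(2) in \<open>auto intro!: always_eventually less_imp_le\<close>)
      show "(\<lambda>n. L2_square M (\<lambda>x. s n x - g x)) \<longlonglongrightarrow> 0"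
        by (rule tendsto_sandwich[OF _ _ tendsto_const geom[of c]]) (use g(2) in auto)
    qed (auto intro!: strongly_measurable_diff m g)
    ultimately have "R f g" unfolding R_def using fm g(1) u(1) by blast
    then show ?thesis by (intro exI[of _ g])
  qed
  \<comment> \<open>Two quasi-triangle inequalities, one in the image and one in the argument, turn
    \<open>B\<close> into \<open>4 * B\<close>.\<close>
  have R_bound: "L2_square M g \<le> ennreal (4 * B) * L2_square M f" if r: "R f g" for f g
  proof -
    obtain u where m: "strongly_measurable M f" "strongly_measurable M g" and u: "\<And>n::nat. u n \<in> V"
      "(\<lambda>n. L2_square M (\<lambda>x. u n x - f x)) \<longlonglongrightarrow> 0" "(\<lambda>n. L2_square M (\<lambda>x. F (u n) x - g x)) \<longlonglongrightarrow> 0"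
      using r unfolding R_def by blast
    have le: "L2_square M g \<le> 2 * L2_square M (\<lambda>x. F (u n) x - g x) +
        2 * (ennreal B * (2 * L2_square M (\<lambda>x. u n x - f x) + 2 * L2_square M f))" for n
    proof -
      have a: "L2_square M (\<lambda>x. g x - 0) \<le> 2 * L2_square M (\<lambda>x. g x - F (u n) x) + 2 * L2_square M (\<lambda>x. F (u n) x - 0)"
        by (intro L2_square_triangle m F_meas u strongly_measurable_const)
      have "L2_square M (\<lambda>x. u n x - 0) \<le> 2 * L2_square M (\<lambda>x. u n x - f x) + 2 * L2_square M (\<lambda>x. f x - 0)"
        by (intro L2_square_triangle m Vm u strongly_measurable_const)
      then have "ennreal B * L2_square M (u n) \<le> ennreal B * (2 * L2_square M (\<lambda>x. u n x - f x) + 2 * L2_square M f)"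
        by (intro mult_left_mono) auto
      with bound[OF u(1), of n]
      have "L2_square M (F (u n)) \<le> ennreal B * (2 * L2_square M (\<lambda>x. u n x - f x) + 2 * L2_square M f)"
        by (rule order_trans)
      then have b: "2 * L2_square M (\<lambda>x. F (u n) x - g x) + 2 * L2_square M (F (u n)) \<le>
          2 * L2_square M (\<lambda>x. F (u n) x - g x) + 2 * (ennreal B * (2 * L2_square M (\<lambda>x. u n x - f x) + 2 * L2_square M f))"
        by (intro add_left_mono mult_left_mono) auto
      show ?thesis
        using order_trans[OF a[unfolded L2_square_minus_commute[of M g] diff_0_right] b] .
    qed
    have "(\<lambda>n. 2 * L2_square M (\<lambda>x. F (u n) x - g x) +
        2 * (ennreal B * (2 * L2_square M (\<lambda>x. u n x - f x) + 2 * L2_square M f))) \<longlonglongrightarrow>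
        2 * 0 + 2 * (ennreal B * (2 * 0 + 2 * L2_square M f))"
      by (intro tendsto_add ennreal_tendsto_cmult u tendsto_const) auto
    then have "L2_square M g \<le> 2 * 0 + 2 * (ennreal B * (2 * 0 + 2 * L2_square M f))"
      by (rule LIMSEQ_le_const) (use le in auto)
    also have "\<dots> = ennreal (4 * B) * L2_square M f"
      using B by (simp add: ennreal_mult mult.assoc[symmetric]) (simp add: mult.commute mult.left_commute)
    finally show ?thesis .
  qed
  have R_add: "R (\<lambda>x. f x + f' x) (\<lambda>x. g x + g' x)" if r: "R f g" "R f' g'" for f g f' g'
  proof -
    obtain u where m: "strongly_measurable M f" "strongly_measurable M g" and u: "\<And>n::nat. u n \<in> V"
      "(\<lambda>n. L2_square M (\<lambda>x. u n x - f x)) \<longlonglongrightarrow> 0" "(\<lambda>n. L2_square M (\<lambda>x. F (u n) x - g x)) \<longlonglongrightarrow> 0"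
      using r(1) unfolding R_def by blast
    obtain u' where m': "strongly_measurable M f'" "strongly_measurable M g'" and u': "\<And>n::nat. u' n \<in> V"
      "(\<lambda>n. L2_square M (\<lambda>x. u' n x - f' x)) \<longlonglongrightarrow> 0" "(\<lambda>n. L2_square M (\<lambda>x. F (u' n) x - g' x)) \<longlonglongrightarrow> 0"
      using r(2) unfolding R_def by blast
    have "(\<lambda>n. L2_square M (\<lambda>x. (u n x + u' n x) - (f x + f' x))) \<longlonglongrightarrow> 0"
      by (rule L2_null_add[OF _ _ _ u(2) u'(2)])
        (auto intro!: strongly_measurable_diff Vm[OF u(1)] Vm[OF u'(1)] m m' simp: algebra_simps)
    moreover have "(\<lambda>n. L2_square M (\<lambda>x. F (\<lambda>y. u n y + u' n y) x - (g x + g' x))) \<longlonglongrightarrow> 0"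
    proof (rule L2_null_add[OF _ _ _ u(3) u'(3)])
      show "AE x in M. F (\<lambda>y. u n y + u' n y) x - (g x + g' x) = (F (u n) x - g x) + (F (u' n) x - g' x)" for n
        using F_add[OF u(1)[of n] u'(1)[of n]] by eventually_elim simp
    qed (intro strongly_measurable_diff F_meas u u' m m')+
    ultimately show ?thesis
      unfolding R_def using m m' V_add[OF u(1) u'(1)]
      by (intro conjI strongly_measurable_add exI[of _ "\<lambda>n x. u n x + u' n x"] allI) auto
  qed
  have R_scaleC: "R (\<lambda>x. c *\<^sub>C f x) (\<lambda>x. c *\<^sub>C g x)" if r: "R f g" for f g c
  proof -
    obtain u where m: "strongly_measurable M f" "strongly_measurable M g" and u: "\<And>n::nat. u n \<in> V"
      "(\<lambda>n. L2_square M (\<lambda>x. u n x - f x)) \<longlonglongrightarrow> 0" "(\<lambda>n. L2_square M (\<lambda>x. F (u n) x - g x)) \<longlonglongrightarrow> 0"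
      using r(1) unfolding R_def by blast
    have null: "(\<lambda>n. ennreal ((cmod c)\<^sup>2) * z n) \<longlonglongrightarrow> 0" if "z \<longlonglongrightarrow> 0" for z
      using ennreal_tendsto_cmult[OF _ that, of "ennreal ((cmod c)\<^sup>2)"] by simp
    have "L2_square M (\<lambda>x. c *\<^sub>C u n x - c *\<^sub>C f x) = ennreal ((cmod c)\<^sup>2) * L2_square M (\<lambda>x. u n x - f x)" for n
      using L2_square_scaleC[OF strongly_measurable_diff[OF Vm[OF u(1)[of n]] m(1)], of c]
      by (simp add: scaleC_diff_right)
    moreover have "L2_square M (\<lambda>x. F (\<lambda>y. c *\<^sub>C u n y) x - c *\<^sub>C g x) =
        ennreal ((cmod c)\<^sup>2) * L2_square M (\<lambda>x. F (u n) x - g x)" for n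
    proof -
      have "AE x in M. F (\<lambda>y. c *\<^sub>C u n y) x - c *\<^sub>C g x = c *\<^sub>C (F (u n) x - g x)"
        using F_scaleC[OF u(1)[of n], of c] by eventually_elim (simp add: scaleC_diff_right)
      from L2_square_cong_AE[OF this] show ?thesis
        using L2_square_scaleC[OF strongly_measurable_diff[OF F_meas[OF u(1)[of n]] m(2)], of c] by simp
    qed
    ultimately show ?thesis
      unfolding R_def using m V_scaleC[OF u(1)] null[OF u(2)] null[OF u(3)]
      by (intro conjI strongly_measurable_scaleC exI[of _ "\<lambda>n x. c *\<^sub>C u n x"] allI) auto
  qed
  have R_cong: "R f' g" if "R f g" "AE x in M. f x = f' x" for f f' g
  proof -
    have "L2_square M (\<lambda>x. u x - f' x) = L2_square M (\<lambda>x. u x - f x)" for u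
      by (rule L2_square_cong_AE) (use that(2) in \<open>auto elim: eventually_mono\<close>)
    then show ?thesis
      using that(1) strongly_measurable_cong_AE[OF _ that(2)] unfolding R_def by simp
  qed
  \<comment> \<open>By linearity the difference of two images is related to 0, and
    \<open>R_bound\<close> makes it vanish.\<close>
  have R_unique: "AE x in M. g x = g' x" if "R f g" "R f g'" for f g g'
  proof -
    have "R (\<lambda>x. f x + (-1) *\<^sub>C f x) (\<lambda>x. g x + (-1) *\<^sub>C g' x)"
      by (intro R_add R_scaleC that)
    then have d: "R (\<lambda>x. 0) (\<lambda>x. g x - g' x)" by (simp add: scaleC_minus_one)
    have "L2_square M (\<lambda>x. g x - g' x) = 0"
      using R_bound[OF d] by (simp add: L2_square_def)
    moreover have "strongly_measurable M (\<lambda>x. g x - g' x)" using d by (simp add: R_def)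
    ultimately have "AE x in M. g x - g' x = 0" by (intro L2_square_eq_0_imp_AE)
    then show ?thesis by eventually_elim simp
  qed
  have R_V: "R f (F f)" if "f \<in> V" for f
    unfolding R_def using that Vm F_meas
    by (intro conjI exI[of _ "\<lambda>_. f"]) (auto simp: L2_square_def)
  \<comment> \<open>An arbitrary representative; linearity up to null sets comes from
    \<open>R_unique\<close>.\<close>
  define T where "T = (\<lambda>f. SOME g. R f g)"
  have RT: "R f (T f)" if "f \<in> L2_space M" for f
    unfolding T_def using R_exists[OF that] by (rule someI_ex)
  have add_L2: "(\<lambda>x. f x + g x) \<in> L2_space M" if "f \<in> L2_space M" "g \<in> L2_space M" for f g :: "'s \<Rightarrow> 'b"
  proof -
    have m: "strongly_measurable M f" "strongly_measurable M g" using that by (auto simp: L2_space_iff)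
    have "2 * L2_square M f + 2 * L2_square M g < \<infinity>"
      using that by (auto simp: L2_space_iff ennreal_mult_less_top)
    with L2_square_add_le[OF m] show ?thesis
      unfolding L2_space_iff using m by (blast intro: strongly_measurable_add le_less_trans)
  qed
  have scale_L2: "(\<lambda>x. c *\<^sub>C f x) \<in> L2_space M" if "f \<in> L2_space M" for f :: "'s \<Rightarrow> 'b" and c
    using that by (auto simp: L2_space_iff L2_square_scaleC ennreal_mult_less_top intro: strongly_measurable_scaleC)
  have "bounded_operator_L2 M T"
    unfolding bounded_operator_L2_def
  proof (intro conjI ballI allI impI)
    show "T f \<in> L2_space M" if f: "f \<in> L2_space M" for f
    proof -
      have "ennreal (4 * B) * L2_square M f < \<infinity>"
        using f by (simp add: L2_space_iff ennreal_mult_less_top)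
      with R_bound[OF RT[OF f]] have "L2_square M (T f) < \<infinity>" by (rule le_less_trans)
      then show ?thesis using RT[OF f] by (simp add: L2_space_iff R_def)
    qed
    show "AE x in M. T f x = T g x" if "f \<in> L2_space M" "g \<in> L2_space M" "AE x in M. f x = g x" for f g
      by (rule R_unique[OF R_cong[OF RT[OF that(1)] that(3)] RT[OF that(2)]])
    show "AE x in M. T (\<lambda>y. f y + g y) x = T f x + T g x" if "f \<in> L2_space M" "g \<in> L2_space M" for f g
      by (rule R_unique[OF RT[OF add_L2[OF that]] R_add[OF RT[OF that(1)] RT[OF that(2)]]])
    show "AE x in M. T (\<lambda>y. c *\<^sub>C f y) x = c *\<^sub>C T f x" if "f \<in> L2_space M" for c f
      by (rule R_unique[OF RT[OF scale_L2[OF that]] R_scaleC[OF RT[OF that]]])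
    show "\<exists>C. \<forall>f\<in>L2_space M. L2_norm M (T f) \<le> C * L2_norm M f"
    proof (intro exI ballI)
      fix f :: "'s \<Rightarrow> 'b" assume f: "f \<in> L2_space M"
      have "enn2real (L2_square M (T f)) \<le> enn2real (ennreal (4 * B) * L2_square M f)"
        using R_bound[OF RT[OF f]] f by (intro enn2real_mono) (auto simp: L2_space_iff ennreal_mult_less_top)
      then have "enn2real (L2_square M (T f)) \<le> 4 * B * enn2real (L2_square M f)"
        using B by (simp add: enn2real_mult)
      then show "L2_norm M (T f) \<le> sqrt (4 * B) * L2_norm M f"
        unfolding L2_norm_eq real_sqrt_mult[symmetric] by (rule real_sqrt_le_mono)
    qed
  qed
  moreover have "AE x in M. T f x = F f x" if "f \<in> V" for f
    by (rule R_unique[OF RT R_V]) (use that V in auto)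
  ultimately show ?thesis
    unfolding extends_to_bounded_operator_L2_def using V by blast
qed

section \<open>The weighted half-line\<close>

lemma simple_function_weighted_half_line [simp]:
  "simple_function (weighted_half_line \<beta>) f \<longleftrightarrow> simple_function half_line f"
  unfolding weighted_half_line_def by (rule simple_function_cong_algebra) auto

text \<open>The density is positive on the whole half-line, so the null sets are the same for every
  \<beta>.\<close>

lemma AE_weighted_half_line: "(AE t in weighted_half_line \<beta>. P t) \<longleftrightarrow> (AE t in half_line. P t)"
proof -
  have "(\<lambda>t. ennreal (t powr \<beta>)) \<in> borel_measurable half_line"
    by (intro borel_measurable_half_line) measurable
  then show ?thesis
    unfolding weighted_half_line_def by (simp add: AE_density AE_half_line)
qed

lemma strongly_measurable_weighted_half_line [simp]:
  "strongly_measurable (weighted_half_line \<beta>) f \<longleftrightarrow> strongly_measurable half_line f"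
  by (simp add: strongly_measurable_def AE_weighted_half_line)

lemma L2_square_weighted_half_line:
  assumes "strongly_measurable half_line f"
  shows "L2_square (weighted_half_line \<beta>) f = (\<integral>\<^sup>+t. ennreal (t powr \<beta> * (norm (f t))\<^sup>2) \<partial>half_line)"
proof -
  obtain q :: "real \<Rightarrow> ennreal" where q: "q \<in> borel_measurable borel"
    "AE t in half_line. q t = ennreal (norm (f t))"
    by (rule strongly_measurable_norm_borel_version[OF assms])
  have m: "(\<lambda>t. ennreal (t powr \<beta>)) \<in> borel_measurable half_line" "(\<lambda>t. (q t)\<^sup>2) \<in> borel_measurable half_line"
    using q(1) by (auto intro!: borel_measurable_half_line)
  have "AE t in weighted_half_line \<beta>. ennreal ((norm (f t))\<^sup>2) = (q t)\<^sup>2"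
    unfolding AE_weighted_half_line using q(2) by eventually_elim (simp add: ennreal_power)
  then have "L2_square (weighted_half_line \<beta>) f = (\<integral>\<^sup>+t. (q t)\<^sup>2 \<partial>weighted_half_line \<beta>)"
    unfolding L2_square_def by (rule nn_integral_cong_AE)
  also have "\<dots> = (\<integral>\<^sup>+t. ennreal (t powr \<beta>) * (q t)\<^sup>2 \<partial>half_line)"
    unfolding weighted_half_line_def by (rule nn_integral_density[OF m])
  also have "\<dots> = (\<integral>\<^sup>+t. ennreal (t powr \<beta> * (norm (f t))\<^sup>2) \<partial>half_line)"
    by (rule nn_integral_cong_AE) (use q(2) in \<open>auto simp: ennreal_power ennreal_mult elim: eventually_mono\<close>)
  finally show ?thesis .
qed

context semigroup_estimates
begin

text \<open>Multiplication by \<open>s powr (\<beta> / 2)\<close> preserves the initial domain,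
  since supports are compact in the open half-line.\<close>

lemma L2c_domain_subset_L2: "L2c_domain D A \<subseteq> L2_space (weighted_half_line \<beta>)"
proof
  fix f assume f: "f \<in> L2c_domain D A"
  note fm = L2c_domain_strongly_measurable(1)[OF f]
  let ?g = "\<lambda>s. complex_of_real (s powr (\<beta> / 2)) *\<^sub>C f s"
  have "(t powr (\<beta> / 2))\<^sup>2 = t powr \<beta>" for t
    by (simp add: power2_eq_square flip: powr_add)
  then have "t powr \<beta> * (norm (f t))\<^sup>2 = (norm (?g t))\<^sup>2" for t
    by (simp add: power_mult_distrib)
  then have "(\<integral>\<^sup>+t. ennreal (t powr \<beta> * (norm (f t))\<^sup>2) \<partial>half_line) \<le>
      (\<integral>\<^sup>+t. ennreal ((norm (?g t))\<^sup>2 + (norm (A (?g t)))\<^sup>2) \<partial>half_line)"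
    by (intro nn_integral_mono ennreal_leI) simp
  also have "\<dots> < \<infinity>" by (rule L2c_domain_integral[OF L2c_domain_powr[OF f]])
  finally show "f \<in> L2_space (weighted_half_line \<beta>)"
    using fm by (simp add: L2_space_iff L2_square_weighted_half_line)
qed

text \<open>The bound by \<open>norm x\<close> preserves domination of an approximating sequence,
  the bound by \<open>e\<close> its limit.\<close>

lemma approximation_in_D:
  assumes "0 < e"
  shows "\<exists>y. (\<forall>x. y x \<in> D) \<and> (\<forall>x. norm (x - y x) \<le> norm x) \<and> (\<forall>x. norm (x - y x) \<le> e)"
proof -
  have "\<exists>y\<in>D. norm (x - y) \<le> norm x \<and> norm (x - y) \<le> e" for x
  proof (cases "x = 0")
    case True
    then show ?thesis using D_zero assms by (intro bexI[of _ 0]) auto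
  next
    case False
    have "x \<in> closure D" using D_dense by simp
    moreover have "0 < min (norm x) e" using False assms by simp
    ultimately obtain y where "y \<in> D" "dist y x < min (norm x) e"
      unfolding closure_approachable by blast
    then show ?thesis by (intro bexI[of _ y]) (auto simp: dist_norm norm_minus_commute)
  qed
  then show ?thesis by metis
qed

text \<open>Values of simple approximants are moved into \<open>D\<close> and the support is cut to
  a compact interval. A simple function has finitely many values, so its graph norm is bounded,
  although nothing is approximated in the graph norm.\<close>

lemma L2c_domain_dense:
  assumes f: "f \<in> L2_space (weighted_half_line \<beta>)" and e: "0 < e"
  shows "\<exists>g\<in>L2c_domain D A. L2_square (weighted_half_line \<beta>) (\<lambda>t. f t - g t) < e"
proof -
  let ?M = "weighted_half_line \<beta>"
  have fm: "strongly_measurable half_line f" "L2_square ?M f < \<infinity>" using f by (auto simp: L2_space_iff)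
  obtain s where s: "\<And>i. simple_function half_line (s i)" "AE x in half_line. (\<lambda>i. s i x) \<longlonglongrightarrow> f x"
    using fm by (auto simp: strongly_measurable_def)
  obtain B where B: "\<And>i::nat. B i \<in> sets half_line"
    "AE t in half_line. (\<lambda>i. indicat_real (B i) t *\<^sub>R s i t) \<longlonglongrightarrow> f t"
    "AE t in half_line. \<forall>i. norm (indicat_real (B i) t *\<^sub>R s i t) \<le> 2 * norm (f t)"
    using dominated_simple_functions[OF s] by auto
  define w where "w = (\<lambda>i t. indicat_real (B i) t *\<^sub>R s i t)"
  have w: "simple_function half_line (w i)" for i
    unfolding w_def using s(1)[of i] B(1)[of i]
    by (intro simple_function_compose2[where h="(*\<^sub>R)"] simple_function_indicator)
  have "\<exists>y. (\<forall>x. y x \<in> D) \<and> (\<forall>x. norm (x - y x) \<le> norm x) \<and> (\<forall>x. norm (x - y x) \<le> 1 / real (Suc n))" for n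
    by (rule approximation_in_D) simp
  then obtain y where y: "\<And>n x. y n x \<in> D" "\<And>n x. norm (x - y n x) \<le> norm x"
    "\<And>n x. norm (x - y n x) \<le> 1 / real (Suc n)"
    by metis
  define I where "I = (\<lambda>n. {1 / real (Suc n)..real (Suc n)})"
  define v where "v = (\<lambda>n t. indicat_real (I n) t *\<^sub>R y n (w n t))"
  have v: "simple_function half_line (v n)" for n
  proof -
    have "I n \<in> sets half_line"
      unfolding I_def by (intro sets_half_line) (auto intro: less_le_trans[of 0 "1 / real (Suc n)"])
    then show ?thesis
      unfolding v_def using simple_function_compose1[OF w[of n], of "y n"]
      by (intro simple_function_compose2[where h="(*\<^sub>R)"] simple_function_indicator)
  qed
  have vD: "v n t \<in> D" for n t unfolding v_def by (intro D_scaleR y)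
  have "v n \<in> L2c_domain D A" for n
  proof -
    let ?P = "v n ` {0<..}"
    let ?c = "\<Sum>x\<in>?P. (norm x)\<^sup>2 + (norm (A x))\<^sup>2"
    have P: "finite ?P" using v[of n] by (simp add: simple_function_def)
    have c: "0 \<le> ?c" by (intro sum_nonneg) auto
    show ?thesis
    proof (rule L2c_domainI[where s = "\<lambda>_. v n" and a = "1 / real (Suc n)" and b = "real (Suc n)"
          and w = "\<lambda>t. ?c * indicat_real (I n) t"])
      show "AE t in half_line. (norm (v n t))\<^sup>2 + (norm (A (v n t)))\<^sup>2 \<le> ?c * indicat_real (I n) t"
      proof (rule AE_half_lineI)
        fix t :: real assume t: "0 < t"
        show "(norm (v n t))\<^sup>2 + (norm (A (v n t)))\<^sup>2 \<le> ?c * indicat_real (I n) t"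
        proof (cases "t \<in> I n")
          case True
          have "(norm (v n t))\<^sup>2 + (norm (A (v n t)))\<^sup>2 \<le> ?c"
            using P t by (intro member_le_sum) auto
          then show ?thesis using True by simp
        qed (simp add: v_def)
      qed
      show "(\<integral>\<^sup>+t. ennreal (?c * indicat_real (I n) t) \<partial>half_line) < \<infinity>"
        unfolding I_def by (rule indicator_Icc_integral_finite)
      show "AE t in half_line. t \<notin> {1 / real (Suc n)..real (Suc n)} \<longrightarrow> v n t = 0"
        by (rule AE_half_lineI) (auto simp: v_def I_def)
    qed (use v vD in auto)
  qed
  moreover have "(\<lambda>n. L2_square ?M (\<lambda>t. v n t - f t)) \<longlonglongrightarrow> 0"
  proof (rule L2_square_tendsto_0[where B = 4])
    have pos: "AE t in half_line. 0 < t" by (rule AE_half_lineI)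
    show "AE t in ?M. (\<lambda>n. v n t) \<longlonglongrightarrow> f t"
      unfolding AE_weighted_half_line using B(2) pos
    proof eventually_elim
      case (elim t)
      have wl: "(\<lambda>n. w n t) \<longlonglongrightarrow> f t" using elim(1) by (simp add: w_def)
      have "(\<lambda>n. w n t - y n (w n t)) \<longlonglongrightarrow> 0"
        by (rule Lim_null_comparison[OF _ LIMSEQ_inverse_real_of_nat])
          (use y(3) in \<open>auto simp: inverse_eq_divide\<close>)
      from tendsto_diff[OF wl this] have yl: "(\<lambda>n. y n (w n t)) \<longlonglongrightarrow> f t" by simp
      have "\<forall>\<^sub>F n in sequentially. 1 / real (Suc n) < t"
        using order_tendstoD(2)[OF LIMSEQ_inverse_real_of_nat elim(2)] by (simp add: inverse_eq_divide)
      moreover have "\<forall>\<^sub>F n in sequentially. t < real (Suc n)"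
        using filterlim_compose[OF filterlim_real_sequentially filterlim_Suc]
        by (auto simp: filterlim_at_top_dense)
      ultimately have "\<forall>\<^sub>F n in sequentially. y n (w n t) = v n t"
        by eventually_elim (simp add: v_def I_def)
      with yl show ?case by (rule Lim_transform_eventually)
    qed
    show "AE t in ?M. norm (v n t) \<le> 4 * norm (f t)" for n
      unfolding AE_weighted_half_line using B(3)
    proof eventually_elim
      case (elim t)
      have "norm (v n t) \<le> norm (y n (w n t))" by (auto simp: v_def indicator_def)
      also have "\<dots> \<le> norm (w n t) + norm (w n t - y n (w n t))"
        using norm_triangle_ineq4[of "w n t" "w n t - y n (w n t)"] by simp
      also have "\<dots> \<le> 2 * norm (w n t)" using y(2)[of "w n t" n] by simp
      also have "\<dots> \<le> 4 * norm (f t)" using elim by (simp add: w_def)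
      finally show ?case .
    qed
  qed (use v fm in \<open>auto intro: strongly_measurable_simple\<close>)
  then have "\<forall>\<^sub>F n in sequentially. L2_square ?M (\<lambda>t. v n t - f t) < e"
    using e by (rule order_tendstoD(2))
  then obtain n where "L2_square ?M (\<lambda>t. v n t - f t) < e"
    by (auto simp: eventually_sequentially)
  ultimately show ?thesis by (intro bexI[of _ "v n"]) (simp_all add: L2_square_minus_commute)
qed

theorem M_op_extends:
  assumes \<beta>: "- 1 < \<beta>"
  shows "extends_to_bounded_operator_L2 (weighted_half_line \<beta>) (L2c_domain D A) M_op"
proof -
  have Mm: "strongly_measurable half_line (M_op f)" if "f \<in> L2c_domain D A" for f
    using strongly_measurable_continuous_on[of 0 "M_op f"] L2c_domain_M_op_bounded[OF that]
    by (simp add: half_line_def M_op_bounded_def)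
  obtain B where B: "0 \<le> B" "\<And>f. f \<in> L2c_domain D A \<Longrightarrow>
    (\<integral>\<^sup>+t. ennreal (t powr \<beta> * (norm (M_op f t))\<^sup>2) \<partial>half_line) \<le>
    ennreal B * (\<integral>\<^sup>+t. ennreal (t powr \<beta> * (norm (f t))\<^sup>2) \<partial>half_line)"
    using M_op_weighted[OF \<beta>] by blast
  show ?thesis
  proof (rule extends_to_bounded_operator_L2I[OF L2c_domain_subset_L2 _ _ _ _ _ B(1)])
    show "(\<lambda>x. c *\<^sub>C f x) \<in> L2c_domain D A" if "f \<in> L2c_domain D A" for c f
      by (rule L2c_domain_scale[OF that]) auto
    show "L2_square (weighted_half_line \<beta>) (M_op f) \<le> ennreal B * L2_square (weighted_half_line \<beta>) f"
      if "f \<in> L2c_domain D A" for f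
      using B(2)[OF that] Mm[OF that] L2c_domain_strongly_measurable(1)[OF that]
      by (simp add: L2_square_weighted_half_line)
  qed (auto simp: AE_weighted_half_line Mm L2c_domain_add M_op_add M_op_scaleC
      intro!: AE_half_lineI L2c_domain_dense)
qed

end

text \<open>Integrability is part of the conclusion because \<open>bochner_integral\<close> is a
  \<open>THE\<close> description: it ensures that the formula for \<open>M_minus\<close> denotes a
  genuine integral.\<close>

theorem corollary1p4:
  fixes D :: "'a::chilbert_space set"
    and A :: "'a \<Rightarrow> 'a"
    and S :: "complex \<Rightarrow> 'a \<Rightarrow> 'a"
    and \<delta> \<beta> :: real
  assumes "densely_defined_closed_operator D A"
    and "0 < \<delta>" and "\<delta> < pi / 2"
    and "bounded_analytic_semigroup \<delta> S"
    and "is_generator S D (\<lambda>x. - A x)"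
    and "-1 < \<beta>"
  shows "(\<forall>f \<in> L2c_domain D A. \<forall>t>0.
            bochner_integrable (restrict_space lborel {t<..}) (M_minus_integrand A S f t)) \<and>
         extends_to_bounded_operator_L2 (weighted_half_line \<beta>) (L2c_domain D A) (M_minus A S)"
proof -
  obtain K C where "semigroup_estimates D A (\<lambda>t. S (complex_of_real t)) K C"
    using bounded_analytic_semigroup_estimates[OF assms(1-5)] by blast
  then interpret semigroup_estimates D A "\<lambda>t. S (complex_of_real t)" K C .
  have integrand: "M_minus_integrand A S f t = (\<lambda>s. A (S (complex_of_real (s - t)) (f s)))" for f t
    by (rule ext) (simp add: M_minus_integrand_def)
  have "M_minus A S = M_op"
    by (intro ext) (simp add: M_minus_def M_op_def integrand)
  then show ?thesis
    using M_op_integrable M_op_extends[OF assms(6)] by (simp add: integrand)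
qed

end
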